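(* Let $k$ be a field of characteristic $2$ and let $C/k$ be an elliptic curve in $\mu_4$-normal form, i.e. for some $s\in k$, $$(X_0+X_2)^2=X_1X_3,\qquad s(X_1+X_3)^2=X_0X_2,$$ in $\mathbb{P}^3$, with identity $\mathrm{O}=(1:1:0:1)$. A basis for the space of addition laws of bidegree $(2,2)$ for $C$ is given by the four tuples $$\big((X_0Y_0+X_2Y_2)^2,\ X_0X_1Y_0Y_1+X_2X_3Y_2Y_3,\ s(X_1Y_1+X_3Y_3)^2,\ X_0X_3Y_0Y_3+X_1X_2Y_1Y_2\big),$$ $$\big(X_0X_1Y_0Y_3+X_2X_3Y_1Y_2,\ (X_1Y_0+X_3Y_2)^2,\ X_0X_3Y_2Y_3+X_1X_2Y_0Y_1,\ (X_0Y_3+X_2Y_1)^2\big),$$ $$\big(s(X_1Y_3+X_3Y_1)^2,\ X_0X_3Y_1Y_2+X_1X_2Y_0Y_3,\ (X_0Y_2+X_2Y_0)^2,\ X_0X_1Y_2Y_3+X_2X_3Y_0Y_1\big),$$ $$\big(X_0X_3Y_0Y_1+X_1X_2Y_2Y_3,\ (X_0Y_1+X_2Y_3)^2,\ X_0X_1Y_1Y_2+X_2X_3Y_0Y_3,\ (X_1Y_2+X_3Y_0)^2\big).$$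
   Context: $X_i$ and $Y_i$ denote the coordinates on the first and second factor of $C\times C\subset\mathbb{P}^3\times\mathbb{P}^3$, and $\mu:C\times C\to C$ is the addition morphism. An elliptic curve is nonsingular, so $s\ne0$. An addition law of bidegree $(2,2)$ is a tuple $(p_0,p_1,p_2,p_3)$ of polynomials of bidegree $(2,2)$ in $(X_j),(Y_j)$, taken modulo the bihomogeneous ideal of $C\times C$, such that $(p_0:p_1:p_2:p_3)$ equals $\mu$ on the (nonempty open) complement of the common zeros of the $p_i$; together with the zero tuple these form a $k$-vector space. (This form is obtained from the split $\mu_4$-normal form $(X_0+X_2)^2=c^2X_1X_3$, $(X_1+X_3)^2=c^2X_0X_2$, with identity $(c:1:0:1)$, by rescaling the coordinates $X_1,X_3$ by $c$ and setting $s=c^{-4}$.) *)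

theory Defs
  imports
    "HOL-Analysis.Cartesian_Space"
    "HOL-Library.Poly_Mapping"
    "HOL-Algebra.Algebraic_Closure_Type"
begin

section \<open>Multivariate polynomials and tuples of them\<close>

text \<open>
  A polynomial over \<open>'a\<close> with variables indexed by \<open>'v\<close> is a finitely supported function from
  exponent vectors to coefficients.
\<close>

type_synonym ('v, 'a) mpoly = "('v \<Rightarrow>\<^sub>0 nat) \<Rightarrow>\<^sub>0 'a"

definition cst :: "'a::zero \<Rightarrow> ('v, 'a) mpoly" where
  "cst c = Poly_Mapping.single 0 c"

definition mvar :: "'v \<Rightarrow> ('v, 'a::zero_neq_one) mpoly" where
  "mvar v = Poly_Mapping.single (Poly_Mapping.single v 1) 1"

text \<open>Evaluation at \<open>z\<close>, the coefficients being mapped by \<open>h\<close> into the ring where \<open>z\<close> lives.\<close>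

definition mpoly_eval ::
  "('a::zero \<Rightarrow> 'b::comm_semiring_1) \<Rightarrow> ('v::finite, 'a) mpoly \<Rightarrow> ('v \<Rightarrow> 'b) \<Rightarrow> 'b" where
  "mpoly_eval h p z =
     (\<Sum>m\<in>Poly_Mapping.keys p.
        h (Poly_Mapping.lookup p m) * (\<Prod>v\<in>UNIV. z v ^ Poly_Mapping.lookup m v))"

definition tuple_eval ::
  "('a::zero \<Rightarrow> 'b::comm_semiring_1) \<Rightarrow> ('v::finite, 'a) mpoly ^ 4 \<Rightarrow> ('v \<Rightarrow> 'b) \<Rightarrow> 'b ^ 4" where
  "tuple_eval h p z = (\<chi> j. mpoly_eval h (p $ j) z)"

definition homogeneous :: "nat \<Rightarrow> ('v::finite, 'a::zero) mpoly \<Rightarrow> bool" where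
  "homogeneous d p \<longleftrightarrow>
     (\<forall>m\<in>Poly_Mapping.keys p. (\<Sum>v\<in>UNIV. Poly_Mapping.lookup m v) = d)"

text \<open>
  The variable \<open>Inl i\<close> is the coordinate \<open>X\<^sub>i\<close> on the first factor of a product of two projective
  3-spaces, \<open>Inr i\<close> is the coordinate \<open>Y\<^sub>i\<close> on the second. The index type \<open>4\<close> has the
  elements \<open>0, 1, 2, 3\<close>.
\<close>

abbreviation Xv :: "4 \<Rightarrow> (4 + 4, 'a::zero_neq_one) mpoly" where "Xv i \<equiv> mvar (Inl i)"
abbreviation Yv :: "4 \<Rightarrow> (4 + 4, 'a::zero_neq_one) mpoly" where "Yv i \<equiv> mvar (Inr i)"

definition bihomogeneous :: "nat \<Rightarrow> nat \<Rightarrow> (4 + 4, 'a::zero) mpoly \<Rightarrow> bool" where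
  "bihomogeneous d e p \<longleftrightarrow>
     (\<forall>m\<in>Poly_Mapping.keys p.
        (\<Sum>i\<in>UNIV. Poly_Mapping.lookup m (Inl i)) = d \<and>
        (\<Sum>i\<in>UNIV. Poly_Mapping.lookup m (Inr i)) = e)"

definition at_pair :: "'b ^ 4 \<Rightarrow> 'b ^ 4 \<Rightarrow> 4 + 4 \<Rightarrow> 'b" where
  "at_pair x y = case_sum (($) x) (($) y)"

text \<open>The built-in \<open>vector\<close> numbers its entries from 1; here they are numbered from 0.\<close>

definition quad :: "'a \<Rightarrow> 'a \<Rightarrow> 'a \<Rightarrow> 'a \<Rightarrow> 'a ^ 4" where
  "quad a b c d = (\<chi> i. if i = 0 then a else if i = 1 then b else if i = 2 then c else d)"

definition tuple_scale :: "'a::comm_ring_1 \<Rightarrow> ('v, 'a) mpoly ^ 4 \<Rightarrow> ('v, 'a) mpoly ^ 4" where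
  "tuple_scale c p = (\<chi> j. cst c * p $ j)"

global_interpretation tuple: vector_space "tuple_scale :: 'a::field \<Rightarrow> _"
  by standard
    (simp_all add: tuple_scale_def cst_def vec_eq_iff algebra_simps single_add mult_single
      flip: mult.assoc)


section \<open>Bases of quotient spaces\<close>

text \<open>
  For subspaces \<open>N\<close>, \<open>V\<close>: the residue classes of the members of the family \<open>b\<close> form a basis of
  \<open>(V + N) / N\<close>, i.e. of \<open>V\<close> taken modulo \<open>N\<close>.
\<close>

definition (in vector_space) basis_modulo :: "'b set \<Rightarrow> 'b set \<Rightarrow> 'b ^ 'i::finite \<Rightarrow> bool" where
  "basis_modulo N V b \<longleftrightarrow>
     (\<forall>i. b $ i \<in> V) \<and>
     (\<forall>c. (\<Sum>i\<in>UNIV. scale (c i) (b $ i)) \<in> N \<longrightarrow> (\<forall>i. c i = 0)) \<and>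
     (\<forall>v\<in>V. \<exists>c. v - (\<Sum>i\<in>UNIV. scale (c i) (b $ i)) \<in> N)"


section \<open>The curve and its addition morphism\<close>

text \<open>
  Varieties over the base field \<open>'k\<close> are described by their points over the algebraic closure.
  The point of projective 3-space with homogeneous coordinates \<open>x\<close> is the line spanned by \<open>x\<close>.
  In characteristic 2, \<open>curve s\<close> is nonsingular if and only if \<open>s \<noteq> 0\<close>.
\<close>

definition proj :: "'a::field ^ 4 \<Rightarrow> ('a ^ 4) set" where
  "proj x = vec.span {x}"

definition curve_coords :: "'k::field \<Rightarrow> ('k alg_closure ^ 4) set" where
  "curve_coords s =
     {x. x \<noteq> 0 \<and> (x $ 0 + x $ 2)\<^sup>2 = x $ 1 * x $ 3 \<and> to_ac s * (x $ 1 + x $ 3)\<^sup>2 = x $ 0 * x $ 2}"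

definition curve :: "'k::field \<Rightarrow> ('k alg_closure ^ 4) set set" where
  "curve s = proj ` curve_coords s"

definition origin :: "('k::field alg_closure ^ 4) set" where
  "origin = proj (quad 1 1 0 1)"

text \<open>
  A morphism from the curve, or from its product with itself, to the curve is a map which near
  every point is given by homogeneous, or bihomogeneous, polynomials of the same (bi)degree.
  It suffices to have, for every point, one tuple not vanishing there that gives the map wherever
  the tuple does not vanish: a tuple giving the map only on a neighbourhood can be multiplied by a
  polynomial that vanishes outside a smaller one.
\<close>

definition curve_morphism ::
  "'k::field \<Rightarrow> (('k alg_closure ^ 4) set \<Rightarrow> ('k alg_closure ^ 4) set) \<Rightarrow> bool" where
  "curve_morphism s f \<longleftrightarrow>
     f \<in> curve s \<rightarrow> curve s \<and>
     (\<forall>x\<in>curve_coords s. \<exists>d (p :: (4, 'k alg_closure) mpoly ^ 4).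
        (\<forall>j. homogeneous d (p $ j)) \<and> tuple_eval id p (($) x) \<noteq> 0 \<and>
        (\<forall>x'\<in>curve_coords s. tuple_eval id p (($) x') \<noteq> 0 \<longrightarrow>
           f (proj x') = proj (tuple_eval id p (($) x'))))"

definition gives_on_product ::
  "('a::zero \<Rightarrow> 'k::field alg_closure) \<Rightarrow> 'k \<Rightarrow> (4 + 4, 'a) mpoly ^ 4 \<Rightarrow>
     (('k alg_closure ^ 4) set \<Rightarrow> ('k alg_closure ^ 4) set \<Rightarrow> ('k alg_closure ^ 4) set) \<Rightarrow> bool" where
  "gives_on_product h s p f \<longleftrightarrow>
     (\<forall>x\<in>curve_coords s. \<forall>y\<in>curve_coords s. tuple_eval h p (at_pair x y) \<noteq> 0 \<longrightarrow>
        f (proj x) (proj y) = proj (tuple_eval h p (at_pair x y)))"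

definition product_morphism ::
  "'k::field \<Rightarrow>
     (('k alg_closure ^ 4) set \<Rightarrow> ('k alg_closure ^ 4) set \<Rightarrow> ('k alg_closure ^ 4) set) \<Rightarrow> bool" where
  "product_morphism s f \<longleftrightarrow>
     f \<in> curve s \<rightarrow> curve s \<rightarrow> curve s \<and>
     (\<forall>x\<in>curve_coords s. \<forall>y\<in>curve_coords s. \<exists>d e (p :: (4 + 4, 'k alg_closure) mpoly ^ 4).
        (\<forall>j. bihomogeneous d e (p $ j)) \<and> tuple_eval id p (at_pair x y) \<noteq> 0 \<and>
        gives_on_product id s p f)"

text \<open>
  The addition morphism of an elliptic curve is the multiplication of its structure of a group
  variety whose neutral element is the given base point; by the rigidity lemma there is only one
  such structure.
\<close>

definition curve_group ::
  "'k::field \<Rightarrow>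
     (('k alg_closure ^ 4) set \<Rightarrow> ('k alg_closure ^ 4) set \<Rightarrow> ('k alg_closure ^ 4) set) \<Rightarrow>
     ('k alg_closure ^ 4) set monoid" where
  "curve_group s \<mu> = \<lparr>carrier = curve s, monoid.mult = \<mu>, one = origin\<rparr>"

definition addition_morphism ::
  "'k::field \<Rightarrow>
     (('k alg_closure ^ 4) set \<Rightarrow> ('k alg_closure ^ 4) set \<Rightarrow> ('k alg_closure ^ 4) set) \<Rightarrow> bool" where
  "addition_morphism s \<mu> \<longleftrightarrow>
     Group.group (curve_group s \<mu>) \<and> product_morphism s \<mu> \<and>
     curve_morphism s (m_inv (curve_group s \<mu>))"


section \<open>Addition laws\<close>

text \<open>
  Tuples whose entries lie in the ideal of the product of the curve with itself, i.e. vanish at all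
  its geometric points. (The algebraic closure being infinite, a polynomial that vanishes at all
  homogeneous coordinates of these points has bihomogeneous components that all do so as well.)
\<close>

definition ideal_tuples :: "'k::field \<Rightarrow> ((4 + 4, 'k) mpoly ^ 4) set" where
  "ideal_tuples s =
     {p. \<forall>j. \<forall>x\<in>curve_coords s. \<forall>y\<in>curve_coords s. mpoly_eval to_ac (p $ j) (at_pair x y) = 0}"

definition addition_law ::
  "nat \<Rightarrow> nat \<Rightarrow> 'k::field \<Rightarrow>
     (('k alg_closure ^ 4) set \<Rightarrow> ('k alg_closure ^ 4) set \<Rightarrow> ('k alg_closure ^ 4) set) \<Rightarrow>
     (4 + 4, 'k) mpoly ^ 4 \<Rightarrow> bool" where
  "addition_law d e s \<mu> p \<longleftrightarrow>
     (\<forall>j. bihomogeneous d e (p $ j)) \<and> p \<notin> ideal_tuples s \<and> gives_on_product to_ac s p \<mu>"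

text \<open>The addition laws and the representatives of the zero tuple modulo the ideal.\<close>

definition addition_law_space ::
  "nat \<Rightarrow> nat \<Rightarrow> 'k::field \<Rightarrow>
     (('k alg_closure ^ 4) set \<Rightarrow> ('k alg_closure ^ 4) set \<Rightarrow> ('k alg_closure ^ 4) set) \<Rightarrow>
     ((4 + 4, 'k) mpoly ^ 4) set" where
  "addition_law_space d e s \<mu> =
     {p. addition_law d e s \<mu> p} \<union> {p \<in> ideal_tuples s. \<forall>j. bihomogeneous d e (p $ j)}"

end

theory Submission
  imports Defs
begin

text \<open>
  Let \<open>O = (1:1:0:1)\<close>. Evaluated at \<open>(x, O)\<close>, the \<open>i\<close>-th law is \<open>x $ i\<close> times \<open>x\<close>; in general the \<open>4 \<times> 4\<close> matrix of the
  entries of the four laws has rank one on the curve, with rows proportional to \<open>x + y\<close> and columns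
  proportional to \<open>x - y\<close>. That the laws give the addition morphism is rigidity: the point
  \<open>(0:1:1:1)\<close> has the Weierstrass complement \<open>v\<^sup>2 + w v = s w\<^sup>3 + 1\<close>, and an automorphism fixing that point
  preserves pole orders, hence is \<open>1\<close> or \<open>-1\<close>; so translations are unique up to a sign, which is
  constant. Conversely, the restriction of a law to the pairs \<open>(x, O)\<close> is \<open>x\<close> times a section
  of the hyperplane bundle, i.e. a linear form in the \<open>x $ i\<close>. A law with zero restriction vanishes
  on every curve \<open>x - y = const\<close>, since there its quotient by one of the four laws is a regular
  function.
\<close>

text \<open>The group law \<open>\<mu>\<close> is given abstractly, while the tuples define an
  explicit addition \<open>padd\<close>. About \<open>padd\<close> only polynomial identities are
  computed: a neutral element, commutativity and \<open>(x - y) + y = x\<close>. That it agrees with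
  \<open>\<mu>\<close> is left to rigidity.

  The affine chart omits \<open>infty\<close> rather than \<open>org\<close> because the plane
  \<open>x $ 0 = 0\<close> meets the curve nowhere else. The coordinate ring of the chart is free
  over the polynomials in \<open>w\<close> with basis 1, \<open>v\<close>, so a function is a pair
  of polynomials and its pole order is the degree of a norm. Regularity is only known locally, as a
  quotient of forms; integral closedness of this ring turns it into a pair of polynomials. Pole
  order at most 4 leaves the span of 1, \<open>w\<close>, \<open>v\<close>, \<open>w^2\<close>,
  which are exactly the linear forms: hence four laws.

  Points live over the algebraic closure, but the coefficients of a combination have to lie in the
  base field. Therefore forms carry a set \<open>S\<close> of admissible coefficients.\<close>

no_notation fps_nth (infixl "$" 75)

section \<open>The addition laws as functions of coordinates\<close>

lemma forall_index4: "(\<forall>i::4. P i) \<longleftrightarrow> P 0 \<and> P 1 \<and> P 2 \<and> P 3"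
proof -
  have "(4::4) = 0" by simp
  then show ?thesis using forall_4[of P] by metis
qed

lemma sum_index4: "(\<Sum>i\<in>(UNIV::4 set). f i) = f 0 + f 1 + f 2 + (f 3 :: 'b::comm_monoid_add)"
proof -
  have "(4::4) = 0" by simp
  then show ?thesis using sum_4[of f] by (simp only:) (simp add: ac_simps)
qed

text \<open>The increasing pairs index the 2 by 2 minors that have to be computed; the others follow
  by symmetry or are trivial.\<close>

definition index_pairs :: "(4 \<times> 4) set" where
  "index_pairs = {(0,1), (0,2), (0,3), (1,2), (1,3), (2,3)}"

lemma index_pairs_total: "(i, j) \<in> index_pairs \<or> i = j \<or> (j, i) \<in> index_pairs"
proof -
  have "\<forall>i j. (i, j) \<in> index_pairs \<or> i = j \<or> (j, i) \<in> index_pairs"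
    by (simp add: forall_index4 index_pairs_def)
  then show ?thesis by blast
qed

lemma minors_index_pairs:
  fixes x y :: "'a::comm_semiring_0 ^ 4"
  assumes "\<And>i j. (i, j) \<in> index_pairs \<Longrightarrow> x $ i * y $ j = x $ j * y $ i"
  shows "x $ i * y $ j = x $ j * y $ i"
  using index_pairs_total[of i j] assms[of i j] assms[of j i] by auto

lemma quad_nth [simp]:
  "quad a b c d $ 0 = a" "quad a b c d $ 1 = b" "quad a b c d $ 2 = c" "quad a b c d $ 3 = d"
  by (simp_all add: quad_def)

lemma vec_eq_iff4: "(x :: 'b ^ 4) = y \<longleftrightarrow> x $ 0 = y $ 0 \<and> x $ 1 = y $ 1 \<and> x $ 2 = y $ 2 \<and> x $ 3 = y $ 3"
  by (simp add: vec_eq_iff forall_index4)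

text \<open>Inversion on the curve for the neutral element \<open>(1:1:0:1)\<close>.\<close>

definition neg4 :: "'a ^ 4 \<Rightarrow> 'a ^ 4" where
  "neg4 x = quad (x $ 0) (x $ 3) (x $ 2) (x $ 1)"

text \<open>Translation by the point \<open>(0:1:1:1)\<close> of order two, the image of
  \<open>(1:1:0:1)\<close> under this map.\<close>

definition shift4 :: "'a ^ 4 \<Rightarrow> 'a ^ 4" where
  "shift4 x = quad (x $ 2) (x $ 3) (x $ 0) (x $ 1)"

lemma neg4_nth [simp]:
  "neg4 x $ 0 = x $ 0" "neg4 x $ 1 = x $ 3" "neg4 x $ 2 = x $ 2" "neg4 x $ 3 = x $ 1"
  by (simp_all add: neg4_def)

lemma shift4_nth [simp]:
  "shift4 x $ 0 = x $ 2" "shift4 x $ 1 = x $ 3" "shift4 x $ 2 = x $ 0" "shift4 x $ 3 = x $ 1"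
  by (simp_all add: shift4_def)

lemma neg4_neg4 [simp]: "neg4 (neg4 x) = x"
  by (simp add: vec_eq_iff4)

lemma shift4_shift4 [simp]: "shift4 (shift4 x) = x"
  by (simp add: vec_eq_iff4)

definition proportional :: "'a::field ^ 4 \<Rightarrow> 'a ^ 4 \<Rightarrow> bool" (infix "\<propto>" 50) where
  "x \<propto> y \<longleftrightarrow> (\<exists>c. c \<noteq> 0 \<and> y = c *s x)"

lemma proportional_refl [simp]: "x \<propto> x"
  unfolding proportional_def by (rule exI[of _ 1]) simp

lemma proportional_sym: "x \<propto> y \<Longrightarrow> y \<propto> x"
  unfolding proportional_def
proof (elim exE conjE)
  fix c assume "c \<noteq> 0" "y = c *s x"
  then have "x = inverse c *s y" by (simp add: vector_smult_assoc)
  with \<open>c \<noteq> 0\<close> show "\<exists>c. c \<noteq> 0 \<and> x = c *s y" by (intro exI[of _ "inverse c"]) simp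
qed

lemma proportional_trans [trans]: "x \<propto> y \<Longrightarrow> y \<propto> z \<Longrightarrow> x \<propto> z"
  unfolding proportional_def by (metis mult_eq_0_iff vector_smult_assoc)

lemma proportional_smult: "c \<noteq> 0 \<Longrightarrow> c *s x \<propto> x"
  by (rule proportional_sym) (auto simp: proportional_def)

lemma proportional_nth_eq_0: "x \<propto> y \<Longrightarrow> x $ i = 0 \<longleftrightarrow> y $ i = 0"
  by (auto simp: proportional_def)

lemma proportional_minors:
  assumes "x \<noteq> 0" "y \<noteq> 0" "\<And>i j. x $ i * y $ j = x $ j * y $ i"
  shows "x \<propto> y"
proof -
  from assms(1) obtain i where i: "x $ i \<noteq> 0" by (auto simp: vec_eq_iff)
  define c where "c = y $ i / x $ i"
  have "y $ j = c * x $ j" for j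
    using assms(3)[of i j] i by (simp add: c_def field_simps)
  then have "y = c *s x" by (simp add: vec_eq_iff)
  with assms(2) show ?thesis unfolding proportional_def by (intro exI[of _ c]) auto
qed

lemma proportional_minorsD: "x \<propto> y \<Longrightarrow> x $ i * y $ j = x $ j * y $ i"
  by (auto simp: proportional_def)

lemma neg4_cong: "x \<propto> y \<Longrightarrow> neg4 x \<propto> neg4 y"
  unfolding proportional_def by (auto simp: vec_eq_iff4)

lemma shift4_cong: "x \<propto> y \<Longrightarrow> shift4 x \<propto> shift4 y"
  unfolding proportional_def by (auto simp: vec_eq_iff4)

lemma proj_eq_iff: "x \<noteq> 0 \<Longrightarrow> y \<noteq> 0 \<Longrightarrow> proj x = proj y \<longleftrightarrow> x \<propto> y"
proof
  assume "x \<noteq> 0" "y \<noteq> 0" and eq: "proj x = proj y"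
  have "y \<in> vec.span {x}" using eq by (simp add: proj_def vec.span_base)
  then obtain c where "y = c *s x" by (auto simp: vec.span_singleton)
  with \<open>y \<noteq> 0\<close> show "x \<propto> y" by (auto simp: proportional_def)
next
  have *: "proj (c *s x) \<subseteq> proj x" for c and x :: "'a ^ 4"
    by (auto simp: proj_def vec.span_singleton vector_smult_assoc)
  assume "x \<propto> y"
  then show "proj x = proj y" using * by (metis proportional_def proportional_sym subset_antisym)
qed

section \<open>The curve in characteristic 2 and its four explicit laws\<close>

locale mu4_form =
  fixes s :: "'a::field"
  assumes char2: "(2::'a) = 0" and s_nonzero: "s \<noteq> 0"
begin

definition cone :: "('a ^ 4) set" where
  "cone = {x. x \<noteq> 0 \<and> (x $ 0 + x $ 2)\<^sup>2 = x $ 1 * x $ 3 \<and> s * (x $ 1 + x $ 3)\<^sup>2 = x $ 0 * x $ 2}"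

definition law :: "4 \<Rightarrow> 'a ^ 4 \<Rightarrow> 'a ^ 4 \<Rightarrow> 'a ^ 4" where
  "law i x y = quad
    (quad ((x $ 0 * y $ 0 + x $ 2 * y $ 2)\<^sup>2)
          (x $ 0 * x $ 1 * y $ 0 * y $ 1 + x $ 2 * x $ 3 * y $ 2 * y $ 3)
          (s * (x $ 1 * y $ 1 + x $ 3 * y $ 3)\<^sup>2)
          (x $ 0 * x $ 3 * y $ 0 * y $ 3 + x $ 1 * x $ 2 * y $ 1 * y $ 2))
    (quad (x $ 0 * x $ 1 * y $ 0 * y $ 3 + x $ 2 * x $ 3 * y $ 1 * y $ 2)
          ((x $ 1 * y $ 0 + x $ 3 * y $ 2)\<^sup>2)
          (x $ 0 * x $ 3 * y $ 2 * y $ 3 + x $ 1 * x $ 2 * y $ 0 * y $ 1)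
          ((x $ 0 * y $ 3 + x $ 2 * y $ 1)\<^sup>2))
    (quad (s * (x $ 1 * y $ 3 + x $ 3 * y $ 1)\<^sup>2)
          (x $ 0 * x $ 3 * y $ 1 * y $ 2 + x $ 1 * x $ 2 * y $ 0 * y $ 3)
          ((x $ 0 * y $ 2 + x $ 2 * y $ 0)\<^sup>2)
          (x $ 0 * x $ 1 * y $ 2 * y $ 3 + x $ 2 * x $ 3 * y $ 0 * y $ 1))
    (quad (x $ 0 * x $ 3 * y $ 0 * y $ 1 + x $ 1 * x $ 2 * y $ 2 * y $ 3)
          ((x $ 0 * y $ 1 + x $ 2 * y $ 3)\<^sup>2)
          (x $ 0 * x $ 1 * y $ 1 * y $ 2 + x $ 2 * x $ 3 * y $ 0 * y $ 3)
          ((x $ 1 * y $ 2 + x $ 3 * y $ 0)\<^sup>2)) $ i"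

definition org :: "'a ^ 4" where "org = quad 1 1 0 1"

definition infty :: "'a ^ 4" where "infty = quad 0 1 1 1"

lemma org_nth [simp]: "org $ 0 = 1" "org $ 1 = 1" "org $ 2 = 0" "org $ 3 = 1"
  by (simp_all add: org_def)

lemma infty_nth [simp]: "infty $ 0 = 0" "infty $ 1 = 1" "infty $ 2 = 1" "infty $ 3 = 1"
  by (simp_all add: infty_def)

lemma add_self [simp]: "x + x = (0::'a)"
  using char2 by (metis mult_2 mult_zero_left)

lemma add_self_left [simp]: "x + (x + y) = (y::'a)"
  by (simp flip: add.assoc)

lemma add_eq_0_iff_eq: "x + y = 0 \<longleftrightarrow> x = (y::'a)"
  by (metis add_self add_self_left add_0_right)

lemma square_add: "(x + y)\<^sup>2 = x\<^sup>2 + (y::'a)\<^sup>2"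
  by (simp add: power2_eq_square algebra_simps)

lemma square_eq_iff: "x\<^sup>2 = y\<^sup>2 \<longleftrightarrow> x = (y::'a)"
  using add_eq_0_iff_eq square_add by (metis power_eq_0_iff zero_neq_numeral)

text \<open>
  Oriented towards the squares of the first two coordinates, the equations of the curve form a
  Groebner basis, so the simplifier decides equality of polynomials modulo them.
\<close>

lemma cone_rewrites:
  assumes "x \<in> cone"
  shows "x $ 0 * x $ 0 = x $ 2 * x $ 2 + x $ 1 * x $ 3"
    "x $ 0 * (x $ 0 * t) = x $ 2 * (x $ 2 * t) + x $ 1 * (x $ 3 * t)"
    "x $ 1 * x $ 1 = x $ 3 * x $ 3 + inverse s * (x $ 0 * x $ 2)"
    "x $ 1 * (x $ 1 * t) = x $ 3 * (x $ 3 * t) + inverse s * (x $ 0 * (x $ 2 * t))"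
proof -
  have 0: "x $ 0 * x $ 0 + x $ 2 * x $ 2 = x $ 1 * x $ 3"
    using assms by (simp add: cone_def square_add flip: power2_eq_square)
  then show 1: "x $ 0 * x $ 0 = x $ 2 * x $ 2 + x $ 1 * x $ 3"
    by (metis add.commute add_self_left)
  have "s * (x $ 1 * x $ 1 + x $ 3 * x $ 3) = x $ 0 * x $ 2"
    using assms by (simp add: cone_def square_add flip: power2_eq_square)
  then have "x $ 1 * x $ 1 + x $ 3 * x $ 3 = inverse s * (x $ 0 * x $ 2)"
    using s_nonzero by (simp add: field_simps)
  then show 2: "x $ 1 * x $ 1 = x $ 3 * x $ 3 + inverse s * (x $ 0 * x $ 2)"
    by (metis add.commute add_self_left)
  show "x $ 0 * (x $ 0 * t) = x $ 2 * (x $ 2 * t) + x $ 1 * (x $ 3 * t)"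
    using arg_cong[OF 1, of "\<lambda>u. u * t"] by (simp add: algebra_simps)
  show "x $ 1 * (x $ 1 * t) = x $ 3 * (x $ 3 * t) + inverse s * (x $ 0 * (x $ 2 * t))"
    using arg_cong[OF 2, of "\<lambda>u. u * t"] by (simp add: algebra_simps)
qed

lemma s_inverse [simp]: "s * inverse s = 1" "s * (inverse s * t) = t"
  using s_nonzero by (simp_all flip: mult.assoc)

lemmas normalize = power2_eq_square algebra_simps

lemma law_nth:
  "law 0 x y $ 0 = (x $ 0 * y $ 0 + x $ 2 * y $ 2)\<^sup>2"
  "law 0 x y $ 1 = x $ 0 * x $ 1 * y $ 0 * y $ 1 + x $ 2 * x $ 3 * y $ 2 * y $ 3"
  "law 0 x y $ 2 = s * (x $ 1 * y $ 1 + x $ 3 * y $ 3)\<^sup>2"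
  "law 0 x y $ 3 = x $ 0 * x $ 3 * y $ 0 * y $ 3 + x $ 1 * x $ 2 * y $ 1 * y $ 2"
  "law 1 x y $ 0 = x $ 0 * x $ 1 * y $ 0 * y $ 3 + x $ 2 * x $ 3 * y $ 1 * y $ 2"
  "law 1 x y $ 1 = (x $ 1 * y $ 0 + x $ 3 * y $ 2)\<^sup>2"
  "law 1 x y $ 2 = x $ 0 * x $ 3 * y $ 2 * y $ 3 + x $ 1 * x $ 2 * y $ 0 * y $ 1"
  "law 1 x y $ 3 = (x $ 0 * y $ 3 + x $ 2 * y $ 1)\<^sup>2"
  "law 2 x y $ 0 = s * (x $ 1 * y $ 3 + x $ 3 * y $ 1)\<^sup>2"
  "law 2 x y $ 1 = x $ 0 * x $ 3 * y $ 1 * y $ 2 + x $ 1 * x $ 2 * y $ 0 * y $ 3"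
  "law 2 x y $ 2 = (x $ 0 * y $ 2 + x $ 2 * y $ 0)\<^sup>2"
  "law 2 x y $ 3 = x $ 0 * x $ 1 * y $ 2 * y $ 3 + x $ 2 * x $ 3 * y $ 0 * y $ 1"
  "law 3 x y $ 0 = x $ 0 * x $ 3 * y $ 0 * y $ 1 + x $ 1 * x $ 2 * y $ 2 * y $ 3"
  "law 3 x y $ 1 = (x $ 0 * y $ 1 + x $ 2 * y $ 3)\<^sup>2"
  "law 3 x y $ 2 = x $ 0 * x $ 1 * y $ 1 * y $ 2 + x $ 2 * x $ 3 * y $ 0 * y $ 3"
  "law 3 x y $ 3 = (x $ 1 * y $ 2 + x $ 3 * y $ 0)\<^sup>2"
  by (simp_all add: law_def)

text \<open>This is the rank one property of the matrix with rows \<open>law i\<close>: each minor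
  reduces to zero modulo the equations for \<open>x\<close> and those for \<open>y\<close>.\<close>

lemma law_minors_less:
  assumes "x \<in> cone" "y \<in> cone"
    and "(i, k) \<in> index_pairs"
    and "(j, l) \<in> index_pairs"
  shows "law i x y $ j * law k x y $ l = law i x y $ l * law k x y $ j"
  using assms(3,4) unfolding index_pairs_def
  by (auto simp: law_nth normalize cone_rewrites[OF assms(1)] cone_rewrites[OF assms(2)])

lemma law_on_curve:
  assumes "x \<in> cone" "y \<in> cone"
  shows "(law i x y $ 0 + law i x y $ 2)\<^sup>2 = law i x y $ 1 * law i x y $ 3"
    "s * (law i x y $ 1 + law i x y $ 3)\<^sup>2 = law i x y $ 0 * law i x y $ 2"
proof -
  have "\<forall>i. (law i x y $ 0 + law i x y $ 2)\<^sup>2 = law i x y $ 1 * law i x y $ 3"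
    unfolding forall_index4
    by (simp add: law_nth normalize cone_rewrites[OF assms(1)] cone_rewrites[OF assms(2)])
  then show "(law i x y $ 0 + law i x y $ 2)\<^sup>2 = law i x y $ 1 * law i x y $ 3" ..
  have "\<forall>i. s * (law i x y $ 1 + law i x y $ 3)\<^sup>2 = law i x y $ 0 * law i x y $ 2"
    unfolding forall_index4
    by (simp add: law_nth normalize cone_rewrites[OF assms(1)] cone_rewrites[OF assms(2)])
  then show "s * (law i x y $ 1 + law i x y $ 3)\<^sup>2 = law i x y $ 0 * law i x y $ 2" ..
qed

text \<open>The composed tuple is a multiple of \<open>x\<close> because
  \<open>(x - y) + y = x\<close>. Rows 0 and 2 suffice, as coordinates 0 and 2 of a point of the
  curve never vanish together.\<close>

lemma law_law_minor:
  assumes "x \<in> cone" "y \<in> cone" and "i \<in> {0, 2}"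
    and "(j, l) \<in> index_pairs"
  shows "law i (law 0 x (neg4 y)) y $ j * x $ l = law i (law 0 x (neg4 y)) y $ l * x $ j"
  using assms(3,4) unfolding index_pairs_def
  by (auto simp: law_nth normalize cone_rewrites[OF assms(1)] cone_rewrites[OF assms(2)])

end

section \<open>Addition of points read off from the four laws\<close>

context mu4_form
begin

lemma smult_in_cone: "x \<in> cone \<Longrightarrow> c \<noteq> 0 \<Longrightarrow> c *s x \<in> cone"
proof -
  assume x: "x \<in> cone" and "c \<noteq> 0"
  have "c * x $ i + c * x $ j = c * (x $ i + x $ j)" for i j by (simp add: distrib_left)
  with x \<open>c \<noteq> 0\<close> show ?thesis
    by (simp add: cone_def power_mult_distrib) (simp add: power2_eq_square ac_simps)
qed

lemma proportional_in_cone: "x \<propto> y \<Longrightarrow> x \<in> cone \<Longrightarrow> y \<in> cone"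
  by (auto simp: proportional_def smult_in_cone)

lemma cone_nonzero: "x \<in> cone \<Longrightarrow> x \<noteq> 0"
  by (simp add: cone_def)

lemma neg4_in_cone [simp]: "neg4 x \<in> cone \<longleftrightarrow> x \<in> cone"
  by (auto simp: cone_def vec_eq_iff4 ac_simps)

lemma shift4_in_cone [simp]: "shift4 x \<in> cone \<longleftrightarrow> x \<in> cone"
  by (auto simp: cone_def vec_eq_iff4 ac_simps)

lemma org_in_cone [simp]: "org \<in> cone"
  by (simp add: cone_def vec_eq_iff4)

lemma infty_in_cone [simp]: "infty \<in> cone"
  by (simp add: cone_def vec_eq_iff4)

lemma neg4_org [simp]: "neg4 org = org"
  by (simp add: vec_eq_iff4)

lemma neg4_infty [simp]: "neg4 infty = infty"
  by (simp add: vec_eq_iff4)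

text \<open>The second equation forces \<open>x $ 1 = x $ 3\<close>; then \<open>x $ 2\<close> and
  \<open>x $ 1\<close> have equal squares by the first, so they are equal in characteristic
  2.\<close>

lemma cone_nth_0_eq_0:
  assumes "x \<in> cone" "x $ 0 = 0"
  shows "x = x $ 2 *s infty" "x $ 2 \<noteq> 0"
proof -
  have 13: "x $ 1 = x $ 3"
    using assms s_nonzero add_eq_0_iff_eq by (simp add: cone_def)
  then have "(x $ 2)\<^sup>2 = (x $ 1)\<^sup>2"
    using assms by (simp add: cone_def power2_eq_square)
  then have "x $ 2 = x $ 1" by (simp add: square_eq_iff)
  with 13 assms show "x = x $ 2 *s infty" by (simp add: vec_eq_iff4)
  then show "x $ 2 \<noteq> 0" using cone_nonzero[OF assms(1)] by auto
qed

lemma cone_nth_0_eq_0_proportional: "x \<in> cone \<Longrightarrow> x $ 0 = 0 \<Longrightarrow> x \<propto> infty"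
  using cone_nth_0_eq_0 proportional_smult by metis

lemma cone_nth_1_ne_3:
  assumes "x \<in> cone" "x $ 0 = x $ 2"
  shows "x $ 1 * x $ 3 = 0" "x $ 1 \<noteq> x $ 3"
proof -
  show p: "x $ 1 * x $ 3 = 0" using assms by (simp add: cone_def)
  show "x $ 1 \<noteq> x $ 3"
  proof
    assume "x $ 1 = x $ 3"
    then have "x $ 1 = 0" "x $ 3 = 0" "x $ 0 * x $ 2 = 0" using assms p by (simp_all add: cone_def)
    with assms show False by (auto simp: cone_def vec_eq_iff4)
  qed
qed

lemma law_minors:
  assumes "x \<in> cone" "y \<in> cone"
  shows "law i x y $ j * law k x y $ l = law i x y $ l * law k x y $ j"
proof -
  have *: "law i x y $ j * law k x y $ l = law i x y $ l * law k x y $ j"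
    if "(i, k) \<in> index_pairs" for i j k l
    by (rule minors_index_pairs) (rule law_minors_less[OF assms that])
  consider "(i, k) \<in> index_pairs" | "i = k" | "(k, i) \<in> index_pairs"
    using index_pairs_total by blast
  then show ?thesis
  proof cases
    case 3
    from *[OF this, of l j] show ?thesis by (simp add: mult.commute)
  qed (use * in \<open>auto simp: mult.commute\<close>)
qed

lemma law_proportional:
  assumes "x \<in> cone" "y \<in> cone" "law i x y \<noteq> 0" "law k x y \<noteq> 0"
  shows "law i x y \<propto> law k x y"
  using assms by (intro proportional_minors law_minors)

lemma law_in_cone:
  assumes "x \<in> cone" "y \<in> cone" "law i x y \<noteq> 0"
  shows "law i x y \<in> cone"
  using assms(3) law_on_curve[OF assms(1,2)] unfolding cone_def by simp

text \<open>The four entries with even row and column are squares up to the unit \<open>s\<close>.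
  If they vanish, adding their roots gives \<open>(x $ 0 + x $ 2) * (y $ 0 + y $ 2) = 0\<close> and
  the analogous product for the odd coordinates. The first product forces
  \<open>x $ 0 = x $ 2\<close> and \<open>y $ 0 = y $ 2\<close>; at such points the odd coordinates
  differ, against the second.\<close>

lemma ex_law_nonzero:
  assumes "x \<in> cone" "y \<in> cone"
  shows "\<exists>i. law i x y \<noteq> 0"
proof (rule ccontr)
  assume "\<nexists>i. law i x y \<noteq> 0"
  then have zero: "law i x y $ j = 0" for i j by (simp add: vec_eq_iff)
  have "x $ 0 * y $ 0 = x $ 2 * y $ 2" "x $ 0 * y $ 2 = x $ 2 * y $ 0"
    "x $ 1 * y $ 1 = x $ 3 * y $ 3" "x $ 1 * y $ 3 = x $ 3 * y $ 1"
    using zero[of 0 0] zero[of 2 2] zero[of 0 2] zero[of 2 0] s_nonzero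
    by (simp_all add: law_nth add_eq_0_iff_eq)
  then have p: "(x $ 0 + x $ 2) * (y $ 0 + y $ 2) = 0" "(x $ 1 + x $ 3) * (y $ 1 + y $ 3) = 0"
    by (simp_all add: algebra_simps)
  have "x $ 0 = x $ 2 \<longleftrightarrow> y $ 0 = y $ 2"
    using \<open>x $ 0 * y $ 0 = x $ 2 * y $ 2\<close> cone_nth_0_eq_0 assms
    by (metis mult_cancel_left mult_cancel_right)
  with p(1) have "x $ 0 = x $ 2" "y $ 0 = y $ 2" by (auto simp: add_eq_0_iff_eq)
  then show False
    using p(2) cone_nth_1_ne_3[OF assms(1)] cone_nth_1_ne_3[OF assms(2)]
    by (auto simp: add_eq_0_iff_eq)
qed

lemma law_smult: "law i (c *s x) (d *s y) = (c\<^sup>2 * d\<^sup>2) *s law i x y"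
proof -
  have "\<forall>i. law i (c *s x) (d *s y) = (c\<^sup>2 * d\<^sup>2) *s law i x y"
    unfolding forall_index4 vec_eq_iff4
    by (simp add: law_nth square_add power_mult_distrib) (simp add: normalize)
  then show ?thesis ..
qed

text \<open>Replacing \<open>y\<close> by \<open>-y\<close> exchanges \<open>x + y\<close> and
  \<open>x - y\<close>, hence rows and columns of the matrix.\<close>

lemma law_transpose: "law i x (neg4 y) $ j = law j x y $ i"
proof -
  have "\<forall>i j. law i x (neg4 y) $ j = law j x y $ i"
    unfolding forall_index4 by (simp add: law_nth ac_simps)
  then show ?thesis by blast
qed

text \<open>Exchanging the arguments negates \<open>x - y\<close>, which swaps rows 1 and 3, and
  fixes \<open>x + y\<close>.\<close>

lemma law_commute: "law i y x = law (quad 0 3 2 1 $ i) x y"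
proof -
  have "\<forall>i. law i y x = law (quad 0 3 2 1 $ i) x y"
    unfolding forall_index4 vec_eq_iff4 by (simp add: law_nth ac_simps)
  then show ?thesis ..
qed

text \<open>Translating \<open>x\<close> by a point of order two translates both
  \<open>x + y\<close> and \<open>x - y\<close> by it, so rows and columns are permuted
  alike.\<close>

lemma law_shift: "law i (shift4 x) y = shift4 (law (quad 2 3 0 1 $ i) x y)"
proof -
  have "\<forall>i. law i (shift4 x) y = shift4 (law (quad 2 3 0 1 $ i) x y)"
    unfolding forall_index4 vec_eq_iff4 by (simp add: law_nth ac_simps)
  then show ?thesis ..
qed

lemma law_org: "x \<in> cone \<Longrightarrow> law i x org = x $ i *s x"
proof -
  assume "x \<in> cone"
  then have "\<forall>i. law i x org = x $ i *s x"
    unfolding forall_index4 vec_eq_iff4 cone_def by (simp add: law_nth power2_eq_square ac_simps)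
  then show ?thesis ..
qed

definition padd :: "'a ^ 4 \<Rightarrow> 'a ^ 4 \<Rightarrow> 'a ^ 4" where
  "padd x y = law (SOME i. law i x y \<noteq> 0) x y"

lemma padd_nonzero: "x \<in> cone \<Longrightarrow> y \<in> cone \<Longrightarrow> padd x y \<noteq> 0"
  unfolding padd_def by (rule someI_ex) (rule ex_law_nonzero)

lemma padd_in_cone: "x \<in> cone \<Longrightarrow> y \<in> cone \<Longrightarrow> padd x y \<in> cone"
  using padd_nonzero law_in_cone unfolding padd_def by blast

lemma law_padd: "x \<in> cone \<Longrightarrow> y \<in> cone \<Longrightarrow> law i x y \<noteq> 0 \<Longrightarrow> law i x y \<propto> padd x y"
  using padd_nonzero law_proportional unfolding padd_def by blast

lemma padd_cong:
  assumes "x \<in> cone" "y \<in> cone" "x \<propto> x'" "y \<propto> y'"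
  shows "padd x y \<propto> padd x' y'"
proof -
  obtain c d where c: "c \<noteq> 0" "x' = c *s x" and d: "d \<noteq> 0" "y' = d *s y"
    using assms by (auto simp: proportional_def)
  obtain i where i: "law i x y \<noteq> 0" using ex_law_nonzero assms by blast
  have eq: "law i x' y' = (c\<^sup>2 * d\<^sup>2) *s law i x y" by (simp add: c d law_smult)
  have "padd x y \<propto> law i x y" using i assms by (simp add: law_padd proportional_sym)
  also have "law i x y \<propto> law i x' y'"
    unfolding eq using c d by (simp add: proportional_smult proportional_sym)
  also have "law i x' y' \<propto> padd x' y'"
  proof (rule law_padd)
    show "law i x' y' \<noteq> 0" using eq i c d by simp
  qed (use assms proportional_in_cone in blast)+
  finally show ?thesis .
qed

lemma padd_commute:
  assumes "x \<in> cone" "y \<in> cone"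
  shows "padd x y \<propto> padd y x"
proof -
  obtain i where i: "law i x y \<noteq> 0" using ex_law_nonzero assms by blast
  then have "padd x y \<propto> law i x y" using assms by (simp add: law_padd proportional_sym)
  also have "law i x y = law (quad 0 3 2 1 $ i) y x" by (rule law_commute)
  also have "\<dots> \<propto> padd y x" using i assms by (intro law_padd) (simp_all flip: law_commute)
  finally show ?thesis .
qed

lemma padd_org:
  assumes "x \<in> cone" shows "padd x org \<propto> x"
proof -
  obtain i where "x $ i \<noteq> 0" using cone_nonzero[OF assms] by (auto simp: vec_eq_iff)
  then have "x $ i *s x \<propto> padd x org"
    using law_padd[OF assms org_in_cone, of i] cone_nonzero[OF assms] by (simp add: law_org assms)
  with \<open>x $ i \<noteq> 0\<close> show ?thesis
    by (metis proportional_smult proportional_sym proportional_trans)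
qed

lemma padd_org_left: "x \<in> cone \<Longrightarrow> padd org x \<propto> x"
  using padd_commute padd_org proportional_trans org_in_cone by blast

text \<open>By transposition, row \<open>i\<close> at \<open>(x, y)\<close> collects the coordinates
  \<open>i\<close> of the laws at \<open>(x, -y)\<close>, and some law there is proportional to
  \<open>x - y\<close>.\<close>

lemma law_nonzero:
  assumes "x \<in> cone" "y \<in> cone" "padd x (neg4 y) $ i \<noteq> 0"
  shows "law i x y \<noteq> 0"
proof -
  have "neg4 y \<in> cone" using assms by simp
  then obtain j where j: "law j x (neg4 y) \<noteq> 0" using ex_law_nonzero assms(1) by blast
  then have "law j x (neg4 y) $ i \<noteq> 0"
    using law_padd[OF assms(1) \<open>neg4 y \<in> cone\<close> j] assms(3) by (simp add: proportional_nth_eq_0)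
  then show ?thesis unfolding law_transpose by auto
qed

lemma padd_diff_aux:
  assumes "x \<in> cone" "y \<in> cone" "law 0 x (neg4 y) \<noteq> 0"
  shows "padd (law 0 x (neg4 y)) y \<propto> x"
proof -
  define z where "z = law 0 x (neg4 y)"
  have z: "z \<in> cone" using law_in_cone[of x "neg4 y" 0] assms by (simp add: z_def)
  have "padd z (neg4 y) \<in> cone" using z assms by (simp add: padd_in_cone)
  \<comment> \<open>Coordinates 0 and 2 of \<open>z - y\<close> do not both vanish, so law 0 or law
    2 is nonzero at \<open>(z, y)\<close>.\<close>
  then have "padd z (neg4 y) $ 0 \<noteq> 0 \<or> padd z (neg4 y) $ 2 \<noteq> 0"
    using cone_nth_0_eq_0 by blast
  then obtain i where i: "law i z y \<noteq> 0" "i \<in> {0, 2}"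
    using law_nonzero[OF z assms(2)] by blast
  have "law i z y $ j * x $ l = law i z y $ l * x $ j"
    for j l
    unfolding z_def by (rule minors_index_pairs) (rule law_law_minor[OF assms(1,2) i(2)])
  then have "law i z y \<propto> x"
    using i(1) cone_nonzero[OF assms(1)] by (intro proportional_minors)
  then show ?thesis using law_padd[OF z assms(2) i(1)] unfolding z_def
    by (blast intro: proportional_trans proportional_sym)
qed

lemma padd_shift:
  assumes "x \<in> cone" "y \<in> cone"
  shows "padd (shift4 x) y \<propto> shift4 (padd x y)"
proof -
  obtain i where i: "law i (shift4 x) y \<noteq> 0"
    using ex_law_nonzero assms shift4_in_cone by blast
  then have "padd (shift4 x) y \<propto> law i (shift4 x) y"
    using assms by (simp add: law_padd proportional_sym)
  also have "\<dots> = shift4 (law (quad 2 3 0 1 $ i) x y)" by (rule law_shift)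
  also have "\<dots> \<propto> shift4 (padd x y)"
  proof (intro shift4_cong law_padd assms)
    show "law (quad 2 3 0 1 $ i) x y \<noteq> 0" using i by (auto simp: law_shift vec_eq_iff4)
  qed
  finally show ?thesis .
qed

lemma padd_diff:
  assumes "x \<in> cone" "y \<in> cone"
  shows "padd (padd x (neg4 y)) y \<propto> x"
proof (cases "law 0 x (neg4 y) = 0")
  case False
  have "law 0 x (neg4 y) \<propto> padd x (neg4 y)" using False assms by (simp add: law_padd)
  then have "padd (padd x (neg4 y)) y \<propto> padd (law 0 x (neg4 y)) y"
    using assms False by (intro padd_cong) (auto intro: proportional_sym padd_in_cone)
  then show ?thesis using padd_diff_aux[OF assms False] proportional_trans by blast
next
  case True
  \<comment> \<open>Translating \<open>x\<close> by the point of order two turns law 2 into law 0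
    and so reduces to the first case. Law 2 is nonzero here since coordinates 0 and 2 of
    \<open>x + y\<close> cannot both vanish.\<close>
  define x' where "x' = shift4 x"
  have x': "x' \<in> cone" using assms by (simp add: x'_def)
  have "neg4 y \<in> cone" using assms by simp
  have "law 2 x (neg4 y) \<noteq> 0"
  proof
    assume 2: "law 2 x (neg4 y) = 0"
    have "padd x (neg4 (neg4 y)) $ 0 = 0" "padd x (neg4 (neg4 y)) $ 2 = 0"
      using law_nonzero[OF assms(1) \<open>neg4 y \<in> cone\<close>] True 2 by blast+
    then show False using cone_nth_0_eq_0[OF padd_in_cone[OF assms]] by simp
  qed
  then have nz: "law 0 x' (neg4 y) \<noteq> 0"
    unfolding x'_def law_shift by (auto simp: vec_eq_iff4)
  have "padd (padd x (neg4 y)) y \<propto> padd (shift4 (law 0 x' (neg4 y))) y"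
  proof (intro padd_cong padd_in_cone)
    have "padd x (neg4 y) = padd (shift4 x') (neg4 y)" by (simp add: x'_def)
    also have "\<dots> \<propto> shift4 (padd x' (neg4 y))" using x' assms by (intro padd_shift) simp_all
    also have "\<dots> \<propto> shift4 (law 0 x' (neg4 y))"
      using nz x' assms by (intro shift4_cong proportional_sym[OF law_padd]) simp_all
    finally show "padd x (neg4 y) \<propto> shift4 (law 0 x' (neg4 y))" .
  qed (use assms in simp_all)
  also have "\<dots> \<propto> shift4 (padd (law 0 x' (neg4 y)) y)"
    using nz x' assms by (intro padd_shift law_in_cone) simp_all
  also have "\<dots> \<propto> shift4 x'" using nz x' assms by (intro shift4_cong padd_diff_aux)
  finally show ?thesis by (simp add: x'_def)
qed

lemma padd_diff':
  assumes "x \<in> cone" "y \<in> cone"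
  shows "padd (padd x y) (neg4 y) \<propto> x"
  using padd_diff[of x "neg4 y"] assms by simp

end

section \<open>The affine coordinate ring\<close>

text \<open>If \<open>p\<close> is nonconstant, so is \<open>p + 1\<close>, and at a root of the
  latter \<open>p\<close> takes the value \<open>-1\<close>.\<close>

lemma poly_eq_0_everywhere:
  fixes p :: "'a::alg_closed_field poly"
  assumes "\<And>x. poly p x = 0"
  shows "p = 0"
proof (cases "degree p > 0")
  case True
  then have "degree (p + 1) > 0" by (simp add: degree_add_eq_left)
  then obtain x where "poly (p + 1) x = 0" using alg_closed_imp_poly_has_root by blast
  with assms[of x] show ?thesis by simp
next
  case False
  then obtain c where "p = [:c:]" using degree_eq_zeroE by blast
  with assms[of 0] show ?thesis by simp
qed

locale mu4_closed = mu4_form s for s :: "'a::alg_closed_field"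
begin

lemma poly_add_self [simp]: "p + p = (0::'a poly)"
  by (rule poly_eqI) (simp only: coeff_add add_self coeff_0)

lemma poly_add_self_left [simp]: "p + (p + q) = (q::'a poly)"
  by (simp flip: add.assoc)

text \<open>The complement of \<open>infty\<close> in Weierstrass form; \<open>org\<close> becomes
  the point \<open>(0, 1)\<close>.\<close>

definition affine :: "('a \<times> 'a) set" where
  "affine = {(w, v). v\<^sup>2 + w * v = s * w ^ 3 + 1}"

definition cubic :: "'a poly" where "cubic = [:1, 0, 0, s:]"

lemma degree_cubic [simp]: "degree cubic = 3"
  using s_nonzero by (simp add: cubic_def)

lemma cubic_nonzero [simp]: "cubic \<noteq> 0"
  by (simp add: cubic_def)

lemma affine_square: "(w, v) \<in> affine \<Longrightarrow> v * v = w * v + poly cubic w"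
proof -
  assume "(w, v) \<in> affine"
  then have "v * v + w * v = poly cubic w"
    by (simp add: affine_def cubic_def power2_eq_square power3_eq_cube algebra_simps)
  then show ?thesis by (metis add.commute add_self_left)
qed

lemma affine_conj: "(w, v) \<in> affine \<Longrightarrow> (w, v + w) \<in> affine"
  by (simp add: affine_def square_add algebra_simps power2_eq_square)

lemma ex_affine: "\<exists>v. (w, v) \<in> affine"
proof -
  have "degree [:- (s * w ^ 3 + 1), w, 1:] > 0" by simp
  then obtain v where "poly [:- (s * w ^ 3 + 1), w, 1:] v = 0" using alg_closed_imp_poly_has_root by blast
  then have "(w, v) \<in> affine" by (simp add: affine_def algebra_simps power2_eq_square)
  then show ?thesis ..
qed

text \<open>The coordinate ring is free over the polynomials in \<open>w\<close> with basis 1,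
  \<open>v\<close>; \<open>A\<close> and \<open>B\<close> are the two components.\<close>

definition represents :: "('a \<times> 'a \<Rightarrow> 'a) \<Rightarrow> 'a poly \<Rightarrow> 'a poly \<Rightarrow> bool" where
  "represents u A B \<longleftrightarrow> (\<forall>(w, v)\<in>affine. u (w, v) = poly A w + poly B w * v)"

lemma representsD: "represents u A B \<Longrightarrow> (w, v) \<in> affine \<Longrightarrow> u (w, v) = poly A w + poly B w * v"
  by (auto simp: represents_def)

lemma represents_cong:
  "(\<And>P. P \<in> affine \<Longrightarrow> u P = u' P) \<Longrightarrow> represents u A B \<longleftrightarrow> represents u' A B"
  unfolding represents_def by auto

lemma represents_const: "represents (\<lambda>P. c) [:c:] 0"
  and represents_fst: "represents fst [:0, 1:] 0"
  and represents_snd: "represents snd 0 1"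
  by (auto simp: represents_def)

lemma represents_add:
  "represents u A B \<Longrightarrow> represents u' A' B' \<Longrightarrow> represents (\<lambda>P. u P + u' P) (A + A') (B + B')"
  by (auto simp: represents_def split_beta algebra_simps)

lemma represents_mult:
  "represents u A B \<Longrightarrow> represents u' A' B' \<Longrightarrow>
    represents (\<lambda>P. u P * u' P) (A * A' + B * B' * cubic) (A * B' + A' * B + B * B' * [:0, 1:])"
proof -
  have "(poly A w + poly B w * v) * (poly A' w + poly B' w * v) =
    poly (A * A' + B * B' * cubic) w + poly (A * B' + A' * B + B * B' * [:0, 1:]) w * v"
    if "(w, v) \<in> affine" for w v
  proof -
    have "(poly A w + poly B w * v) * (poly A' w + poly B' w * v) =
        poly A w * poly A' w + (poly A w * poly B' w + poly A' w * poly B w) * v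
        + poly B w * poly B' w * (v * v)"
      by (simp add: algebra_simps)
    then show ?thesis using affine_square[OF that] by (simp add: algebra_simps)
  qed
  then show "represents u A B \<Longrightarrow> represents u' A' B' \<Longrightarrow> ?thesis"
    by (simp add: represents_def split_beta)
qed

text \<open>Over \<open>w \<noteq> 0\<close> lie the two distinct points \<open>v\<close> and
  \<open>v + w\<close>, and subtracting the values there isolates \<open>B\<close>. The excluded
  value 0 is absorbed by the factor \<open>[:0, 1:]\<close>.\<close>

lemma represents_zero:
  assumes "represents u A B" "\<And>P. P \<in> affine \<Longrightarrow> u P = 0"
  shows "A = 0" "B = 0"
proof -
  have 0: "poly A w = 0 \<and> poly B w = 0" if "w \<noteq> 0" for w
  proof -
    obtain v where v: "(w, v) \<in> affine" using ex_affine by blast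
    have "poly A w + poly B w * v = 0" "poly A w + poly B w * (v + w) = 0"
      using assms v affine_conj[OF v] by (simp_all flip: representsD[OF assms(1)])
    then have "poly B w * w = 0" by (metis add.assoc add_0_left distrib_left)
    with that \<open>poly A w + poly B w * v = 0\<close> show ?thesis by simp
  qed
  have "[:0, 1:] * A = 0" "[:0, 1:] * B = 0"
    by (rule poly_eq_0_everywhere, use 0 in force)+
  then show "A = 0" "B = 0" by simp_all
qed

lemma represents_unique:
  assumes "represents u A B" "represents u' A' B'" "\<And>P. P \<in> affine \<Longrightarrow> u P = u' P"
  shows "A = A'" "B = B'"
proof -
  have "represents (\<lambda>P. u P + u' P) (A + A') (B + B')" using assms by (intro represents_add)
  then have "A + A' = 0" "B + B' = 0" by (rule represents_zero; simp add: assms(3))+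
  then show "A = A'" "B = B'" by (metis add_0_right poly_add_self_left)+
qed

text \<open>The order of the pole at the point at infinity, where \<open>w\<close> has order 2 and \<open>v\<close> order 3.\<close>

definition pole :: "'a poly \<Rightarrow> 'a poly \<Rightarrow> nat" where
  "pole A B = max (2 * degree A) (if B = 0 then 0 else 2 * degree B + 3)"

text \<open>The product of \<open>A + B v\<close> with its conjugate \<open>A + B (v + w)\<close>,
  because \<open>v (v + w)\<close> equals \<open>cubic\<close>.\<close>

definition norm_poly :: "'a poly \<Rightarrow> 'a poly \<Rightarrow> 'a poly" where
  "norm_poly A B = A * A + [:0, 1:] * A * B + B * B * cubic"

lemma norm_poly_mult:
  "norm_poly (A * A' + B * B' * cubic) (A * B' + A' * B + B * B' * [:0, 1:]) =
    norm_poly A B * norm_poly A' B'"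
  unfolding norm_poly_def
  by (simp only: ring_distribs ac_simps poly_add_self poly_add_self_left add_0_right add_0_left)

text \<open>For nonzero \<open>A\<close>, \<open>B\<close> of degrees \<open>a\<close>,
  \<open>b\<close> the outer terms have degrees \<open>2 a\<close> and \<open>2 b + 3\<close>, which
  differ by parity, and the mixed term of degree \<open>a + b + 1\<close> stays below the larger
  one. Pole orders become multiplicative in this way.\<close>

lemma degree_norm_poly: "degree (norm_poly A B) = pole A B"
proof (cases "A = 0 \<or> B = 0")
  case True
  then show ?thesis
    by (cases "A = 0"; cases "B = 0") (simp_all add: norm_poly_def pole_def degree_mult_eq)
next
  case False
  define a b where "a = degree A" and "b = degree B"
  have d: "degree (A * A) = 2 * a" "degree ([:0, 1:] * A * B) = a + b + 1"
    "degree (B * B * cubic) = 2 * b + 3"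
    using False by (simp_all add: degree_mult_eq a_def b_def del: mult_pCons_left)
  show ?thesis
  proof (cases "b + 2 \<le> a")
    case True
    have "degree ([:0, 1:] * A * B + B * B * cubic) < degree (A * A)"
      using True by (intro degree_add_less) (simp_all add: d del: mult_pCons_left)
    then have "degree (A * A + ([:0, 1:] * A * B + B * B * cubic)) = 2 * a"
      by (subst degree_add_eq_left) (simp_all add: d del: mult_pCons_left)
    with True show ?thesis
      by (simp add: norm_poly_def pole_def add.assoc max_def flip: a_def b_def del: mult_pCons_left)
  next
    case b: False
    have "degree (A * A + [:0, 1:] * A * B) < degree (B * B * cubic)"
      using b by (intro degree_add_less) (simp_all add: d del: mult_pCons_left)
    then have "degree (A * A + [:0, 1:] * A * B + B * B * cubic) = 2 * b + 3"
      by (subst degree_add_eq_right) (simp_all add: d del: mult_pCons_left)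
    with b False show ?thesis
      by (simp add: norm_poly_def pole_def max_def flip: a_def b_def del: mult_pCons_left)
  qed
qed

lemma norm_poly_eq_0_iff: "norm_poly A B = 0 \<longleftrightarrow> A = 0 \<and> B = 0"
proof
  assume 0: "norm_poly A B = 0"
  then have "pole A B = 0" using degree_norm_poly[of A B] by simp
  then have "B = 0" by (auto simp: pole_def split: if_splits)
  with 0 show "A = 0 \<and> B = 0" by (simp add: norm_poly_def)
qed (simp add: norm_poly_def)

text \<open>A relation, since the zero function has no pole order.\<close>

definition pole_order :: "('a \<times> 'a \<Rightarrow> 'a) \<Rightarrow> nat \<Rightarrow> bool" where
  "pole_order u n \<longleftrightarrow> (\<exists>A B. represents u A B \<and> (A \<noteq> 0 \<or> B \<noteq> 0) \<and> pole A B = n)"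

lemma pole_orderI: "represents u A B \<Longrightarrow> A \<noteq> 0 \<or> B \<noteq> 0 \<Longrightarrow> pole A B = n \<Longrightarrow> pole_order u n"
  by (auto simp: pole_order_def)

lemma pole_order_cong:
  "(\<And>P. P \<in> affine \<Longrightarrow> u P = u' P) \<Longrightarrow> pole_order u n \<longleftrightarrow> pole_order u' n"
  unfolding pole_order_def using represents_cong by metis

lemma pole_order_unique: "pole_order u m \<Longrightarrow> pole_order u n \<Longrightarrow> m = n"
  unfolding pole_order_def using represents_unique by metis

lemma pole_order_mult:
  assumes "pole_order u m" "pole_order u' n"
  shows "pole_order (\<lambda>P. u P * u' P) (m + n)"
proof -
  obtain A B where AB: "represents u A B" "A \<noteq> 0 \<or> B \<noteq> 0" "pole A B = m"
    using assms by (auto simp: pole_order_def)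
  obtain A' B' where AB': "represents u' A' B'" "A' \<noteq> 0 \<or> B' \<noteq> 0" "pole A' B' = n"
    using assms by (auto simp: pole_order_def)
  show ?thesis
  proof (rule pole_orderI[OF represents_mult[OF AB(1) AB'(1)]])
    have nz: "norm_poly A B \<noteq> 0" "norm_poly A' B' \<noteq> 0"
      using AB(2) AB'(2) by (auto simp: norm_poly_eq_0_iff)
    then show "A * A' + B * B' * cubic \<noteq> 0 \<or> A * B' + A' * B + B * B' * [:0, 1:] \<noteq> 0"
      by (metis norm_poly_mult norm_poly_eq_0_iff mult_eq_0_iff)
    show "pole (A * A' + B * B' * cubic) (A * B' + A' * B + B * B' * [:0, 1:]) = m + n"
      using nz AB(3) AB'(3) by (simp add: norm_poly_mult degree_mult_eq flip: degree_norm_poly del: mult_pCons_left mult_pCons_right)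
  qed
qed

text \<open>The dominant component of \<open>u'\<close>, which is \<open>B'\<close> or
  \<open>A'\<close> according to the parity of \<open>n\<close>, cannot be cancelled by a function
  of smaller order.\<close>

lemma pole_order_add:
  assumes "pole_order u m" "pole_order u' n" "m < n"
  shows "pole_order (\<lambda>P. u P + u' P) n"
proof -
  obtain A B where AB: "represents u A B" "pole A B = m"
    using assms by (auto simp: pole_order_def)
  obtain A' B' where AB': "represents u' A' B'" "pole A' B' = n"
    using assms by (auto simp: pole_order_def)
  have p: "pole (A + A') (B + B') = n"
  proof (cases "B' \<noteq> 0 \<and> 2 * degree A' \<le> 2 * degree B' + 3")
    case True
    then have n: "n = 2 * degree B' + 3" using AB' by (simp add: pole_def)
    then have "degree (A + A') < degree B' + 2"
      using AB(2) assms(3) True by (intro degree_add_less) (auto simp: pole_def split: if_splits)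
    moreover have "degree (B + B') = degree B'" "B + B' \<noteq> 0"
    proof -
      have "B = 0 \<or> degree B < degree B'"
        using AB(2) assms(3) n by (auto simp: pole_def split: if_splits)
      then show "degree (B + B') = degree B'" by (auto simp: degree_add_eq_right)
      show "B + B' \<noteq> 0"
        using \<open>B = 0 \<or> degree B < degree B'\<close> True by (metis add_0_left add_0_right less_irrefl poly_add_self_left)
    qed
    ultimately show ?thesis using n by (simp add: pole_def)
  next
    case False
    then have n: "n = 2 * degree A'" using AB' by (auto simp: pole_def split: if_splits)
    then have "degree (A + A') = degree A'"
      using AB(2) assms(3) by (intro degree_add_eq_right) (auto simp: pole_def split: if_splits)
    moreover have "B + B' = 0 \<or> 2 * degree (B + B') + 3 \<le> n"
    proof -
      have "B = 0 \<or> 2 * degree B + 3 \<le> n" "B' = 0 \<or> 2 * degree B' + 3 \<le> n"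
        using AB AB' assms(3) by (auto simp: pole_def split: if_splits)
      moreover have "degree (B + B') \<le> max (degree B) (degree B')" by (rule degree_add_le_max)
      ultimately show ?thesis by auto
    qed
    ultimately show ?thesis using n by (auto simp: pole_def)
  qed
  have "A + A' \<noteq> 0 \<or> B + B' \<noteq> 0" using p assms(3) by (auto simp: pole_def)
  then show ?thesis using p represents_add[OF AB(1) AB'(1)] by (blast intro: pole_orderI)
qed

lemma pole_order_const: "c \<noteq> 0 \<Longrightarrow> pole_order (\<lambda>P. c) 0"
  by (rule pole_orderI[OF represents_const]) (auto simp: pole_def)

text \<open>
  The coordinate ring is integrally closed. A function \<open>u\<close> that is locally a quotient of elements
  of the ring has a denominator \<open>g\<close> that is a polynomial in \<open>w\<close>, namely the norm of a local
  denominator. If \<open>g\<close> has minimal degree, it has no root: at a root \<open>\<alpha>\<close> the numerator \<open>g u\<close> is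
  divisible by \<open>w - \<alpha>\<close>. This is clear if there are two points over \<open>\<alpha>\<close>; at the ramification point
  \<open>(0, 1)\<close> one uses that the curve is smooth.
\<close>

lemma represents_locally:
  assumes "\<And>P. P \<in> affine \<Longrightarrow> \<exists>q r A B A' B'. represents q A B \<and> represents r A' B' \<and> q P \<noteq> 0 \<and>
     (\<forall>Q\<in>affine. q Q * u Q = r Q)"
  shows "\<exists>A B. represents u A B"
proof -
  define I where "I = (\<lambda>g. g \<noteq> 0 \<and> (\<exists>A B. represents (\<lambda>P. poly g (fst P) * u P) A B))"
  have "\<exists>g. I g"
  proof -
    obtain P where "P \<in> affine" using ex_affine by blast
    then obtain q r A B A' B' where q: "represents q A B" "represents r A' B'" "q P \<noteq> 0"
      "\<forall>Q\<in>affine. q Q * u Q = r Q" using assms by blast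
    have "A \<noteq> 0 \<or> B \<noteq> 0" using representsD[OF q(1)] q(3) \<open>P \<in> affine\<close> by (cases P) auto
    then have "norm_poly A B \<noteq> 0" by (simp add: norm_poly_eq_0_iff)
    \<comment> \<open>\<open>?c\<close> is the conjugate of \<open>q\<close>, so that
      \<open>?c * q\<close> is the norm, a polynomial in \<open>w\<close> alone.\<close>
    let ?c = "\<lambda>(w, v). poly (A + [:0, 1:] * B) w + poly B w * v"
    have c: "represents ?c (A + [:0, 1:] * B) B" by (auto simp: represents_def)
    have "represents (\<lambda>P. ?c P * q P) (norm_poly A B) 0"
    proof -
      have *: "(A + [:0, 1:] * B) * A + B * B * cubic = norm_poly A B"
        "(A + [:0, 1:] * B) * B + A * B + B * B * [:0, 1:] = 0"
        unfolding norm_poly_def by (simp_all only: ring_distribs ac_simps poly_add_self poly_add_self_left)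
      show ?thesis using represents_mult[OF c q(1)] by (simp only: *)
    qed
    then have "?c Q * r Q = poly (norm_poly A B) (fst Q) * u Q" if "Q \<in> affine" for Q
      using that q(4) representsD[of _ "norm_poly A B" 0 "fst Q" "snd Q"]
      by (auto simp flip: mult.assoc)
    then have "I (norm_poly A B)"
      unfolding I_def using \<open>norm_poly A B \<noteq> 0\<close> represents_mult[OF c q(2)] represents_cong
      by (smt (verit, ccfv_SIG))
    then show ?thesis ..
  qed
  then obtain g where g: "I g" and min: "\<And>h. I h \<Longrightarrow> degree g \<le> degree h"
    using ex_has_least_nat[of I _ degree] by blast
  obtain A B where AB: "represents (\<lambda>P. poly g (fst P) * u P) A B" and "g \<noteq> 0"
    using g by (auto simp: I_def)
  show ?thesis
  proof (cases "degree g = 0")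
    case True
    then obtain c where c: "g = [:c:]" using degree_eq_zeroE by blast
    with \<open>g \<noteq> 0\<close> have "c \<noteq> 0" by simp
    have "\<exists>A B. represents (\<lambda>P. inverse c * (poly g (fst P) * u P)) A B"
      using represents_mult[OF represents_const AB] by blast
    then show ?thesis using \<open>c \<noteq> 0\<close> by (simp add: c flip: mult.assoc)
  next
    case False
    then obtain \<alpha> where "poly g \<alpha> = 0" using alg_closed_imp_poly_has_root by blast
    then obtain h where h: "g = [:- \<alpha>, 1:] * h" by (auto simp: poly_eq_0_iff_dvd elim: dvdE)
    with \<open>g \<noteq> 0\<close> have "h \<noteq> 0" by auto
    have "degree g = degree h + 1"
      using \<open>h \<noteq> 0\<close> by (simp add: h degree_mult_eq del: mult_pCons_left)
    have vanish: "poly A \<alpha> + poly B \<alpha> * v = 0" if "(\<alpha>, v) \<in> affine" for v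
      using representsD[OF AB that] \<open>poly g \<alpha> = 0\<close> by simp
    have root: "poly A \<alpha> = 0 \<and> poly B \<alpha> = 0"
    proof (cases "\<alpha> = 0")
      case False
      obtain v where v: "(\<alpha>, v) \<in> affine" using ex_affine by blast
      have "poly A \<alpha> + poly B \<alpha> * v = 0" "poly A \<alpha> + poly B \<alpha> * (v + \<alpha>) = 0"
        using vanish v affine_conj[OF v] by auto
      then have "poly B \<alpha> * \<alpha> = 0" by (metis add.assoc add_0_left distrib_left)
      with False \<open>poly A \<alpha> + poly B \<alpha> * v = 0\<close> show ?thesis by simp
    next
      case True
      \<comment> \<open>Only one point lies over 0, giving just \<open>A = B\<close> at 0. Comparing
        the components without \<open>v\<close> in \<open>q * (g u) = g * r\<close> at
        \<open>w = 0\<close>, where \<open>cubic\<close> is 1, gives \<open>(Q0 + Q1) B = 0\<close>;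
        the first factor is the nonzero value of \<open>q\<close> at \<open>(0, 1)\<close>.\<close>
      have P: "(0, 1) \<in> affine" by (simp add: affine_def)
      with vanish[of 1] True have eq: "poly A 0 = poly B 0" by (simp add: add_eq_0_iff_eq)
      obtain q r Q0 Q1 R0 R1 where q: "represents q Q0 Q1" "represents r R0 R1" "q (0, 1) \<noteq> 0"
        "\<forall>Q\<in>affine. q Q * u Q = r Q" using assms[OF P] by blast
      have "represents (\<lambda>P. q P * (poly g (fst P) * u P))
          (Q0 * A + Q1 * B * cubic) (Q0 * B + A * Q1 + Q1 * B * [:0, 1:])"
        by (rule represents_mult[OF q(1) AB])
      moreover have "represents (\<lambda>P. poly g (fst P) * r P) (g * R0 + 0 * R1 * cubic) (g * R1 + R0 * 0 + 0 * R1 * [:0, 1:])"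
        by (rule represents_mult[OF _ q(2)]) (auto simp: represents_def)
      ultimately have "Q0 * A + Q1 * B * cubic = g * R0 + 0 * R1 * cubic"
        by (rule represents_unique) (use q(4) in \<open>auto simp: ac_simps\<close>)
      from arg_cong[OF this, of "\<lambda>p. poly p 0"]
      have "(poly Q0 0 + poly Q1 0) * poly B 0 = 0"
        using \<open>poly g \<alpha> = 0\<close> True eq by (simp add: cubic_def distrib_right)
      moreover have "poly Q0 0 + poly Q1 0 \<noteq> 0" using q(3) representsD[OF q(1) P] by simp
      ultimately show ?thesis using eq True by simp
    qed
    then obtain A' B' where A': "A = [:- \<alpha>, 1:] * A'" and B': "B = [:- \<alpha>, 1:] * B'"
      by (auto simp: poly_eq_0_iff_dvd elim!: dvdE)
    \<comment> \<open>Cancelling \<open>w - \<alpha>\<close> pointwise says nothing over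
      \<open>\<alpha>\<close> itself. Instead the difference of both sides, times a local
      denominator \<open>q\<close>, is written as \<open>?f\<close> with components
      \<open>?F\<close> and \<open>?G\<close>; these vanish because
      \<open>(w - \<alpha>) * ?f\<close> is zero everywhere and polynomials allow
      cancellation.\<close>
    have "represents (\<lambda>P. poly h (fst P) * u P) A' B'"
      unfolding represents_def
    proof (intro ballI, clarify)
      fix w v assume P: "(w, v) \<in> affine"
      obtain q r Q0 Q1 R0 R1 where q: "represents q Q0 Q1" "represents r R0 R1" "q (w, v) \<noteq> 0"
        "\<forall>Q\<in>affine. q Q * u Q = r Q" using assms[OF P] by blast
      have t: "represents (\<lambda>(w, v). poly A' w + poly B' w * v) A' B'"
        by (auto simp: represents_def)
      have "represents (\<lambda>P. q P * (case P of (w, v) \<Rightarrow> poly A' w + poly B' w * v) + poly h (fst P) * r P)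
          (Q0 * A' + Q1 * B' * cubic + (h * R0 + 0 * R1 * cubic))
          (Q0 * B' + A' * Q1 + Q1 * B' * [:0, 1:] + (h * R1 + R0 * 0 + 0 * R1 * [:0, 1:]))" (is "represents ?f ?F ?G")
        by (intro represents_add represents_mult q(1,2) t) (auto simp: represents_def)
      then have f: "represents ?f ?F ?G" .
      have "represents (\<lambda>P. (fst P - \<alpha>) * ?f P) ([:- \<alpha>, 1:] * ?F + 0 * ?G * cubic) ([:- \<alpha>, 1:] * ?G + ?F * 0 + 0 * ?G * [:0, 1:])"
        by (intro represents_mult f) (auto simp: represents_def)
      moreover have "(fst P - \<alpha>) * ?f P = 0" if "P \<in> affine" for P
      proof -
        obtain w v where P: "P = (w, v)" by fastforce
        have *: "(w - \<alpha>) * (poly A' w + poly B' w * v) = (w - \<alpha>) * (poly h w * u P)"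
          using representsD[OF AB, of w v] that by (simp add: P A' B' h algebra_simps)
        have "(fst P - \<alpha>) * ?f P = q P * ((w - \<alpha>) * (poly A' w + poly B' w * v)) + (w - \<alpha>) * (poly h w * (q P * u P))"
          using q(4) that by (simp add: P algebra_simps)
        also have "\<dots> = 0" unfolding * by (simp add: ac_simps)
        finally show ?thesis .
      qed
      ultimately have "[:- \<alpha>, 1:] * ?F + 0 * ?G * cubic = 0 \<and> [:- \<alpha>, 1:] * ?G + ?F * 0 + 0 * ?G * [:0, 1:] = 0"
        using represents_zero by (metis (no_types, lifting))
      then have "?F = 0" "?G = 0" by (simp_all del: mult_pCons_left mult_pCons_right)
      then have "?f (w, v) = 0" using representsD[OF f P] by (simp del: mult_pCons_left mult_pCons_right)
      then have "q (w, v) * (poly A' w + poly B' w * v) = poly h w * r (w, v)"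
        by (simp add: add_eq_0_iff_eq)
      also have "\<dots> = q (w, v) * (poly h w * u (w, v))" using q(4) P by (auto simp: ac_simps)
      finally show "poly h (fst (w, v)) * u (w, v) = poly A' w + poly B' w * v"
        using q(3) by simp
    qed
    with \<open>h \<noteq> 0\<close> have "I h" by (auto simp: I_def)
    from min[OF this] \<open>degree g = degree h + 1\<close> show ?thesis by simp
  qed
qed

end

section \<open>Forms and sections\<close>

text \<open>Homogeneous polynomial functions; \<open>S\<close> records where the coefficients come
  from, for the descent to the base field.\<close>

inductive form :: "'a::comm_ring_1 set \<Rightarrow> nat \<Rightarrow> ('a ^ 4 \<Rightarrow> 'a) \<Rightarrow> bool" for S where
  form_const: "c \<in> S \<Longrightarrow> form S 0 (\<lambda>x. c)"
| form_nth: "form S 1 (\<lambda>x. x $ i)"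
| form_add: "form S d f \<Longrightarrow> form S d g \<Longrightarrow> form S d (\<lambda>x. f x + g x)"
| form_mult: "form S d f \<Longrightarrow> form S e g \<Longrightarrow> form S (d + e) (\<lambda>x. f x * g x)"

lemma form_zero: "0 \<in> S \<Longrightarrow> form S d (\<lambda>x. 0)"
proof (induction d)
  case (Suc d)
  have "form S (1 + d) (\<lambda>x. x $ 0 * 0)" by (rule form_mult[OF form_nth Suc.IH[OF Suc.prems]])
  then show ?case by simp
qed (rule form_const)

lemma form_cmult: "c \<in> S \<Longrightarrow> form S d f \<Longrightarrow> form S d (\<lambda>x. c * f x)"
  using form_mult[OF form_const] by fastforce

lemma form_sum:
  assumes "finite I" "0 \<in> S" "\<And>i. i \<in> I \<Longrightarrow> form S d (f i)"
  shows "form S d (\<lambda>x. \<Sum>i\<in>I. f i x)"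
  using assms(1,3) by (induction I) (auto intro: form_add form_zero assms(2))

lemma form_power: "1 \<in> S \<Longrightarrow> form S d f \<Longrightarrow> form S (n * d) (\<lambda>x. f x ^ n)"
  by (induction n) (auto intro: form_const form_mult)

lemma form_prod:
  assumes "finite I" "1 \<in> S" "\<And>i. i \<in> I \<Longrightarrow> form S (d i) (f i)"
  shows "form S (\<Sum>i\<in>I. d i) (\<lambda>x. \<Prod>i\<in>I. f i x)"
  using assms(1,3) by (induction I) (auto intro: form_const form_mult assms(2))

lemma form_smult: "form S d f \<Longrightarrow> f (c *s x) = c ^ d * f x"
  by (induction rule: form.induct) (auto simp: algebra_simps power_add)

lemma form_compose:
  assumes "form S d f" "\<And>i. form S e (\<lambda>x. g x $ i)"
  shows "form S (d * e) (\<lambda>x. f (g x))"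
  using assms(1)
  by (induction rule: form.induct) (use assms(2) in \<open>auto intro: form.intros simp: distrib_right\<close>)

lemma coeff_mult_le_degree:
  fixes p q :: "'a::comm_semiring_0 poly"
  assumes "degree p \<le> m" "degree q \<le> n"
  shows "coeff (p * q) (m + n) = coeff p m * coeff q n"
proof (cases "degree p = m \<and> degree q = n")
  case True
  then show ?thesis using coeff_mult_degree_sum[of p q] by simp
next
  case False
  with assms have "degree p + degree q < m + n" "coeff p m = 0 \<or> coeff q n = 0"
    by (auto intro: coeff_eq_0)
  then have "degree (p * q) < m + n" using degree_mult_le[of p q] by simp
  with \<open>coeff p m = 0 \<or> coeff q n = 0\<close> show ?thesis by (auto simp: coeff_eq_0)
qed

text \<open>In characteristic 2, where subtraction is addition, this makes \<open>S\<close> a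
  subring.\<close>

definition semiring_closed :: "'a::comm_ring_1 set \<Rightarrow> bool" where
  "semiring_closed S \<longleftrightarrow> 0 \<in> S \<and> 1 \<in> S \<and> (\<forall>x\<in>S. \<forall>y\<in>S. x + y \<in> S \<and> x * y \<in> S)"

lemma semiring_closed_UNIV: "semiring_closed UNIV"
  by (simp add: semiring_closed_def)

lemma coeff_mult_closed:
  assumes "semiring_closed S" "\<And>i. coeff p i \<in> S" "\<And>i. coeff q i \<in> S"
  shows "coeff (p * q) i \<in> S"
proof -
  have "finite I \<Longrightarrow> (\<And>i. i \<in> I \<Longrightarrow> f i \<in> S) \<Longrightarrow> sum f I \<in> S" for f and I :: "nat set"
    by (induction I rule: finite_induct) (use assms(1) in \<open>auto simp: semiring_closed_def\<close>)
  then show ?thesis using assms by (simp add: coeff_mult semiring_closed_def)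
qed

section \<open>Forms on the affine chart and sections of powers of the hyperplane bundle\<close>

context mu4_closed
begin

lemma even_numeral_eq_0 [simp]: "numeral (Num.Bit0 n) = (0::'a)"
  by (simp only: numeral_Bit0 add_self)

text \<open>Inverse of \<open>w = (x1 + x3) / x0\<close>, \<open>v = (x1 + x2) / x0\<close>; in
  these terms the second equation reads \<open>x2 / x0 = s w^2\<close>.\<close>

definition coords :: "'a \<times> 'a \<Rightarrow> 'a ^ 4" where
  "coords = (\<lambda>(w, v). quad 1 (v + s * w\<^sup>2) (s * w\<^sup>2) (v + w + s * w\<^sup>2))"

lemma coords_nth [simp]:
  "coords (w, v) $ 0 = 1" "coords (w, v) $ 1 = v + s * w\<^sup>2" "coords (w, v) $ 2 = s * w\<^sup>2"
  "coords (w, v) $ 3 = v + w + s * w\<^sup>2"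
  by (simp_all add: coords_def)

lemma coords_in_cone:
  assumes "P \<in> affine"
  shows "coords P \<in> cone"
proof -
  obtain w v where P: "P = (w, v)" by fastforce
  have v: "v * v = w * v + (1 + s * (w * (w * w)))"
    using affine_square assms by (simp add: P cubic_def ac_simps)
  have "v * (v * x) = w * (v * x) + (1 + s * (w * (w * w))) * x" for x
    using arg_cong[OF v, of "\<lambda>t. t * x"] by (simp add: algebra_simps)
  with v show ?thesis
    by (simp add: P cone_def vec_eq_iff4) (simp add: normalize)
qed

lemma cone_eq_coords:
  assumes "x \<in> cone" "x $ 0 \<noteq> 0"
  obtains P where "P \<in> affine" "x = x $ 0 *s coords P"
proof -
  define y where "y = inverse (x $ 0) *s x"
  have y: "y \<in> cone" "y $ 0 = 1" using assms by (simp_all add: y_def smult_in_cone)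
  have e: "1 + (y $ 2)\<^sup>2 = y $ 1 * y $ 3" "y $ 2 = s * (y $ 1 + y $ 3)\<^sup>2"
    using y by (simp_all add: cone_def square_add)
  define w v where "w = y $ 1 + y $ 3" and "v = y $ 1 + y $ 2"
  have "v\<^sup>2 + w * v = y $ 1 * y $ 3 + (y $ 2)\<^sup>2 + w * y $ 2"
    by (simp add: v_def w_def normalize)
  also have "\<dots> = s * w ^ 3 + 1"
    by (simp add: e(2) flip: e(1) w_def) (simp add: power2_eq_square power3_eq_cube ac_simps)
  finally have "(w, v) \<in> affine" by (simp add: affine_def)
  moreover have "y = coords (w, v)"
    using y e(2) by (simp add: vec_eq_iff4 v_def w_def ac_simps flip: e(2))
  then have "x = x $ 0 *s coords (w, v)"
    using assms(2) by (simp add: y_def flip: \<open>y = coords (w, v)\<close>)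
  ultimately show thesis by (rule that)
qed

text \<open>Each coordinate has pole order at most 4, and its coefficient of \<open>w^2\<close> is
  \<open>s\<close> times the coordinate of \<open>infty\<close>; both facts propagate to sums and
  products. So a form of degree \<open>d\<close> has pole order at most \<open>4 * d\<close>,
  attained exactly if it is nonzero at \<open>infty\<close>.\<close>

lemma form_coords:
  assumes "form S d f" and S: "semiring_closed S" "s \<in> S"
  shows "\<exists>A B. represents (\<lambda>P. f (coords P)) A B \<and> (\<forall>i. coeff A i \<in> S) \<and> (\<forall>i. coeff B i \<in> S) \<and>
    degree A \<le> 2 * d \<and> (B = 0 \<or> degree B + 2 \<le> 2 * d) \<and> coeff A (2 * d) = s ^ d * f infty"
  using assms(1)
proof (induction rule: form.induct)
  case (form_const c)
  have "represents (\<lambda>P. c) [:c:] 0" by (rule represents_const)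
  moreover have "\<forall>i. coeff [:c:] i \<in> S" using form_const S(1)
    by (auto simp: semiring_closed_def coeff_pCons split: nat.split)
  ultimately show ?case using S(1) by (intro exI[of _ "[:c:]"] exI[of _ 0]) (simp add: semiring_closed_def)
next
  case (form_nth i)
  have cS: "\<forall>i. coeff p i \<in> S" if "set (coeffs p) \<subseteq> S" for p
    using that S(1) unfolding semiring_closed_def
    by (metis coeff_in_coeffs coeffs_eq_Nil coeff_0 le_degree subsetD)
  show ?case
  proof -
    let ?Q = "\<lambda>i A B. represents (\<lambda>P. coords P $ i) A B \<and> (\<forall>i. coeff A i \<in> S) \<and> (\<forall>i. coeff B i \<in> S) \<and>
      degree A \<le> 2 * 1 \<and> (B = 0 \<or> degree B + 2 \<le> 2 * 1) \<and> coeff A (2 * 1) = s ^ 1 * infty $ i"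
    have "?Q 0 1 0" "?Q 1 [:0, 0, s:] 1" "?Q 2 [:0, 0, s:] 0" "?Q 3 [:0, 1, s:] 1"
      using S by (auto simp: represents_def semiring_closed_def coeff_pCons numeral_2_eq_2 power2_eq_square
          one_pCons ac_simps distrib_left split: nat.split)
    then have "\<forall>i. \<exists>A B. ?Q i A B" unfolding forall_index4 by blast
    then show ?thesis by blast
  qed
next
  case (form_add d f g)
  then obtain A B A' B' where
    *: "represents (\<lambda>P. f (coords P)) A B" "\<forall>i. coeff A i \<in> S" "\<forall>i. coeff B i \<in> S"
    "degree A \<le> 2 * d" "B = 0 \<or> degree B + 2 \<le> 2 * d" "coeff A (2 * d) = s ^ d * f infty"
    "represents (\<lambda>P. g (coords P)) A' B'" "\<forall>i. coeff A' i \<in> S" "\<forall>i. coeff B' i \<in> S"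
    "degree A' \<le> 2 * d" "B' = 0 \<or> degree B' + 2 \<le> 2 * d" "coeff A' (2 * d) = s ^ d * g infty"
    by blast
  have "B + B' = 0 \<or> degree (B + B') + 2 \<le> 2 * d"
    using *(5,11) degree_add_le_max[of B B'] by auto
  moreover have "degree (A + A') \<le> 2 * d" using * by (intro degree_add_le)
  ultimately show ?case
    using represents_add[OF *(1,7)] * S(1)
    by (intro exI[of _ "A + A'"] exI[of _ "B + B'"]) (simp add: semiring_closed_def distrib_left)
next
  case (form_mult d f e g)
  then obtain A B A' B' where
    *: "represents (\<lambda>P. f (coords P)) A B" "\<forall>i. coeff A i \<in> S" "\<forall>i. coeff B i \<in> S"
    "degree A \<le> 2 * d" "B = 0 \<or> degree B + 2 \<le> 2 * d" "coeff A (2 * d) = s ^ d * f infty"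
    "represents (\<lambda>P. g (coords P)) A' B'" "\<forall>i. coeff A' i \<in> S" "\<forall>i. coeff B' i \<in> S"
    "degree A' \<le> 2 * e" "B' = 0 \<or> degree B' + 2 \<le> 2 * e" "coeff A' (2 * e) = s ^ e * g infty"
    by blast
  have low: "degree (B * B' * cubic) < 2 * d + 2 * e \<or> B * B' * cubic = 0"
    using *(5,11) by (cases "B = 0 \<or> B' = 0") (auto simp: degree_mult_eq)
  let ?A = "A * A' + B * B' * cubic" and ?B = "A * B' + A' * B + B * B' * [:0, 1:]"
  have "coeff (B * B' * cubic) (2 * d + 2 * e) = 0" using low by (auto intro: coeff_eq_0)
  then have "coeff ?A (2 * d + 2 * e) = s ^ (d + e) * (f infty * g infty)"
    using coeff_mult_le_degree[OF *(4,10)] *(6,12) by (simp add: power_add ac_simps)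
  moreover have "degree ?A \<le> 2 * d + 2 * e"
    using low *(4,10) degree_mult_le[of A A'] by (intro degree_add_le) auto
  moreover have "?B = 0 \<or> degree ?B + 2 \<le> 2 * d + 2 * e"
  proof -
    have add: "p + q = 0 \<or> degree (p + q) + 2 \<le> n"
      if "p = 0 \<or> degree p + 2 \<le> n" "q = 0 \<or> degree q + 2 \<le> n" for p q :: "'a poly" and n
      using that degree_add_le_max[of p q] by auto
    show ?thesis
    proof (intro add)
      show "A * B' = 0 \<or> degree (A * B') + 2 \<le> 2 * d + 2 * e"
        using *(4,11) degree_mult_le[of A B'] by auto
      show "A' * B = 0 \<or> degree (A' * B) + 2 \<le> 2 * d + 2 * e"
        using *(5,10) degree_mult_le[of A' B] by auto
      show "B * B' * [:0, 1:] = 0 \<or> degree (B * B' * [:0, 1:]) + 2 \<le> 2 * d + 2 * e"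
        using *(5,11) degree_mult_le[of B B'] by auto
    qed
  qed
  moreover have "(\<forall>i. coeff ?A i \<in> S) \<and> (\<forall>i. coeff ?B i \<in> S)"
  proof -
    have c: "\<forall>i. coeff cubic i \<in> S" "\<forall>i. coeff [:0, 1:] i \<in> S"
      using S by (auto simp: semiring_closed_def cubic_def coeff_pCons split: nat.split)
    have a: "\<forall>i. coeff (p + q) i \<in> S" if "\<forall>i. coeff p i \<in> S" "\<forall>i. coeff q i \<in> S" for p q
      using that S(1) by (simp add: semiring_closed_def)
    have m: "\<forall>i. coeff (p * q) i \<in> S" if "\<forall>i. coeff p i \<in> S" "\<forall>i. coeff q i \<in> S" for p q
      using that coeff_mult_closed[OF S(1)] by blast
    have "\<forall>i. coeff ?A i \<in> S" by (rule a[OF m[OF *(2,8)] m[OF m[OF *(3,9)] c(1)]])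
    moreover have "\<forall>i. coeff ?B i \<in> S"
      by (rule a[OF a[OF m[OF *(2,9)] m[OF *(8,3)]] m[OF m[OF *(3,9)] c(2)]])
    ultimately show ?thesis ..
  qed
  moreover note represents_mult[OF *(1,7)]
  ultimately show ?case
    by (intro exI[of _ ?A] exI[of _ ?B]) (simp del: mult_pCons_left mult_pCons_right)
qed

text \<open>The value at \<open>infty\<close> is read off from the coefficient of
  \<open>w ^ (2 * d)\<close>, which is zero with the others.\<close>

lemma form_vanishing:
  assumes "form UNIV d f" "\<And>P. P \<in> affine \<Longrightarrow> f (coords P) = 0" "x \<in> cone"
  shows "f x = 0"
proof (cases "x $ 0 = 0")
  case True
  obtain A B where AB: "represents (\<lambda>P. f (coords P)) A B" "coeff A (2 * d) = s ^ d * f infty"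
    using form_coords[OF assms(1) semiring_closed_UNIV] by auto
  have "A = 0" using represents_zero(1)[OF AB(1)] assms(2) by blast
  with AB(2) s_nonzero have "f infty = 0" by simp
  then show ?thesis using cone_nth_0_eq_0(1)[OF assms(3) True] form_smult[OF assms(1)]
    by (metis mult_zero_right)
next
  case False
  then obtain P where P: "P \<in> affine" "x = x $ 0 *s coords P" using cone_eq_coords assms(3) by blast
  show ?thesis by (subst P(2), subst form_smult[OF assms(1)]) (simp add: assms(2) P(1))
qed

text \<open>
  A section of the \<open>d\<close>-th power of the bundle of hyperplanes is given by quotients of forms whose
  degrees differ by \<open>d\<close>. The hyperplane \<open>x $ 0 = 0\<close> meets the curve only in the point \<open>infty\<close>,
  with multiplicity 4.
\<close>

definition is_section :: "nat \<Rightarrow> ('a ^ 4 \<Rightarrow> 'a) \<Rightarrow> bool" where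
  "is_section d f \<longleftrightarrow> (\<forall>x\<in>cone. \<exists>e q r. form UNIV e q \<and> form UNIV (e + d) r \<and> q x \<noteq> 0 \<and>
     (\<forall>y\<in>cone. q y * f y = r y))"

lemma is_sectionE:
  assumes "is_section d f" "x \<in> cone"
  obtains e q r where "form UNIV e q" "form UNIV (e + d) r" "q x \<noteq> 0"
    "\<And>y. y \<in> cone \<Longrightarrow> q y * f y = r y"
proof -
  from assms have "\<exists>e q r. form UNIV e q \<and> form UNIV (e + d) r \<and> q x \<noteq> 0 \<and>
     (\<forall>y\<in>cone. q y * f y = r y)" unfolding is_section_def by (rule bspec)
  then show thesis using that by (elim exE conjE) simp
qed

text \<open>On the chart, integral closedness applies. At \<open>infty\<close>, a denominator of
  degree \<open>e\<close> that is nonzero there has pole order exactly \<open>4 * e\<close>, and the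
  numerator has at most \<open>4 * (e + d)\<close>; the difference bounds the order of
  \<open>f\<close>.\<close>

lemma section_pole:
  assumes "is_section d f"
  shows "\<exists>A B. represents (\<lambda>P. f (coords P)) A B \<and> pole A B \<le> 4 * d"
proof -
  have "\<exists>A B. represents (\<lambda>P. f (coords P)) A B"
  proof (rule represents_locally)
    fix P assume "P \<in> affine"
    obtain e q r where *: "form UNIV e q" "form UNIV (e + d) r" "q (coords P) \<noteq> 0"
      "\<And>y. y \<in> cone \<Longrightarrow> q y * f y = r y"
      by (rule is_sectionE[OF assms coords_in_cone[OF \<open>P \<in> affine\<close>]]) (rule that; assumption)
    obtain A B A' B' where "represents (\<lambda>P. q (coords P)) A B" "represents (\<lambda>P. r (coords P)) A' B'"
      using form_coords[OF *(1) semiring_closed_UNIV] form_coords[OF *(2) semiring_closed_UNIV] by auto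
    moreover have "\<forall>Q\<in>affine. q (coords Q) * f (coords Q) = r (coords Q)"
      using *(4) coords_in_cone by blast
    ultimately show "\<exists>q r A B A' B'. represents q A B \<and> represents r A' B' \<and> q P \<noteq> 0 \<and>
        (\<forall>Q\<in>affine. q Q * f (coords Q) = r Q)"
      using *(3)
      by (intro exI[of _ "\<lambda>P. q (coords P)"] exI[of _ "\<lambda>P. r (coords P)"] exI[of _ A] exI[of _ B]
          exI[of _ A'] exI[of _ B']) simp
  qed
  then obtain A B where AB: "represents (\<lambda>P. f (coords P)) A B" by blast
  have "pole A B \<le> 4 * d"
  proof (cases "A = 0 \<and> B = 0")
    case False
    then have f: "pole_order (\<lambda>P. f (coords P)) (pole A B)" using AB by (auto intro: pole_orderI)
    obtain e q r where *: "form UNIV e q" "form UNIV (e + d) r" "q infty \<noteq> 0"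
      "\<And>y. y \<in> cone \<Longrightarrow> q y * f y = r y"
      by (rule is_sectionE[OF assms infty_in_cone]) (rule that; assumption)
    obtain C D where q: "represents (\<lambda>P. q (coords P)) C D" "degree C \<le> 2 * e"
        "D = 0 \<or> degree D + 2 \<le> 2 * e" "coeff C (2 * e) = s ^ e * q infty"
      using form_coords[OF *(1) semiring_closed_UNIV] by auto
    have C: "coeff C (2 * e) \<noteq> 0" using q(4) *(3) s_nonzero by simp
    then have "degree C = 2 * e" "C \<noteq> 0" using q(2) le_degree[OF C] by auto
    then have "pole_order (\<lambda>P. q (coords P)) (4 * e)"
      using q by (intro pole_orderI[OF q(1)]) (auto simp: pole_def)
    then have r: "pole_order (\<lambda>P. q (coords P) * f (coords P)) (4 * e + pole A B)"
      using f by (rule pole_order_mult)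
    obtain C' D' where r': "represents (\<lambda>P. r (coords P)) C' D'" "degree C' \<le> 2 * (e + d)"
        "D' = 0 \<or> degree D' + 2 \<le> 2 * (e + d)"
      using form_coords[OF *(2) semiring_closed_UNIV] by auto
    obtain C'' D'' where r'': "represents (\<lambda>P. q (coords P) * f (coords P)) C'' D''"
       "pole C'' D'' = 4 * e + pole A B" using r by (auto simp: pole_order_def)
    have eq: "q (coords P) * f (coords P) = r (coords P)" if "P \<in> affine" for P
      using *(4) coords_in_cone[OF that] by blast
    have "C'' = C'" "D'' = D'" by (rule represents_unique[OF r''(1) r'(1) eq]; assumption)+
    then show ?thesis using r''(2) r'(2,3) by (auto simp: pole_def split: if_splits)
  qed (simp add: pole_def)
  with AB show ?thesis by blast
qed

lemma section_eq_form:
  assumes "is_section d f" "form UNIV d g" "\<And>P. P \<in> affine \<Longrightarrow> f (coords P) = g (coords P)" "x \<in> cone"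
  shows "f x = g x"
proof -
  obtain e q r where *: "form UNIV e q" "form UNIV (e + d) r" "q x \<noteq> 0"
      "\<And>y. y \<in> cone \<Longrightarrow> q y * f y = r y"
    by (rule is_sectionE[OF assms(1,4)]) (rule that; assumption)
  have "form UNIV (e + d) (\<lambda>x. r x + q x * g x)"
    by (rule form_add[OF *(2) form_mult[OF *(1) assms(2)]])
  moreover have "r (coords P) + q (coords P) * g (coords P) = 0" if "P \<in> affine" for P
    using *(4) coords_in_cone[OF that] assms(3)[OF that] by (metis add_self)
  ultimately have "r x + q x * g x = 0" using assms(4) by (rule form_vanishing)
  then have "q x * f x = q x * g x" using *(4) assms(4) by (simp add: add_eq_0_iff_eq)
  with *(3) show ?thesis by simp
qed

lemma section_0_constant:
  assumes "is_section 0 f" "x \<in> cone" "y \<in> cone"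
  shows "f x = f y"
proof -
  obtain A B where AB: "represents (\<lambda>P. f (coords P)) A B" "pole A B \<le> 0"
    using section_pole[OF assms(1)] by auto
  then have "B = 0" "degree A = 0" by (auto simp: pole_def split: if_splits)
  then obtain c where "A = [:c:]" using degree_eq_zeroE by blast
  then have c: "f (coords P) = c" if "P \<in> affine" for P
    using representsD[OF AB(1), of "fst P" "snd P"] that \<open>B = 0\<close> by simp
  have "f z = c" if "z \<in> cone" for z
    by (rule section_eq_form[OF assms(1) form_const c that]) simp_all
  then show ?thesis using assms by simp
qed

definition linear_form :: "(4 \<Rightarrow> 'a) \<Rightarrow> 'a ^ 4 \<Rightarrow> 'a" where
  "linear_form c x = (\<Sum>i\<in>UNIV. c i * x $ i)"

lemma form_linear_form: "form UNIV 1 (linear_form c)"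
  unfolding linear_form_def by (intro form_sum form_cmult form_nth) simp_all

lemma represents_linear_form:
  "represents (\<lambda>P. linear_form c (coords P)) [:c 0, c 3, s * (c 1 + c 2 + c 3):] [:c 1 + c 3:]"
  by (auto simp: represents_def linear_form_def sum_index4 algebra_simps power2_eq_square)

text \<open>Pole order at most 4 leaves the span of 1, \<open>w\<close>, \<open>w^2\<close> and
  \<open>v\<close>, and the linear forms already fill it.\<close>

lemma section_1_linear:
  assumes "is_section 1 f"
  obtains c where "\<And>x. x \<in> cone \<Longrightarrow> f x = linear_form c x"
proof -
  obtain A B where AB: "represents (\<lambda>P. f (coords P)) A B" "pole A B \<le> 4"
    using section_pole[OF assms] by auto
  then have "degree B = 0" "degree A \<le> 2" by (auto simp: pole_def split: if_splits)
  then obtain b where "B = [:b:]" using degree_eq_zeroE by blast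
  have A: "A = [:coeff A 0, coeff A 1, coeff A 2:]"
    using \<open>degree A \<le> 2\<close> by (auto simp: poly_eq_iff coeff_pCons coeff_eq_0 numeral_2_eq_2 split: nat.split)
  \<comment> \<open>The solution of the triangular system given by
    \<open>represents_linear_form\<close>; the coefficient of \<open>w^2\<close> brings in
    \<open>inverse s\<close>.\<close>
  define c where "c = (\<lambda>i. quad (coeff A 0) (b + coeff A 1) (inverse s * coeff A 2 + b) (coeff A 1) $ i)"
  have c: "c 0 = coeff A 0" "c 1 = b + coeff A 1" "c 2 = inverse s * coeff A 2 + b" "c 3 = coeff A 1"
    by (simp_all add: c_def)
  have "c 1 + c 3 = b" "s * (c 1 + c 2 + c 3) = coeff A 2"
    by (simp_all add: c algebra_simps)
  then have "represents (\<lambda>P. linear_form c (coords P)) A B"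
    using represents_linear_form[of c] A \<open>B = [:b:]\<close> by (simp add: c)
  then have "f (coords P) = linear_form c (coords P)" if "P \<in> affine" for P
    using that AB(1) representsD by (metis surj_pair)
  then have "f x = linear_form c x" if "x \<in> cone" for x
    using section_eq_form[OF assms form_linear_form] that by blast
  then show thesis by (rule that)
qed

lemma linear_form_eq_0:
  assumes "\<And>x. x \<in> cone \<Longrightarrow> linear_form c x = 0"
  shows "c i = 0"
proof -
  have 0: "linear_form c (coords P) = 0" if "P \<in> affine" for P using assms coords_in_cone that by blast
  have "[:c 0, c 3, s * (c 1 + c 2 + c 3):] = 0" "[:c 1 + c 3:] = 0"
    by (rule represents_zero[OF represents_linear_form 0]; assumption)+
  then have c: "c 0 = 0" "c 3 = 0" "c 1 + c 3 = 0" "s * (c 1 + c 2 + c 3) = 0"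
    unfolding pCons_eq_0_iff by blast+
  then have "c 1 = 0" "c 1 + c 2 + c 3 = 0" using s_nonzero by simp_all
  with c(1,2) have "\<forall>i. c i = 0" by (simp add: forall_index4)
  then show ?thesis ..
qed

text \<open>The descent step: on the chart the components of \<open>g\<close> have coefficients in
  \<open>S\<close>, and the system for the \<open>c i\<close> can be solved inside
  \<open>S\<close>.\<close>

lemma linear_form_coeff_closed:
  assumes S: "semiring_closed S" "s \<in> S" "inverse s \<in> S"
    and g: "form S d g" "\<And>P. P \<in> affine \<Longrightarrow> g (coords P) = linear_form c (coords P)"
  shows "c i \<in> S"
proof -
  obtain A B where AB: "represents (\<lambda>P. g (coords P)) A B" "\<And>i. coeff A i \<in> S" "\<And>i. coeff B i \<in> S"
    using form_coords[OF g(1) S(1,2)] by blast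
  have "A = [:c 0, c 3, s * (c 1 + c 2 + c 3):]" "B = [:c 1 + c 3:]"
    by (rule represents_unique[OF AB(1) represents_linear_form]; use g(2) in blast)+
  then have *: "c 0 \<in> S" "c 3 \<in> S" "s * (c 1 + c 2 + c 3) \<in> S" "c 1 + c 3 \<in> S"
    using AB(2)[of 0] AB(2)[of 1] AB(2)[of 2] AB(3)[of 0] by (simp_all add: numeral_2_eq_2)
  have add: "x \<in> S \<Longrightarrow> y \<in> S \<Longrightarrow> x + y \<in> S" and mult: "x \<in> S \<Longrightarrow> y \<in> S \<Longrightarrow> x * y \<in> S" for x y
    using S(1) by (auto simp: semiring_closed_def)
  have "c 1 \<in> S" using add[OF *(4) *(2)] by (simp add: ac_simps)
  moreover have "c 2 \<in> S"
    using add[OF mult[OF S(3) *(3)] *(4)] s_nonzero by (simp add: algebra_simps)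
  ultimately have "\<forall>i. c i \<in> S" using * by (simp add: forall_index4)
  then show ?thesis ..
qed

end

section \<open>Automorphisms and rigidity\<close>

context mu4_closed
begin

lemma form_law:
  assumes S: "semiring_closed S" "s \<in> S"
    and g: "\<And>i. form S d (\<lambda>x. g x $ i)" and h: "\<And>i. form S e (\<lambda>x. h x $ i)"
  shows "form S (2 * d + 2 * e) (\<lambda>x. law i (g x) (h x) $ j)"
proof -
  have m: "form S (2 * d + 2 * e) (\<lambda>x. g x $ i * g x $ j * h x $ k * h x $ l)" for i j k l
    using form_mult[OF form_mult[OF form_mult[OF g g] h] h] by (simp add: mult_2 add.assoc)
  have q: "form S (2 * d + 2 * e) (\<lambda>x. (g x $ i * h x $ j + g x $ k * h x $ l)\<^sup>2)" for i j k l
    using form_power[OF _ form_add[OF form_mult[OF g h] form_mult[OF g h]], of 2] S(1)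
    by (simp add: semiring_closed_def distrib_left)
  have "\<forall>i j. form S (2 * d + 2 * e) (\<lambda>x. law i (g x) (h x) $ j)"
    unfolding forall_index4 law_nth by (intro conjI form_cmult form_add m q S(2))
  then show ?thesis by blast
qed

lemma form_neg4: "(\<And>i. form S d (\<lambda>x. g x $ i)) \<Longrightarrow> form S d (\<lambda>x. neg4 (g x) $ i)"
proof -
  assume "\<And>i. form S d (\<lambda>x. g x $ i)"
  then have "\<forall>i. form S d (\<lambda>x. neg4 (g x) $ i)" by (simp add: forall_index4)
  then show ?thesis ..
qed

text \<open>The degree \<open>Suc d\<close> is positive, so \<open>g\<close> maps 0 to 0. In a
  composition this ensures that the inner tuple is nonzero wherever the composed one is.\<close>

definition morphism :: "('a ^ 4 \<Rightarrow> 'a ^ 4) \<Rightarrow> bool" where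
  "morphism f \<longleftrightarrow> (\<forall>x\<in>cone. f x \<in> cone) \<and>
     (\<forall>x\<in>cone. \<exists>d g. (\<forall>i. form UNIV (Suc d) (\<lambda>y. g y $ i)) \<and> g x \<noteq> 0 \<and>
        (\<forall>y\<in>cone. g y \<noteq> 0 \<longrightarrow> g y \<propto> f y))"

lemma morphism_in_cone: "morphism f \<Longrightarrow> x \<in> cone \<Longrightarrow> f x \<in> cone"
  by (simp add: morphism_def)

lemma morphismE:
  assumes "morphism f" "x \<in> cone"
  obtains d g where "\<And>i. form UNIV (Suc d) (\<lambda>y. g y $ i)" "g x \<noteq> 0"
    "\<And>y. y \<in> cone \<Longrightarrow> g y \<noteq> 0 \<Longrightarrow> g y \<propto> f y"
proof -
  from assms have "\<exists>d g. (\<forall>i. form UNIV (Suc d) (\<lambda>y. g y $ i)) \<and> g x \<noteq> 0 \<and>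
      (\<forall>y\<in>cone. g y \<noteq> 0 \<longrightarrow> g y \<propto> f y)"
    by (simp only: morphism_def)
  then show thesis
  proof (elim exE conjE)
    fix d g
    assume "\<forall>i. form UNIV (Suc d) (\<lambda>y. g y $ i)" "g x \<noteq> 0"
      "\<forall>y\<in>cone. g y \<noteq> 0 \<longrightarrow> g y \<propto> f y"
    then show thesis by (intro that[of d g]) auto
  qed
qed

lemma form_vec_smult:
  "(\<And>i. form S d (\<lambda>y. g y $ i)) \<Longrightarrow> g (c *s x) = c ^ d *s g x"
  by (simp add: vec_eq_iff form_smult[of S d "\<lambda>y. g y $ _"])

lemma morphism_cong:
  assumes "morphism f" "x \<in> cone" "x \<propto> x'"
  shows "f x \<propto> f x'"
proof -
  obtain d g where g: "\<And>i. form UNIV (Suc d) (\<lambda>y. g y $ i)" "g x \<noteq> 0"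
    "\<And>y. y \<in> cone \<Longrightarrow> g y \<noteq> 0 \<Longrightarrow> g y \<propto> f y" by (rule morphismE[OF assms(1,2)]) (rule that; assumption)
  obtain c where c: "c \<noteq> 0" "x' = c *s x" using assms(3) by (auto simp: proportional_def)
  have eq: "g x' = c ^ Suc d *s g x" using form_vec_smult[OF g(1)] by (simp only: c(2))
  have "f x \<propto> g x" using g(2,3) assms(2) proportional_sym by blast
  also have "g x \<propto> g x'" using c(1) eq unfolding proportional_def by (intro exI[of _ "c ^ Suc d"]) simp
  also have "g x' \<propto> f x'"
    using g(2) eq c(1) assms proportional_in_cone by (intro g(3)) auto
  finally show ?thesis .
qed

lemma morphism_compose:
  assumes "morphism f" "morphism f'"
  shows "morphism (\<lambda>x. f (f' x))"
  unfolding morphism_def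
proof (intro conjI ballI)
  fix x assume x: "x \<in> cone"
  then have fx: "f' x \<in> cone" using assms(2) morphism_in_cone by blast
  then show "f (f' x) \<in> cone" using assms(1) morphism_in_cone by blast
  obtain d g where g: "\<And>i. form UNIV (Suc d) (\<lambda>y. g y $ i)" "g (f' x) \<noteq> 0"
    "\<And>y. y \<in> cone \<Longrightarrow> g y \<noteq> 0 \<Longrightarrow> g y \<propto> f y" by (rule morphismE[OF assms(1) fx]) (rule that; assumption)
  obtain e h where h: "\<And>i. form UNIV (Suc e) (\<lambda>y. h y $ i)" "h x \<noteq> 0"
    "\<And>y. y \<in> cone \<Longrightarrow> h y \<noteq> 0 \<Longrightarrow> h y \<propto> f' y" by (rule morphismE[OF assms(2) x]) (rule that; assumption)
  have "form UNIV (Suc (d * Suc e + e)) (\<lambda>y. g (h y) $ i)" for i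
    using form_compose[OF g(1)[of i] h(1)] by (simp add: ac_simps)
  moreover have "g (h x) \<noteq> 0"
  proof -
    obtain c where "c \<noteq> 0" "h x = c *s f' x"
      using h(2,3) x proportional_sym by (metis proportional_def)
    then show ?thesis using g(2) form_vec_smult[OF g(1), of c "f' x"] by simp
  qed
  moreover have "g (h y) \<propto> f (f' y)" if y: "y \<in> cone" and nz: "g (h y) \<noteq> 0" for y
  proof -
    have "h y \<noteq> 0"
      using nz form_vec_smult[OF g(1), of 0 "h y"] by auto
    then have p: "h y \<propto> f' y" using h(3) y by blast
    then have hy: "h y \<in> cone"
      using proportional_in_cone proportional_sym morphism_in_cone[OF assms(2) y] by blast
    have "g (h y) \<propto> f (h y)" using g(3) hy nz by blast
    also have "f (h y) \<propto> f (f' y)" using morphism_cong[OF assms(1) hy p] .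
    finally show ?thesis .
  qed
  ultimately show "\<exists>d g. (\<forall>i. form UNIV (Suc d) (\<lambda>y. g y $ i)) \<and> g x \<noteq> 0 \<and>
      (\<forall>y\<in>cone. g y \<noteq> 0 \<longrightarrow> g y \<propto> f (f' y))"
    by (intro exI[of _ "d * Suc e + e"] exI[of _ "\<lambda>y. g (h y)"]) blast
qed

lemma form_const_nth: "form UNIV 0 (\<lambda>y. b $ i)"
  by (rule form_const) simp

lemma morphism_padd:
  assumes "b \<in> cone"
  shows "morphism (\<lambda>x. padd x b)"
  unfolding morphism_def
proof (intro conjI ballI)
  fix x assume x: "x \<in> cone"
  then show "padd x b \<in> cone" using assms by (rule padd_in_cone)
  obtain i where "law i x b \<noteq> 0" using ex_law_nonzero x assms by blast
  moreover have "form UNIV (Suc 1) (\<lambda>y. law i y b $ j)" for j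
    using form_law[OF semiring_closed_UNIV UNIV_I form_nth form_const_nth]
    by (simp add: numeral_2_eq_2)
  ultimately show "\<exists>d g. (\<forall>i. form UNIV (Suc d) (\<lambda>y. g y $ i)) \<and> g x \<noteq> 0 \<and>
      (\<forall>y\<in>cone. g y \<noteq> 0 \<longrightarrow> g y \<propto> padd y b)"
    using law_padd assms by (intro exI[of _ 1] exI[of _ "\<lambda>y. law i y b"]) blast
qed

section \<open>Pole orders of solutions of the Weierstrass equation\<close>

lemma pole_cases:
  assumes "represents u A B"
  obtains c where "\<And>P. P \<in> affine \<Longrightarrow> u P = c" | n where "n > 0" "pole_order u n"
proof (cases "pole A B = 0")
  case True
  then have "B = 0" "degree A = 0" by (auto simp: pole_def split: if_splits)
  then obtain c where "A = [:c:]" using degree_eq_zeroE by blast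
  then have "u P = c" if "P \<in> affine" for P
    using representsD[OF assms, of "fst P" "snd P"] that \<open>B = 0\<close> by simp
  then show thesis by (rule that(1))
next
  case False
  then have "A \<noteq> 0 \<or> B \<noteq> 0" by (auto simp: pole_def)
  then have "pole_order u (pole A B)" using assms by (auto intro: pole_orderI)
  with False show thesis by (intro that(2)) simp_all
qed

lemma pole_order_constant:
  assumes "pole_order u n" "\<And>P. P \<in> affine \<Longrightarrow> u P = c"
  shows "n = 0"
proof -
  obtain A B where AB: "represents u A B" "pole A B = n" using assms(1) by (auto simp: pole_order_def)
  have "A = [:c:]" "B = 0"
    by (rule represents_unique[OF AB(1) represents_const assms(2)]; assumption)+
  with AB(2) show ?thesis by (simp add: pole_def)
qed

lemma pole_order_cmult: "c \<noteq> 0 \<Longrightarrow> pole_order u n \<Longrightarrow> pole_order (\<lambda>P. c * u P) n"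
  using pole_order_mult[OF pole_order_const] by fastforce

lemma pole_order_poly:
  assumes "pole_order u m" "m > 0" "p \<noteq> 0"
  shows "pole_order (\<lambda>P. poly p (u P)) (m * degree p)"
  using assms(3)
proof (induction p)
  case (pCons a p)
  show ?case
  proof (cases "p = 0")
    case True
    with pCons show ?thesis by (simp add: pole_order_const)
  next
    case False
    then have *: "pole_order (\<lambda>P. u P * poly p (u P)) (m * degree (pCons a p))"
      using pole_order_mult[OF assms(1) pCons.IH[OF False]] by simp
    show ?thesis
    proof (cases "a = 0")
      case False
      have "pole_order (\<lambda>P. a + u P * poly p (u P)) (m * degree (pCons a p))"
        using assms(2) \<open>p \<noteq> 0\<close> by (intro pole_order_add[OF pole_order_const[OF False] *]) simp
      then show ?thesis by simp
    qed (use * in simp)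
  qed
qed simp

lemma pole_order_fst: "pole_order fst 2" and pole_order_snd: "pole_order snd 3"
  by (auto intro!: pole_orderI[OF represents_fst] pole_orderI[OF represents_snd] simp: pole_def)

text \<open>
  An endomorphism of the coordinate ring multiplies pole orders by some \<open>t\<close>, because the images
  of \<open>w\<close> and \<open>v\<close> still satisfy the equation of the curve.
\<close>

lemma weierstrass_pole_orders:
  assumes W: "represents W A B" and V: "represents V C D"
    and eq: "\<And>P. P \<in> affine \<Longrightarrow> (W P, V P) \<in> affine"
    and nonconstant: "\<And>a b. \<exists>P\<in>affine. (W P, V P) \<noteq> (a, b)"
  obtains t where "t > 0" "pole_order W (2 * t)" "pole_order V (3 * t)"
proof -
  have vw: "V P * (V P + W P) = poly cubic (W P)" if "P \<in> affine" for P
    using eq[OF that] by (simp add: affine_def cubic_def power2_eq_square power3_eq_cube algebra_simps)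
  have VW: "represents (\<lambda>P. V P + W P) (C + A) (D + B)" by (intro represents_add W V)
  show thesis
  proof (cases rule: pole_cases[OF W])
    case (1 a)
    show thesis
    proof (cases rule: pole_cases[OF V])
      case (1 b)
      with \<open>\<And>P. P \<in> affine \<Longrightarrow> W P = a\<close> nonconstant show thesis by blast
    next
      case (2 n)
      have "pole_order (\<lambda>P. V P + W P) n"
      proof (cases "a = 0")
        case True
        with 2(2) 1 show ?thesis by (subst pole_order_cong[of _ V]) auto
      next
        case False
        have "pole_order (\<lambda>P. a + V P) n" by (rule pole_order_add[OF pole_order_const[OF False] 2(2,1)])
        then show ?thesis using 1 by (subst pole_order_cong[of _ "\<lambda>P. a + V P"]) auto
      qed
      from pole_order_mult[OF 2(2) this] have "n + n = 0"
        by (rule pole_order_constant[where c = "poly cubic a"]) (use vw 1 in auto)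
      with 2(1) show thesis by simp
    qed
  next
    case (2 m)
    have "pole_order (\<lambda>P. poly cubic (W P)) (m * 3)"
      using pole_order_poly[OF 2(2,1) cubic_nonzero] by simp
    then have m3: "pole_order (\<lambda>P. V P * (V P + W P)) (3 * m)"
      using pole_order_cong[OF vw] by (simp add: mult.commute)
    have unique: "k = 3 * m" if "pole_order (\<lambda>P. V P * (V P + W P)) k" for k
      using pole_order_unique m3 that by blast
    \<comment> \<open>This excludes that one of the factors \<open>V\<close> and
      \<open>V + W\<close> is constant while the other has order less than
      \<open>3 * m\<close>.\<close>
    have sum: False if "\<And>P. P \<in> affine \<Longrightarrow> u P = c"
       "\<And>P. P \<in> affine \<Longrightarrow> V P * (V P + W P) = u P * u' P" "pole_order u' k" "k < 3 * m" for u u' c k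
    proof (cases "c = 0")
      case True
      then have "3 * m = 0" using that by (intro pole_order_constant[OF m3, of 0]) auto
      with 2 show False by simp
    next
      case False
      then have "pole_order (\<lambda>P. c * u' P) k" using that(3) by (rule pole_order_cmult)
      then have "pole_order (\<lambda>P. V P * (V P + W P)) k"
        using that(1,2) by (subst pole_order_cong[of _ "\<lambda>P. c * u' P"]) auto
      with unique that(4) show False by blast
    qed
    show thesis
    proof (cases rule: pole_cases[OF V])
      case (1 b)
      have "pole_order (\<lambda>P. V P + W P) m"
      proof (cases "b = 0")
        case True
        with 2(2) 1 show ?thesis by (subst pole_order_cong[of _ W]) auto
      next
        case False
        have "pole_order (\<lambda>P. b + W P) m" by (rule pole_order_add[OF pole_order_const[OF False] 2(2,1)])
        then show ?thesis using 1 by (subst pole_order_cong[of _ "\<lambda>P. b + W P"]) auto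
      qed
      with sum[of V b "\<lambda>P. V P + W P" m] 1 2(1) show thesis by auto
    next
      case V: (2 n)
      \<comment> \<open>The product \<open>V (V + W)\<close> must have order \<open>3 * m\<close>.
        It has order \<open>n + m\<close> if \<open>n < m\<close>, and at most \<open>2 * m\<close>
        if \<open>n = m\<close>; there remains \<open>n > m\<close>, where the order is
        \<open>2 * n\<close>.\<close>
      consider "n < m" | "n > m" | "n = m" by linarith
      then show thesis
      proof cases
        assume "n < m"
        from unique[OF pole_order_mult[OF V(2) pole_order_add[OF V(2) 2(2) this]]] this
        show thesis by simp
      next
        assume "n > m"
        then have "pole_order (\<lambda>P. V P + W P) n"
          using pole_order_add[OF 2(2) V(2)] by (simp add: add.commute)
        from unique[OF pole_order_mult[OF V(2) this]] have "2 * n = 3 * m" by simp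
        then have "\<exists>t. m = 2 * t \<and> n = 3 * t" by presburger
        then obtain t where t: "m = 2 * t" "n = 3 * t" by blast
        then show thesis using that[of t] 2 V by simp
      next
        assume nm: "n = m"
        show thesis
        proof (cases rule: pole_cases[OF VW])
          case (1 c)
          then show thesis using sum[of "\<lambda>P. V P + W P" c V n] V nm 2(1) by (auto simp: mult.commute)
        next
          case k: (2 k)
          have "k \<le> m"
          proof (rule ccontr)
            assume "\<not> k \<le> m"
            then have "pole_order (\<lambda>P. W P + (V P + W P)) k"
              by (intro pole_order_add[OF 2(2) k(2)]) simp
            then have "pole_order V k" by (subst pole_order_cong[of _ "\<lambda>P. W P + (V P + W P)"]) (auto simp: ac_simps)
            with V(2) nm \<open>\<not> k \<le> m\<close> show False using pole_order_unique by blast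
          qed
          with unique[OF pole_order_mult[OF V(2) k(2)]] nm 2(1) show thesis by simp
        qed
      qed
    qed
  qed
qed

text \<open>The two summands have orders \<open>t * (2 * degree A)\<close> and
  \<open>t * (2 * degree B + 3)\<close>. By parity these differ, so the sum has the larger
  one.\<close>

lemma weierstrass_dvd_pole_order:
  assumes t: "t > 0" "pole_order W (2 * t)" "pole_order V (3 * t)"
    and u: "pole_order (\<lambda>P. poly A (W P) + poly B (W P) * V P) n"
  shows "t dvd n"
proof -
  have A: "pole_order (\<lambda>P. poly A (W P)) (2 * t * degree A)" if "A \<noteq> 0"
    using pole_order_poly[OF t(2) _ that] t(1) by simp
  have B: "pole_order (\<lambda>P. poly B (W P) * V P) (2 * t * degree B + 3 * t)" if "B \<noteq> 0"
    using pole_order_mult[OF pole_order_poly[OF t(2) _ that] t(3)] t(1) by simp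
  show ?thesis
  proof (cases "A = 0 \<or> B = 0")
    case True
    then consider "A = 0" "B = 0" | "A = 0" "B \<noteq> 0" | "A \<noteq> 0" "B = 0" by blast
    then show ?thesis
    proof cases
      case 1
      then have "n = 0" using pole_order_constant[OF u, of 0] by simp
      then show ?thesis by simp
    next
      case 2
      then have "n = 2 * t * degree B + 3 * t" using u B pole_order_unique by simp
      then show ?thesis by simp
    next
      case 3
      then have "n = 2 * t * degree A" using u A pole_order_unique by simp
      then show ?thesis by simp
    qed
  next
    case False
    have "2 * t * degree A \<noteq> 2 * t * degree B + 3 * t"
    proof
      assume "2 * t * degree A = 2 * t * degree B + 3 * t"
      then have "t * (2 * degree A) = t * (2 * degree B + 3)" by (simp add: algebra_simps)
      then have "2 * degree A = 2 * degree B + 3" using t(1) by simp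
      then show False by presburger
    qed
    then consider "2 * t * degree A < 2 * t * degree B + 3 * t" | "2 * t * degree A > 2 * t * degree B + 3 * t"
      by linarith
    then show ?thesis
    proof cases
      case 1
      then have "n = 2 * t * degree B + 3 * t"
        using pole_order_unique[OF u pole_order_add[OF A B]] False by simp
      then show ?thesis by simp
    next
      case 2
      then have "pole_order (\<lambda>P. poly B (W P) * V P + poly A (W P)) (2 * t * degree A)"
        using pole_order_add[OF B A] False by simp
      then have "n = 2 * t * degree A" using pole_order_unique[OF u] by (simp add: add.commute)
      then show ?thesis by simp
    qed
  qed
qed

text \<open>The orders force \<open>W = a w + b\<close> and \<open>V = c v + d w + e\<close>. The
  \<open>v\<close>-component of the equation gives \<open>b = 0\<close> and \<open>a = c\<close>,
  the term \<open>w^3\<close> gives \<open>c = 1\<close>, and the lower terms give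
  \<open>e = 0\<close> and \<open>d (d + 1) = 0\<close>.\<close>

lemma weierstrass_coordinate_change:
  assumes W: "represents W A B" "pole_order W 2" and V: "represents V C D" "pole_order V 3"
    and eq: "\<And>P. P \<in> affine \<Longrightarrow> (W P, V P) \<in> affine"
  shows "(\<forall>(w, v)\<in>affine. W (w, v) = w \<and> V (w, v) = v) \<or>
    (\<forall>(w, v)\<in>affine. W (w, v) = w \<and> V (w, v) = v + w)"
proof -
  have "pole A B = 2" "pole C D = 3"
    using W V pole_order_unique pole_orderI represents_unique unfolding pole_order_def by metis+
  then have deg: "B = 0" "degree A = 1" "D \<noteq> 0" "degree D = 0" "degree C \<le> 1"
    by (auto simp: pole_def max_def split: if_splits) presburger+
  have linear: "p = [:coeff p 0, coeff p 1:]" if "degree p \<le> 1" for p :: "'a poly"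
    using that by (auto simp: poly_eq_iff coeff_pCons coeff_eq_0 split: nat.split)
  define a b where "a = coeff A 1" and "b = coeff A 0"
  have "degree A \<le> 1" using deg(2) by simp
  then have A: "A = [:b, a:]" unfolding a_def b_def by (rule linear)
  obtain c where D: "D = [:c:]" using degree_eq_zeroE[OF deg(4)] .
  with deg(3) have "c \<noteq> 0" by simp
  define d e where "d = coeff C 1" and "e = coeff C 0"
  have C: "C = [:e, d:]" unfolding d_def e_def using deg(5) by (rule linear)
  have "represents (\<lambda>P. V P * V P + W P * V P) (C * C + D * D * cubic + (A * C + 0 * D * cubic))
      (C * D + C * D + D * D * [:0, 1:] + (A * D + C * 0 + 0 * D * [:0, 1:]))"
    using W(1) V(1) deg(1) by (intro represents_add represents_mult) simp_all
  moreover have "represents (\<lambda>P. s * (W P * (W P * W P)) + 1) ([:1:] + smult s (A * (A * A))) 0"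
    using W(1) deg(1) by (auto simp: represents_def split_beta)
  moreover have "V P * V P + W P * V P = s * (W P * (W P * W P)) + 1" if "P \<in> affine" for P
    using eq[OF that] by (simp add: affine_def power2_eq_square power3_eq_cube ac_simps)
  ultimately have *: "C * C + D * D * cubic + (A * C + 0 * D * cubic) = [:1:] + smult s (A * (A * A))"
    "C * D + C * D + D * D * [:0, 1:] + (A * D + C * 0 + 0 * D * [:0, 1:]) = 0"
    using represents_unique by blast+
  have "b * c = 0" "c * c + a * c = 0" using *(2) by (auto simp: A C D ac_simps)
  with \<open>c \<noteq> 0\<close> have b: "b = 0" and ac: "a = c" by (auto simp: add_eq_0_iff_eq)
  have 3: "c * c * s = s * (c * (c * c))" "d * d + c * d = 0" "c * e = 0"
    using *(1) by (auto simp: A C D cubic_def b ac ac_simps)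
  with s_nonzero \<open>c \<noteq> 0\<close> have c1: "c = 1" by (auto simp: ac_simps)
  with 3 have e: "e = 0" and "d * (d + 1) = 0" by (simp_all add: distrib_left)
  then consider "d = 0" | "d = 1" by (auto simp: add_eq_0_iff_eq)
  then show ?thesis
    using representsD[OF W(1)] representsD[OF V(1)] A C D deg(1) b ac c1 e
    by cases (auto simp: add.commute)
qed

section \<open>Automorphisms of the curve that fix the point at infinity\<close>

definition wcoord :: "'a ^ 4 \<Rightarrow> 'a" where "wcoord x = (x $ 1 + x $ 3) / x $ 0"

definition vcoord :: "'a ^ 4 \<Rightarrow> 'a" where "vcoord x = (x $ 1 + x $ 2) / x $ 0"

lemma wcoord_coords [simp]: "wcoord (coords (w, v)) = w"
  and vcoord_coords [simp]: "vcoord (coords (w, v)) = v"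
  by (simp_all add: wcoord_def vcoord_def ac_simps)

lemma wcoord_cong: "x \<propto> y \<Longrightarrow> wcoord x = wcoord y"
  and vcoord_cong: "x \<propto> y \<Longrightarrow> vcoord x = vcoord y"
  by (auto simp: wcoord_def vcoord_def proportional_def simp flip: distrib_left)

lemma coords_wcoord_vcoord:
  assumes "x \<in> cone" "x $ 0 \<noteq> 0"
  shows "(wcoord x, vcoord x) \<in> affine" "coords (wcoord x, vcoord x) \<propto> x"
proof -
  obtain P where P: "P \<in> affine" "x = x $ 0 *s coords P" using cone_eq_coords assms by blast
  then have p: "coords P \<propto> x" using assms(2) by (auto simp: proportional_def)
  then have "P = (wcoord x, vcoord x)"
    using wcoord_cong[OF p] vcoord_cong[OF p] by (metis prod.exhaust wcoord_coords vcoord_coords)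
  with P(1) p show "(wcoord x, vcoord x) \<in> affine" "coords (wcoord x, vcoord x) \<propto> x" by auto
qed

text \<open>A local tuple \<open>g\<close> for \<open>f\<close> gives both functions as quotients
  with denominator \<open>g $ 0\<close>, which is nonzero at the point since its image stays in the
  chart.\<close>

lemma represents_morphism:
  assumes f: "morphism f" "\<And>x. x \<in> cone \<Longrightarrow> x $ 0 \<noteq> 0 \<Longrightarrow> f x $ 0 \<noteq> 0"
  shows "\<exists>A B. represents (\<lambda>P. wcoord (f (coords P))) A B"
    "\<exists>A B. represents (\<lambda>P. vcoord (f (coords P))) A B"
proof -
  have *: "\<exists>A B. represents (\<lambda>P. (f (coords P) $ i + f (coords P) $ j) / f (coords P) $ 0) A B" for i j
  proof (rule represents_locally)
    fix P assume P: "P \<in> affine"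
    obtain d g where g: "\<And>i. form UNIV (Suc d) (\<lambda>y. g y $ i)" "g (coords P) \<noteq> 0"
      "\<And>y. y \<in> cone \<Longrightarrow> g y \<noteq> 0 \<Longrightarrow> g y \<propto> f y"
      by (rule morphismE[OF f(1) coords_in_cone[OF P]]) (rule that; assumption)
    obtain A B where r: "represents (\<lambda>P. g (coords P) $ 0) A B"
      using form_coords[OF g(1)[of 0] semiring_closed_UNIV UNIV_I] by blast
    obtain A' B' where r': "represents (\<lambda>P. g (coords P) $ i + g (coords P) $ j) A' B'"
      using form_coords[OF form_add[OF g(1)[of i] g(1)[of j]] semiring_closed_UNIV UNIV_I] by blast
    have "coords P $ 0 \<noteq> 0" if "P \<in> affine" for P by (cases P) simp
    then have nz: "f (coords P) $ 0 \<noteq> 0" if "P \<in> affine" for P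
      using f(2) coords_in_cone that by blast
    have "g (coords P) $ 0 \<noteq> 0"
      using nz[OF P] g(2,3) coords_in_cone[OF P] proportional_nth_eq_0 by blast
    moreover have "g (coords Q) $ 0 * ((f (coords Q) $ i + f (coords Q) $ j) / f (coords Q) $ 0) =
        g (coords Q) $ i + g (coords Q) $ j" if "Q \<in> affine" for Q
    proof (cases "g (coords Q) = 0")
      case False
      then have "g (coords Q) \<propto> f (coords Q)" using g(3) coords_in_cone[OF that] by blast
      from proportional_minorsD[OF this, of 0] show ?thesis
        using nz[OF that] by (simp add: field_simps)
    qed simp
    ultimately show "\<exists>q r A B A' B'. represents q A B \<and> represents r A' B' \<and> q P \<noteq> 0 \<and>
        (\<forall>Q\<in>affine. q Q * ((f (coords Q) $ i + f (coords Q) $ j) / f (coords Q) $ 0) = r Q)"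
      using r r'
      by (intro exI[of _ "\<lambda>P. g (coords P) $ 0"] exI[of _ "\<lambda>P. g (coords P) $ i + g (coords P) $ j"]
          exI[of _ A] exI[of _ B] exI[of _ A'] exI[of _ B']) simp
  qed
  show "\<exists>A B. represents (\<lambda>P. wcoord (f (coords P))) A B"
    "\<exists>A B. represents (\<lambda>P. vcoord (f (coords P))) A B"
    using *[of 1 3] *[of 1 2] by (simp_all add: wcoord_def vcoord_def)
qed

text \<open>Otherwise \<open>x\<close> and \<open>infty\<close> would have the same image, and
  \<open>f'\<close> would identify them.\<close>

lemma morphism_inverse_nth_0:
  assumes f: "morphism f" "morphism f'" "\<And>x. x \<in> cone \<Longrightarrow> f' (f x) \<propto> x" "f infty \<propto> infty"
    and x: "x \<in> cone" "x $ 0 \<noteq> 0"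
  shows "f x $ 0 \<noteq> 0"
proof
  assume "f x $ 0 = 0"
  then have "f x \<propto> infty" using cone_nth_0_eq_0_proportional morphism_in_cone[OF f(1) x(1)] by blast
  then have "f x \<propto> f infty" using f(4) proportional_sym proportional_trans by blast
  then have "f' (f x) \<propto> f' (f infty)" using morphism_cong[OF f(2) morphism_in_cone[OF f(1) x(1)]] by blast
  then have "x \<propto> infty" using f(3) x(1) infty_in_cone proportional_sym proportional_trans by meson
  with x(2) show False using proportional_nth_eq_0 infty_nth(1) by blast
qed

lemma automorphism_fixing_infty:
  assumes f: "morphism f" "morphism f'" "\<And>x. x \<in> cone \<Longrightarrow> f' (f x) \<propto> x"
    "\<And>x. x \<in> cone \<Longrightarrow> f (f' x) \<propto> x" "f infty \<propto> infty"
  shows "(\<forall>x\<in>cone. f x \<propto> x) \<or> (\<forall>x\<in>cone. f x \<propto> neg4 x)"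
proof -
  have f'_infty: "f' infty \<propto> infty"
  proof -
    have "f' infty \<propto> f' (f infty)" by (rule morphism_cong[OF f(2) infty_in_cone proportional_sym[OF f(5)]])
    then show ?thesis using f(3) infty_in_cone proportional_trans by blast
  qed
  have nz: "f x $ 0 \<noteq> 0" "f' x $ 0 \<noteq> 0" if "x \<in> cone" "x $ 0 \<noteq> 0" for x
    using morphism_inverse_nth_0 f f'_infty that by blast+
  define W V where "W = (\<lambda>P. wcoord (f (coords P)))" and "V = (\<lambda>P. vcoord (f (coords P)))"
  obtain A B C D where W: "represents W A B" and V: "represents V C D"
    using represents_morphism[OF f(1) nz(1)] unfolding W_def V_def by blast
  obtain A' B' C' D' where W': "represents (\<lambda>P. wcoord (f' (coords P))) A' B'"
    and V': "represents (\<lambda>P. vcoord (f' (coords P))) C' D'"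
    using represents_morphism[OF f(2) nz(2)] by blast
  have c0: "coords P $ 0 \<noteq> 0" for P by (cases P) simp
  have WV: "(W P, V P) \<in> affine" "coords (W P, V P) \<propto> f (coords P)" if "P \<in> affine" for P
    unfolding W_def V_def
    using coords_wcoord_vcoord morphism_in_cone[OF f(1)] coords_in_cone[OF that] nz(1) c0 by blast+
  have inverse: "f' (coords (W P, V P)) \<propto> coords P" if "P \<in> affine" for P
  proof -
    have "f' (coords (W P, V P)) \<propto> f' (f (coords P))"
      using WV[OF that] by (intro morphism_cong[OF f(2)] coords_in_cone)
    then show ?thesis using f(3) coords_in_cone[OF that] proportional_trans by blast
  qed
  have inv: "w = poly A' (W (w, v)) + poly B' (W (w, v)) * V (w, v)"
    "v = poly C' (W (w, v)) + poly D' (W (w, v)) * V (w, v)" if "(w, v) \<in> affine" for w v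
    using wcoord_cong[OF inverse[OF that]] vcoord_cong[OF inverse[OF that]]
      representsD[OF W' WV(1)[OF that]] representsD[OF V' WV(1)[OF that]] by simp_all
  have nonconstant: "\<exists>P\<in>affine. (W P, V P) \<noteq> (a, b)" for a b
  proof (rule ccontr)
    assume c: "\<not> (\<exists>P\<in>affine. (W P, V P) \<noteq> (a, b))"
    obtain v v' where "(0, v) \<in> affine" "(1, v') \<in> affine" using ex_affine by blast
    with inv(1)[of 0 v] inv(1)[of 1 v'] c show False by fastforce
  qed
  obtain t where t: "t > 0" "pole_order W (2 * t)" "pole_order V (3 * t)"
    using weierstrass_pole_orders[OF W V WV(1) nonconstant] by blast
  \<comment> \<open>Through the inverse \<open>f'\<close>, the functions \<open>w\<close> and
    \<open>v\<close> of orders 2 and 3 are polynomials in \<open>W\<close> and \<open>V\<close>,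
    whose orders are multiples of \<open>t\<close>.\<close>
  have "t dvd 2"
  proof (rule weierstrass_dvd_pole_order[OF t])
    show "pole_order (\<lambda>P. poly A' (W P) + poly B' (W P) * V P) 2"
      using pole_order_fst by (rule pole_order_cong[THEN iffD1, rotated]) (use inv(1) in force)
  qed
  moreover have "t dvd 3"
  proof (rule weierstrass_dvd_pole_order[OF t])
    show "pole_order (\<lambda>P. poly C' (W P) + poly D' (W P) * V P) 3"
      using pole_order_snd by (rule pole_order_cong[THEN iffD1, rotated]) (use inv(2) in force)
  qed
  ultimately have "t dvd 3 - 2" by (rule dvd_diff_nat[rotated])
  then have "t = 1" by simp
  with t have "pole_order W 2" "pole_order V 3" by simp_all
  then have "(\<forall>(w, v)\<in>affine. W (w, v) = w \<and> V (w, v) = v) \<or>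
      (\<forall>(w, v)\<in>affine. W (w, v) = w \<and> V (w, v) = v + w)"
    using W V WV(1) by (intro weierstrass_coordinate_change)
  then have cases: "(\<forall>P\<in>affine. f (coords P) \<propto> coords P) \<or> (\<forall>P\<in>affine. f (coords P) \<propto> neg4 (coords P))"
  proof (elim disjE)
    assume "\<forall>(w, v)\<in>affine. W (w, v) = w \<and> V (w, v) = v"
    then have "f (coords P) \<propto> coords P" if "P \<in> affine" for P
      using WV(2)[OF that] that proportional_sym by (cases P) force
    then show ?thesis by blast
  next
    assume *: "\<forall>(w, v)\<in>affine. W (w, v) = w \<and> V (w, v) = v + w"
    have neg: "neg4 (coords (w, v)) = coords (w, v + w)" for w v
      by (simp add: vec_eq_iff4 ac_simps)
    have "f (coords P) \<propto> neg4 (coords P)" if "P \<in> affine" for P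
    proof -
      obtain w v where P: "P = (w, v)" by fastforce
      with * that have "W P = w" "V P = v + w" by auto
      then show ?thesis using WV(2)[OF that] proportional_sym by (simp add: P neg)
    qed
    then show ?thesis by blast
  qed
  \<comment> \<open>Passage from the chart to the whole curve: both candidates for \<open>h\<close>
    fix \<open>infty\<close>, as \<open>f\<close> does.\<close>
  have extend: "\<forall>x\<in>cone. f x \<propto> h x"
    if h: "\<And>x y. x \<propto> y \<Longrightarrow> h x \<propto> h y" "h infty = infty" "\<forall>P\<in>affine. f (coords P) \<propto> h (coords P)" for h
  proof
    fix x assume x: "x \<in> cone"
    show "f x \<propto> h x"
    proof (cases "x $ 0 = 0")
      case True
      then have "x \<propto> infty" using x cone_nth_0_eq_0_proportional by blast
      then have "f x \<propto> f infty" "h infty \<propto> h x"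
        using morphism_cong[OF f(1) x] h(1) proportional_sym by blast+
      then show ?thesis using f(5) h(2) proportional_trans by metis
    next
      case False
      let ?P = "(wcoord x, vcoord x)"
      have P: "?P \<in> affine" "coords ?P \<propto> x" using coords_wcoord_vcoord x False by blast+
      then have "f x \<propto> f (coords ?P)" "h (coords ?P) \<propto> h x"
        using morphism_cong[OF f(1) x] h(1) proportional_sym by blast+
      then show ?thesis using h(3) P(1) proportional_trans by blast
    qed
  qed
  from cases show ?thesis
    using extend[of "\<lambda>x. x"] extend[of neg4] neg4_cong by auto
qed

end

context mu4_closed
begin

text \<open>
  The translations for any group law differ from those for \<open>padd\<close> by an automorphism of the curve
  and a translation for \<open>padd\<close>, so \<open>m a x\<close> is \<open>padd a x\<close> or \<open>padd a (neg4 x)\<close>. The choice cannot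
  depend on \<open>a\<close>, as regular functions on the curve are constant, and it is the first one at \<open>org\<close>.
\<close>

lemma group_law_unique:
  assumes m: "\<And>a. a \<in> cone \<Longrightarrow> morphism (m a)" "\<And>x. x \<in> cone \<Longrightarrow> morphism (\<lambda>a. m a x)"
    and org: "\<And>x. x \<in> cone \<Longrightarrow> m org x \<propto> x" "\<And>x. x \<in> cone \<Longrightarrow> m x org \<propto> x"
    and inv: "\<And>a. a \<in> cone \<Longrightarrow> \<exists>b\<in>cone. \<forall>x\<in>cone. m b (m a x) \<propto> x \<and> m a (m b x) \<propto> x"
    and a: "a \<in> cone" and x: "x \<in> cone"
  shows "m a x \<propto> padd a x"
proof -
  have sign: "(\<forall>x\<in>cone. m a x \<propto> padd x a) \<or> (\<forall>x\<in>cone. m a x \<propto> padd (neg4 x) a)"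
    if a: "a \<in> cone" for a
  proof -
    obtain b where b: "b \<in> cone" "\<And>x. x \<in> cone \<Longrightarrow> m b (m a x) \<propto> x" "\<And>x. x \<in> cone \<Longrightarrow> m a (m b x) \<propto> x"
      using inv[OF a] by blast
    have ma: "m a x \<in> cone" "m b x \<in> cone" if "x \<in> cone" for x
      using m(1) morphism_in_cone a b(1) that by blast+
    \<comment> \<open>\<open>e\<close> is \<open>infty - m a infty\<close>, so that
      \<open>m a\<close> followed by adding \<open>e\<close> fixes \<open>infty\<close>.\<close>
    define e where "e = padd infty (neg4 (m a infty))"
    have e: "e \<in> cone" by (simp add: e_def padd_in_cone ma)
    let ?f = "\<lambda>x. padd (m a x) e" and ?g = "\<lambda>x. m b (padd x (neg4 e))"
    have f: "morphism ?f" "morphism ?g"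
      using morphism_compose[OF morphism_padd m(1)] morphism_compose[OF m(1) morphism_padd] a b(1) e
      by simp_all
    have "?g (?f x) \<propto> x" if "x \<in> cone" for x
    proof -
      have "?g (?f x) \<propto> m b (m a x)"
        using padd_diff' ma that e by (intro morphism_cong[OF m(1)[OF b(1)]] padd_in_cone) simp_all
      then show ?thesis using b(2)[OF that] proportional_trans by blast
    qed
    moreover have "?f (?g x) \<propto> x" if "x \<in> cone" for x
    proof -
      have "padd x (neg4 e) \<in> cone" using padd_in_cone that e by simp
      then have "?f (?g x) \<propto> padd (padd x (neg4 e)) e"
        using b(3) ma e by (intro padd_cong) simp_all
      then show ?thesis using padd_diff[OF that e] proportional_trans by blast
    qed
    moreover have "?f infty \<propto> infty"
      using proportional_trans[OF padd_commute padd_diff[of infty "m a infty", folded e_def]] e ma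
      by simp
    ultimately have "(\<forall>x\<in>cone. ?f x \<propto> x) \<or> (\<forall>x\<in>cone. ?f x \<propto> neg4 x)"
      by (intro automorphism_fixing_infty[OF f])
    \<comment> \<open>Undoing the correction gives \<open>m a x = h x - e\<close>; at
      \<open>x = org\<close> this identifies \<open>-e\<close> with \<open>a\<close>.\<close>
    moreover have conclude: "\<forall>x\<in>cone. m a x \<propto> padd (h x) a"
      if h: "\<And>x. x \<in> cone \<Longrightarrow> h x \<in> cone" "h org = org" "\<forall>x\<in>cone. ?f x \<propto> h x" for h
    proof -
      have 1: "m a x \<propto> padd (h x) (neg4 e)" if "x \<in> cone" for x
      proof -
        have "m a x \<propto> padd (?f x) (neg4 e)"
          using proportional_sym[OF padd_diff'[OF ma(1)[OF that] e]] .
        also have "\<dots> \<propto> padd (h x) (neg4 e)"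
          using h(1,3) that e ma by (intro padd_cong) (simp_all add: padd_in_cone)
        finally show ?thesis .
      qed
      have "neg4 e \<propto> a"
      proof -
        have "neg4 e \<propto> padd org (neg4 e)" using proportional_sym[OF padd_org_left[of "neg4 e"]] e by simp
        also have "\<dots> \<propto> m a org" using proportional_sym[OF 1[of org]] h(2) by simp
        also have "\<dots> \<propto> a" using org(2) a by blast
        finally show ?thesis .
      qed
      then have "padd (h x) (neg4 e) \<propto> padd (h x) a" if "x \<in> cone" for x
        using h(1) that e by (intro padd_cong) simp_all
      with 1 show ?thesis using proportional_trans by blast
    qed
    ultimately show ?thesis using conclude[of "\<lambda>x. x"] conclude[of neg4] by auto
  qed
  show ?thesis
  proof (cases "x \<propto> neg4 x")
    case True
    then have "padd (neg4 x) a \<propto> padd x a" "padd x a \<propto> padd a x"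
      using a x by (simp_all add: padd_cong proportional_sym padd_commute)
    then show ?thesis using sign[OF a] x proportional_trans by blast
  next
    case False
    have x0: "x $ 0 \<noteq> 0"
    proof
      assume "x $ 0 = 0"
      then have "x \<propto> infty" using x cone_nth_0_eq_0_proportional by blast
      then have "x \<propto> neg4 x" using neg4_cong proportional_sym proportional_trans by (metis neg4_infty)
      with False show False ..
    qed
    have mx: "m b x \<in> cone" if "b \<in> cone" for b using m(1) morphism_in_cone that x by blast
    \<comment> \<open>\<open>u b\<close> stands for \<open>m b x - b\<close>, which is
      \<open>x\<close> or \<open>-x\<close>. The ratio of its coordinates 1 and 0 is a regular
      function of \<open>b\<close>, hence constant, and it separates \<open>x\<close> from
      \<open>-x\<close>, as these are different points with the same nonzero coordinate 0.\<close>
    define u where "u = (\<lambda>b. padd (m b x) (neg4 b))"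
    have u: "u b \<propto> x \<or> u b \<propto> neg4 x" if b: "b \<in> cone" for b
    proof -
      have "u b \<propto> y" if "y \<in> cone" "m b x \<propto> padd y b" for y
      proof -
        have "u b \<propto> padd (padd y b) (neg4 b)"
          unfolding u_def using that b mx by (intro padd_cong) simp_all
        then show ?thesis using padd_diff'[OF that(1) b] proportional_trans by blast
      qed
      then show ?thesis using sign[OF b] x by auto
    qed
    have u0: "u b $ 0 \<noteq> 0" if "b \<in> cone" for b
      using u[OF that] x0 proportional_nth_eq_0 by fastforce
    have "is_section 0 (\<lambda>b. u b $ 1 / u b $ 0)"
      unfolding is_section_def
    proof
      fix b assume b: "b \<in> cone"
      obtain d g where g: "\<And>i. form UNIV (Suc d) (\<lambda>y. g y $ i)" "g b \<noteq> 0"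
        "\<And>y. y \<in> cone \<Longrightarrow> g y \<noteq> 0 \<Longrightarrow> g y \<propto> m y x"
        by (rule morphismE[OF m(2)[OF x] b]) (rule that; assumption)
      have gc: "g y \<in> cone" if "y \<in> cone" "g y \<noteq> 0" for y
        using g(3)[OF that] mx[OF that(1)] proportional_in_cone proportional_sym by blast
      have "neg4 b \<in> cone" using b by simp
      then obtain i where i: "law i (g b) (neg4 b) \<noteq> 0"
        using ex_law_nonzero gc[OF b g(2)] by blast
      have law_u: "law i (g y) (neg4 y) \<propto> u y" if y: "y \<in> cone" and nz: "law i (g y) (neg4 y) \<noteq> 0" for y
      proof -
        have gy: "g y \<noteq> 0" using nz law_smult[of i 0 "g y" 1 "neg4 y"] by auto
        have "law i (g y) (neg4 y) \<propto> padd (g y) (neg4 y)" using nz gc[OF y gy] y by (simp add: law_padd)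
        also have "\<dots> \<propto> u y"
          unfolding u_def using gc[OF y gy] y g(3)[OF y gy] by (intro padd_cong) simp_all
        finally show ?thesis .
      qed
      let ?q = "\<lambda>j y. law i (g y) (neg4 y) $ j"
      have form: "form UNIV (2 * Suc d + 2 * 1) (?q j)" for j
        by (rule form_law[OF semiring_closed_UNIV UNIV_I g(1) form_neg4[OF form_nth]])
      have "?q 0 b \<noteq> 0" using law_u[OF b i] u0[OF b] proportional_nth_eq_0 by blast
      moreover have "?q 0 y * (u y $ 1 / u y $ 0) = ?q 1 y" if "y \<in> cone" for y
      proof (cases "law i (g y) (neg4 y) = 0")
        case False
        from proportional_minorsD[OF law_u[OF that False], of 0 1] show ?thesis
          using u0[OF that] by (simp add: field_simps)
      qed simp
      ultimately show "\<exists>e q r. form UNIV e q \<and> form UNIV (e + 0) r \<and> q b \<noteq> 0 \<and>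
          (\<forall>y\<in>cone. q y * (u y $ 1 / u y $ 0) = r y)"
        using form[of 0] form[of 1]
        by (intro exI[of _ "2 * Suc d + 2 * 1"] exI[of _ "?q 0"] exI[of _ "?q 1"]) simp
    qed
    then have *: "u a $ 1 / u a $ 0 = u org $ 1 / u org $ 0"
      using section_0_constant a org_in_cone by blast
    have ratio: "y $ 1 / y $ 0 = z $ 1 / z $ 0" if "y \<propto> z" for y z
      using that by (auto simp: proportional_def)
    have "u org \<propto> x"
    proof -
      have "u org \<propto> padd x org"
        unfolding u_def using org(1) x mx by (intro padd_cong) simp_all
      then show ?thesis using padd_org[OF x] proportional_trans by blast
    qed
    with * have eq: "u a $ 1 / u a $ 0 = x $ 1 / x $ 0" by (simp add: ratio)
    have "\<not> u a \<propto> neg4 x"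
    proof
      assume "u a \<propto> neg4 x"
      then have "x $ 3 / x $ 0 = x $ 1 / x $ 0" using ratio eq by fastforce
      then have "neg4 x = x" using x0 by (simp add: vec_eq_iff4)
      with False show False by simp
    qed
    with u[OF a] have ua: "u a \<propto> x" by blast
    have "m a x \<propto> padd (u a) a"
      unfolding u_def using padd_diff[OF mx[OF a] a] by (rule proportional_sym)
    also have "\<dots> \<propto> padd x a"
      using ua a x by (intro padd_cong) (auto intro: proportional_in_cone proportional_sym)
    also have "\<dots> \<propto> padd a x" using a x by (rule padd_commute[rotated])
    finally show ?thesis .
  qed
qed

end

section \<open>Addition laws of bidegree (2,2)\<close>

context mu4_closed
begin

text \<open>Bidegree (2,2) expressed by substitution, for functions instead of polynomials. The
  instances used substitute constants, the identity and a law with one argument fixed.\<close>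

definition biquadratic :: "('a ^ 4 \<Rightarrow> 'a ^ 4 \<Rightarrow> 'a ^ 4) \<Rightarrow> bool" where
  "biquadratic p \<longleftrightarrow> (\<forall>d e g h j. (\<forall>i. form UNIV d (\<lambda>x. g x $ i)) \<longrightarrow> (\<forall>i. form UNIV e (\<lambda>x. h x $ i)) \<longrightarrow>
     form UNIV (2 * d + 2 * e) (\<lambda>x. p (g x) (h x) $ j))"

definition gives_padd :: "('a ^ 4 \<Rightarrow> 'a ^ 4 \<Rightarrow> 'a ^ 4) \<Rightarrow> bool" where
  "gives_padd p \<longleftrightarrow> (\<forall>x\<in>cone. \<forall>y\<in>cone. p x y \<noteq> 0 \<longrightarrow> p x y \<propto> padd x y)"

lemma biquadraticD:
  "biquadratic p \<Longrightarrow> (\<And>i. form UNIV d (\<lambda>x. g x $ i)) \<Longrightarrow> (\<And>i. form UNIV e (\<lambda>x. h x $ i)) \<Longrightarrow>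
    form UNIV (2 * d + 2 * e) (\<lambda>x. p (g x) (h x) $ j)"
  by (simp add: biquadratic_def)

lemma biquadratic_law: "biquadratic (law i)"
  unfolding biquadratic_def by (intro allI impI form_law semiring_closed_UNIV UNIV_I) auto

lemma biquadratic_add_smult:
  assumes "biquadratic p" "\<And>i. biquadratic (q i)"
  shows "biquadratic (\<lambda>x y. p x y + (\<Sum>i\<in>UNIV. c i *s q (i::4) x y))"
  unfolding biquadratic_def
proof (intro allI impI)
  fix d e and g h :: "'a ^ 4 \<Rightarrow> 'a ^ 4" and j
  assume g: "\<forall>i. form UNIV d (\<lambda>x. g x $ i)" and h: "\<forall>i. form UNIV e (\<lambda>x. h x $ i)"
  have "form UNIV (2 * d + 2 * e) (\<lambda>x. p (g x) (h x) $ j + (\<Sum>i\<in>UNIV. c i * q i (g x) (h x) $ j))"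
    using g h assms by (intro form_add form_sum form_cmult biquadraticD) auto
  then show "form UNIV (2 * d + 2 * e) (\<lambda>x. (p (g x) (h x) + (\<Sum>i\<in>UNIV. c i *s q i (g x) (h x))) $ j)"
    by simp
qed

lemma biquadratic_smult_left:
  assumes "biquadratic p"
  shows "p (c *s x) y = (c ^ 2) *s p x y"
proof -
  have "form UNIV (2 * 1 + 2 * 0) (\<lambda>x. p x y $ j)" for j
    by (rule biquadraticD[OF assms form_nth form_const_nth])
  from form_smult[OF this] show ?thesis by (simp add: vec_eq_iff)
qed

text \<open>Admitting the factor 0 makes the condition linear, so that combinations of laws inherit
  it.\<close>

lemma gives_padd_iff: "gives_padd p \<longleftrightarrow> (\<forall>x\<in>cone. \<forall>y\<in>cone. \<exists>k. p x y = k *s padd x y)"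
proof -
  have "(p x y \<noteq> 0 \<longrightarrow> p x y \<propto> padd x y) \<longleftrightarrow> (\<exists>k. p x y = k *s padd x y)" for x y
  proof
    assume *: "p x y \<noteq> 0 \<longrightarrow> p x y \<propto> padd x y"
    show "\<exists>k. p x y = k *s padd x y"
    proof (cases "p x y = 0")
      case True
      then show ?thesis by (intro exI[of _ 0]) simp
    next
      case False
      with * have "padd x y \<propto> p x y" using proportional_sym by blast
      then show ?thesis by (auto simp: proportional_def)
    qed
  next
    assume "\<exists>k. p x y = k *s padd x y"
    then obtain k where k: "p x y = k *s padd x y" by blast
    show "p x y \<noteq> 0 \<longrightarrow> p x y \<propto> padd x y"
    proof
      assume "p x y \<noteq> 0"
      with k have "k \<noteq> 0" by auto
      then show "p x y \<propto> padd x y" unfolding k by (rule proportional_smult)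
    qed
  qed
  then show ?thesis unfolding gives_padd_def by simp
qed

lemma gives_padd_law: "gives_padd (law i)"
  unfolding gives_padd_def using law_padd by blast

lemma gives_padd_add_smult:
  assumes "gives_padd p" "\<And>i. gives_padd (q i)"
  shows "gives_padd (\<lambda>x y. p x y + (\<Sum>i\<in>UNIV. c i *s q (i::4) x y))"
  unfolding gives_padd_iff
proof (intro ballI)
  fix x y assume xy: "x \<in> cone" "y \<in> cone"
  obtain k where k: "p x y = k *s padd x y" using assms(1) xy unfolding gives_padd_iff by blast
  have "\<forall>i. \<exists>l. q i x y = l *s padd x y" using assms(2) xy unfolding gives_padd_iff by blast
  then obtain l where l: "\<And>i. q i x y = l i *s padd x y" by metis
  have "p x y + (\<Sum>i\<in>UNIV. c i *s q i x y) = (k + (\<Sum>i\<in>UNIV. c i * l i)) *s padd x y"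
    by (simp add: k l vec_eq_iff distrib_right sum_distrib_right mult.assoc)
  then show "\<exists>k. p x y + (\<Sum>i\<in>UNIV. c i *s q i x y) = k *s padd x y" ..
qed

text \<open>The factor of \<open>x\<close> in \<open>p x org\<close> is locally the quotient of
  \<open>p x org $ j\<close>, of degree 2, by \<open>x $ j\<close>: a section of degree 1.\<close>

lemma law_on_org_linear:
  assumes p: "biquadratic p" "gives_padd p"
  obtains c where "\<And>x. x \<in> cone \<Longrightarrow> p x org = linear_form c x *s x"
proof -
  define f where "f = (\<lambda>x. SOME k. p x org = k *s x)"
  have f: "p x org = f x *s x" if x: "x \<in> cone" for x
    unfolding f_def
  proof (rule someI_ex)
    obtain k where k: "p x org = k *s padd x org"
      using p(2) x org_in_cone unfolding gives_padd_iff by blast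
    obtain l where "padd x org = l *s x"
      using proportional_sym[OF padd_org[OF x]] by (auto simp: proportional_def)
    with k show "\<exists>k. p x org = k *s x" by (auto simp: vector_smult_assoc)
  qed
  have "is_section 1 f"
    unfolding is_section_def
  proof
    fix x assume "x \<in> cone"
    then obtain j where j: "x $ j \<noteq> 0" using cone_nonzero by (force simp: vec_eq_iff)
    have "form UNIV (2 * 1 + 2 * 0) (\<lambda>x. p x org $ j)"
      by (rule biquadraticD[OF p(1) form_nth form_const_nth])
    then have "form UNIV (1 + 1) (\<lambda>x. p x org $ j)" by (simp add: numeral_2_eq_2)
    moreover have "\<forall>y\<in>cone. y $ j * f y = p y org $ j" by (simp add: f mult.commute)
    ultimately show "\<exists>e q r. form UNIV e q \<and> form UNIV (e + 1) r \<and> q x \<noteq> 0 \<and>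
        (\<forall>y\<in>cone. q y * f y = r y)"
      using j form_nth
      by (intro exI[of _ 1] exI[of _ "\<lambda>x. x $ j"] exI[of _ "\<lambda>x. p x org $ j"]) blast
  qed
  then obtain c where "\<And>x. x \<in> cone \<Longrightarrow> f x = linear_form c x" using section_1_linear by blast
  with f show thesis by (intro that[of c]) simp
qed

text \<open>
  On the curve of the pairs \<open>(x, y)\<close> with constant difference, one of the four laws has no zero;
  the quotient by it is regular on a complete curve, hence constant.
\<close>

lemma law_eq_0:
  assumes p: "biquadratic p" "gives_padd p" and org: "\<And>x. x \<in> cone \<Longrightarrow> p x org = 0"
    and xy: "x \<in> cone" "y \<in> cone"
  shows "p x y = 0"
proof -
  define d where "d = padd x (neg4 y)"
  have d: "d \<in> cone" using xy by (simp add: d_def padd_in_cone)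
  then obtain i where i: "d $ i \<noteq> 0" using cone_nonzero by (auto simp: vec_eq_iff)
  \<comment> \<open>All pairs \<open>(T z, z)\<close> have difference \<open>d\<close>; the one for
    \<open>z = y\<close> is \<open>(x, y)\<close> up to a scalar.\<close>
  define T where "T = (\<lambda>z. padd z d)"
  have T: "T z \<in> cone" if "z \<in> cone" for z using that d by (simp add: T_def padd_in_cone)
  have nz: "law i (T z) z \<noteq> 0" if z: "z \<in> cone" for z
  proof (rule law_nonzero[OF T[OF z] z])
    have "padd (T z) (neg4 z) \<propto> padd (padd d z) (neg4 z)"
      unfolding T_def using z d by (intro padd_cong padd_commute padd_in_cone) simp_all
    also have "\<dots> \<propto> d" by (rule padd_diff'[OF d z])
    finally show "padd (T z) (neg4 z) $ i \<noteq> 0" using i proportional_nth_eq_0 by blast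
  qed
  define f where "f = (\<lambda>z. SOME k. p (T z) z = k *s law i (T z) z)"
  have f: "p (T z) z = f z *s law i (T z) z" if z: "z \<in> cone" for z
    unfolding f_def
  proof (rule someI_ex)
    obtain k where k: "p (T z) z = k *s padd (T z) z"
      using p(2) T z unfolding gives_padd_iff by blast
    obtain l where "padd (T z) z = l *s law i (T z) z"
      using law_padd[OF T[OF z] z nz[OF z]] by (auto simp: proportional_def)
    with k show "\<exists>k. p (T z) z = k *s law i (T z) z" by (auto simp: vector_smult_assoc)
  qed
  have "is_section 0 f"
    unfolding is_section_def
  proof
    fix z assume z: "z \<in> cone"
    obtain k where k: "law k z d \<noteq> 0" using ex_law_nonzero z d by blast
    obtain j where j: "law i (T z) z $ j \<noteq> 0" using nz[OF z] by (auto simp: vec_eq_iff)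
    \<comment> \<open>\<open>T\<close> involves pointwise choices. The law \<open>?g\<close> is a
      polynomial substitute: everywhere a multiple of \<open>T\<close>, and a nonzero one near the
      given point.\<close>
    let ?g = "\<lambda>z. law k z d"
    have g: "form UNIV 2 (\<lambda>z. ?g z $ j)" for j
      using form_law[OF semiring_closed_UNIV UNIV_I form_nth form_const_nth] by simp
    have form: "form UNIV (2 * 2 + 2 * 1) (\<lambda>z. q (?g z) z $ j)" if "biquadratic q" for q
      by (rule biquadraticD[OF that g form_nth])
    have g_eq: "\<exists>c. ?g z = c *s T z \<and> (?g z \<noteq> 0 \<longrightarrow> c \<noteq> 0)" if "z \<in> cone" for z
    proof (cases "?g z = 0")
      case False
      then have "T z \<propto> ?g z"
        unfolding T_def using law_padd[OF that d] proportional_sym by blast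
      then show ?thesis by (auto simp: proportional_def)
    qed (auto intro: exI[of _ 0])
    have "law i (?g z) z $ j \<noteq> 0"
    proof -
      obtain c where "?g z = c *s T z" "c \<noteq> 0" using g_eq[OF z] k by blast
      then show ?thesis using j by (simp add: biquadratic_smult_left[OF biquadratic_law])
    qed
    moreover have "law i (?g y) y $ j * f y = p (?g y) y $ j" if y: "y \<in> cone" for y
    proof -
      obtain c where "?g y = c *s T y" using g_eq[OF y] by blast
      then show ?thesis
        using f[OF y]
        by (simp add: biquadratic_smult_left[OF biquadratic_law] biquadratic_smult_left[OF p(1)])
    qed
    ultimately show "\<exists>e q r. form UNIV e q \<and> form UNIV (e + 0) r \<and> q z \<noteq> 0 \<and>
        (\<forall>y\<in>cone. q y * f y = r y)"
      using form[OF biquadratic_law[of i]] form[OF p(1)]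
      by (intro exI[of _ "2 * 2 + 2 * 1"] exI[of _ "\<lambda>z. law i (?g z) z $ j"]
          exI[of _ "\<lambda>z. p (?g z) z $ j"]) simp
  qed
  then have "f y = f org" using section_0_constant xy(2) org_in_cone by blast
  \<comment> \<open>The pair \<open>(T org, org)\<close> is one of those where \<open>p\<close>
    vanishes by assumption, whereas law \<open>i\<close> does not.\<close>
  moreover have "f org = 0"
    using f[OF org_in_cone] org[OF T[OF org_in_cone]] nz[OF org_in_cone] by (metis vector_mul_eq_0)
  ultimately have "p (T y) y = 0" using f[OF xy(2)] by simp
  moreover have "T y \<propto> x"
    unfolding T_def d_def using padd_commute padd_diff xy proportional_trans padd_in_cone neg4_in_cone by meson
  then obtain c where "x = c *s T y" by (auto simp: proportional_def)
  ultimately show ?thesis by (simp add: biquadratic_smult_left[OF p(1)])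
qed

text \<open>The coefficients are dictated by the restriction to \<open>(x, org)\<close>, because law
  \<open>i\<close> restricts to \<open>x $ i *s x\<close>. Adding the combination amounts to
  subtracting it, and leaves a law with zero restriction.\<close>

lemma law_basis:
  assumes p: "biquadratic p" "gives_padd p"
    and S: "semiring_closed S" "s \<in> S" "inverse s \<in> S" "form S 2 (\<lambda>x. p x org $ 0)"
  obtains c where "\<And>i. c i \<in> S"
    "\<And>x y. x \<in> cone \<Longrightarrow> y \<in> cone \<Longrightarrow> p x y = (\<Sum>i\<in>UNIV. c i *s law i x y)"
proof -
  obtain c where c: "\<And>x. x \<in> cone \<Longrightarrow> p x org = linear_form c x *s x"
    using law_on_org_linear[OF p] by blast
  let ?p = "\<lambda>x y. p x y + (\<Sum>i\<in>UNIV. c i *s law i x y)"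
  have 0: "?p x org = 0" if "x \<in> cone" for x
    using that by (simp add: c law_org vec_eq_iff linear_form_def sum_distrib_right mult.assoc)
  have "?p x y = 0" if "x \<in> cone" "y \<in> cone" for x y
    by (rule law_eq_0[OF biquadratic_add_smult[OF p(1) biquadratic_law]
          gives_padd_add_smult[OF p(2) gives_padd_law] 0 that])
  then have "p x y = (\<Sum>i\<in>UNIV. c i *s law i x y)" if "x \<in> cone" "y \<in> cone" for x y
    using that by (simp add: vec_eq_iff add_eq_0_iff_eq)
  moreover have "c i \<in> S" for i
  proof (rule linear_form_coeff_closed[OF S])
    \<comment> \<open>Since \<open>coords P $ 0\<close> is 1, coordinate 0 of
      \<open>p (coords P) org\<close> is the linear form itself.\<close>
    fix P assume "P \<in> affine"
    then show "p (coords P) org $ 0 = linear_form c (coords P)"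
      using c[OF coords_in_cone] by (cases P) simp
  qed
  ultimately show thesis by (intro that)
qed

text \<open>At \<open>y = org\<close> the combination becomes a linear form times \<open>x\<close>,
  and no nonzero linear form vanishes on the curve.\<close>

lemma law_independent:
  assumes "\<And>x y. x \<in> cone \<Longrightarrow> y \<in> cone \<Longrightarrow> (\<Sum>i\<in>UNIV. c i *s law i x y) = 0"
  shows "c i = 0"
proof (rule linear_form_eq_0)
  fix x assume x: "x \<in> cone"
  then have "(\<Sum>i\<in>UNIV. c i *s law i x org) = linear_form c x *s x"
    by (simp add: law_org vec_eq_iff linear_form_def sum_distrib_right mult.assoc)
  with assms[OF x org_in_cone] cone_nonzero[OF x] show "linear_form c x = 0" by simp
qed

end

section \<open>Evaluation of polynomials\<close>

definition monomial_eval :: "('v::finite \<Rightarrow>\<^sub>0 nat) \<Rightarrow> ('v \<Rightarrow> 'b::comm_semiring_1) \<Rightarrow> 'b" where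
  "monomial_eval m z = (\<Prod>v\<in>UNIV. z v ^ Poly_Mapping.lookup m v)"

lemma mpoly_eval_monomials:
  "mpoly_eval h p z = (\<Sum>m\<in>Poly_Mapping.keys p. h (Poly_Mapping.lookup p m) * monomial_eval m z)"
  by (simp add: mpoly_eval_def monomial_eval_def)

lemma monomial_eval_add: "monomial_eval (m + n) z = monomial_eval m z * monomial_eval n z"
  by (simp add: monomial_eval_def lookup_add power_add prod.distrib)

lemma monomial_eval_0 [simp]: "monomial_eval 0 z = 1"
  by (simp add: monomial_eval_def)

lemma sum_singles: "(\<Sum>m\<in>Poly_Mapping.keys p. Poly_Mapping.single m (Poly_Mapping.lookup p m)) = p"
proof (rule poly_mapping_eqI)
  fix k
  have "(\<Sum>m\<in>Poly_Mapping.keys p. Poly_Mapping.lookup p m when m = k) = Poly_Mapping.lookup p k"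
    by (cases "k \<in> Poly_Mapping.keys p") (auto simp: when_def in_keys_iff sum.delta)
  then show "Poly_Mapping.lookup (\<Sum>m\<in>Poly_Mapping.keys p. Poly_Mapping.single m (Poly_Mapping.lookup p m)) k =
      Poly_Mapping.lookup p k"
    by (simp add: lookup_sum lookup_single)
qed

locale ring_embedding =
  fixes h :: "'a::comm_ring_1 \<Rightarrow> 'b::comm_ring_1"
  assumes h_0 [simp]: "h 0 = 0" and h_1 [simp]: "h 1 = 1"
    and h_add [simp]: "h (x + y) = h x + h y" and h_mult [simp]: "h (x * y) = h x * h y"
begin

lemma mpoly_eval_0 [simp]: "mpoly_eval h 0 z = 0"
  by (simp add: mpoly_eval_def)

lemma mpoly_eval_add [simp]: "mpoly_eval h (p + q) z = mpoly_eval h p z + mpoly_eval h q z"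
  unfolding mpoly_eval_monomials
  by (rule setsum_keys_plus_distrib) (simp_all add: distrib_right)

lemma mpoly_eval_sum: "mpoly_eval h (\<Sum>i\<in>I. p i) z = (\<Sum>i\<in>I. mpoly_eval h (p i) z)"
  by (induction I rule: infinite_finite_induct) simp_all

lemma mpoly_eval_single: "mpoly_eval h (Poly_Mapping.single m c) z = h c * monomial_eval m z"
  by (simp add: mpoly_eval_monomials)

lemma mpoly_eval_mult [simp]: "mpoly_eval h (p * q) z = mpoly_eval h p z * mpoly_eval h q z"
proof -
  let ?s = "\<lambda>p m. Poly_Mapping.single m (Poly_Mapping.lookup p m)"
  have "mpoly_eval h (p * q) z =
      mpoly_eval h ((\<Sum>m\<in>Poly_Mapping.keys p. ?s p m) * (\<Sum>n\<in>Poly_Mapping.keys q. ?s q n)) z"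
    by (simp only: sum_singles)
  also have "\<dots> = mpoly_eval h (\<Sum>m\<in>Poly_Mapping.keys p. ?s p m) z * mpoly_eval h (\<Sum>n\<in>Poly_Mapping.keys q. ?s q n) z"
    unfolding sum_product
    by (simp only: mpoly_eval_sum mult_single mpoly_eval_single sum_product h_mult monomial_eval_add ac_simps)
  finally show ?thesis by (simp only: sum_singles)
qed

lemma mpoly_eval_cst [simp]: "mpoly_eval h (cst c) z = h c"
  by (simp add: cst_def mpoly_eval_single)

lemma mpoly_eval_1 [simp]: "mpoly_eval h 1 z = 1"
  using mpoly_eval_single[of 0 1 z] by simp

lemma mpoly_eval_power [simp]: "mpoly_eval h (p ^ n) z = mpoly_eval h p z ^ n"
  by (induction n) simp_all

lemma mpoly_eval_mvar [simp]: "mpoly_eval h (mvar v) z = z v"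
proof -
  have "monomial_eval (Poly_Mapping.single v 1) z = (\<Prod>u\<in>UNIV. if u = v then z u else 1)"
    unfolding monomial_eval_def by (intro prod.cong) (auto simp: lookup_single when_def)
  then show ?thesis by (simp add: mvar_def mpoly_eval_single prod.delta)
qed

lemma tuple_eval_add: "tuple_eval h (p + q) z = tuple_eval h p z + tuple_eval h q z"
  by (simp add: tuple_eval_def vec_eq_iff)

lemma tuple_eval_sum: "tuple_eval h (\<Sum>i\<in>I. p i) z = (\<Sum>i\<in>I. tuple_eval h (p i) z)"
  by (induction I rule: infinite_finite_induct) (simp_all add: tuple_eval_add, simp_all add: tuple_eval_def vec_eq_iff)

lemma tuple_eval_scale: "tuple_eval h (tuple_scale c p) z = h c *s tuple_eval h p z"
  by (simp add: tuple_eval_def tuple_scale_def vec_eq_iff)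

end

lemma at_pair_simps [simp]: "at_pair x y (Inl i) = x $ i" "at_pair x y (Inr i) = y $ i"
  by (simp_all add: at_pair_def)

lemma monomial_eval_at_pair:
  "monomial_eval m (at_pair x y) =
    (\<Prod>i\<in>UNIV. x $ i ^ Poly_Mapping.lookup m (Inl i)) * (\<Prod>i\<in>UNIV. y $ i ^ Poly_Mapping.lookup m (Inr i))"
  unfolding monomial_eval_def UNIV_Plus_UNIV[symmetric] by (subst prod.Plus) simp_all

text \<open>With \<open>S\<close> the image of the base field this records rationality of the
  coefficients; with \<open>S = UNIV\<close> only the degree.\<close>

lemma form_mpoly_eval:
  assumes p: "bihomogeneous d e p" and S: "semiring_closed S" "range h \<subseteq> S"
    and g: "\<And>i. form S d' (\<lambda>x. g x $ i)" and k: "\<And>i. form S e' (\<lambda>x. k x $ i)"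
  shows "form S (d * d' + e * e') (\<lambda>x. mpoly_eval h p (at_pair (g x) (k x)))"
proof -
  have S01: "0 \<in> S" "1 \<in> S" using S(1) by (simp_all add: semiring_closed_def)
  have "form S (d * d' + e * e') (\<lambda>x. monomial_eval m (at_pair (g x) (k x)))"
    if "m \<in> Poly_Mapping.keys p" for m
  proof -
    have "form S ((\<Sum>i\<in>UNIV. Poly_Mapping.lookup m (Inl i) * d') + (\<Sum>i\<in>UNIV. Poly_Mapping.lookup m (Inr i) * e'))
        (\<lambda>x. monomial_eval m (at_pair (g x) (k x)))"
      unfolding monomial_eval_at_pair by (intro form_mult form_prod form_power g k S01) simp_all
    then show ?thesis using p that by (simp add: bihomogeneous_def flip: sum_distrib_right)
  qed
  then show ?thesis
    unfolding mpoly_eval_monomials using S(2) by (intro form_sum form_cmult S01) auto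
qed

lemma bihomogeneous_0: "bihomogeneous d e 0"
  by (simp add: bihomogeneous_def)

lemma bihomogeneous_add: "bihomogeneous d e p \<Longrightarrow> bihomogeneous d e q \<Longrightarrow> bihomogeneous d e (p + q)"
  using keys_add[of p q] unfolding bihomogeneous_def by blast

lemma bihomogeneous_mult:
  assumes "bihomogeneous d e p" "bihomogeneous d' e' q"
  shows "bihomogeneous (d + d') (e + e') (p * q)"
  unfolding bihomogeneous_def
proof
  fix m assume "m \<in> Poly_Mapping.keys (p * q)"
  then obtain a b where "m = a + b" "a \<in> Poly_Mapping.keys p" "b \<in> Poly_Mapping.keys q"
    using keys_mult[of p q] by blast
  with assms show "(\<Sum>i\<in>UNIV. Poly_Mapping.lookup m (Inl i)) = d + d' \<and>
      (\<Sum>i\<in>UNIV. Poly_Mapping.lookup m (Inr i)) = e + e'"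
    by (simp add: bihomogeneous_def lookup_add sum.distrib)
qed

lemma bihomogeneous_cst: "bihomogeneous 0 0 (cst c)"
  by (auto simp: bihomogeneous_def cst_def split: if_splits)

lemma bihomogeneous_Xv: "bihomogeneous 1 0 (Xv i :: (4 + 4, 'a::zero_neq_one) mpoly)"
  and bihomogeneous_Yv: "bihomogeneous 0 1 (Yv i :: (4 + 4, 'a::zero_neq_one) mpoly)"
  by (auto simp: bihomogeneous_def mvar_def lookup_single when_def)

lemma bihomogeneous_cst_mult: "bihomogeneous d e p \<Longrightarrow> bihomogeneous d e (cst c * p)"
  using bihomogeneous_mult[OF bihomogeneous_cst] by fastforce

lemma bihomogeneous_square: "bihomogeneous d e p \<Longrightarrow> bihomogeneous (2 * d) (2 * e) (p\<^sup>2)"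
  unfolding power2_eq_square mult_2 by (rule bihomogeneous_mult)

section \<open>The space of addition laws\<close>

definition law_tuples :: "'a::field \<Rightarrow> ((4 + 4, 'a) mpoly ^ 4) ^ 4" where
  "law_tuples s =
     (quad
       (quad ((Xv 0 * Yv 0 + Xv 2 * Yv 2)\<^sup>2)
             (Xv 0 * Xv 1 * Yv 0 * Yv 1 + Xv 2 * Xv 3 * Yv 2 * Yv 3)
             (cst s * (Xv 1 * Yv 1 + Xv 3 * Yv 3)\<^sup>2)
             (Xv 0 * Xv 3 * Yv 0 * Yv 3 + Xv 1 * Xv 2 * Yv 1 * Yv 2))
       (quad (Xv 0 * Xv 1 * Yv 0 * Yv 3 + Xv 2 * Xv 3 * Yv 1 * Yv 2)
             ((Xv 1 * Yv 0 + Xv 3 * Yv 2)\<^sup>2)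
             (Xv 0 * Xv 3 * Yv 2 * Yv 3 + Xv 1 * Xv 2 * Yv 0 * Yv 1)
             ((Xv 0 * Yv 3 + Xv 2 * Yv 1)\<^sup>2))
       (quad (cst s * (Xv 1 * Yv 3 + Xv 3 * Yv 1)\<^sup>2)
             (Xv 0 * Xv 3 * Yv 1 * Yv 2 + Xv 1 * Xv 2 * Yv 0 * Yv 3)
             ((Xv 0 * Yv 2 + Xv 2 * Yv 0)\<^sup>2)
             (Xv 0 * Xv 1 * Yv 2 * Yv 3 + Xv 2 * Xv 3 * Yv 0 * Yv 1))
       (quad (Xv 0 * Xv 3 * Yv 0 * Yv 1 + Xv 1 * Xv 2 * Yv 2 * Yv 3)
             ((Xv 0 * Yv 1 + Xv 2 * Yv 3)\<^sup>2)
             (Xv 0 * Xv 1 * Yv 1 * Yv 2 + Xv 2 * Xv 3 * Yv 0 * Yv 3)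
             ((Xv 1 * Yv 2 + Xv 3 * Yv 0)\<^sup>2)))"

lemma bihomogeneous_law_tuples: "bihomogeneous 2 2 (law_tuples s $ i $ j)"
proof -
  have m: "bihomogeneous 2 2 (Xv a * Xv b * Yv c * Yv d :: (4 + 4, 'a) mpoly)" for a b c d
    using bihomogeneous_mult[OF bihomogeneous_mult[OF bihomogeneous_mult[OF bihomogeneous_Xv bihomogeneous_Xv]
          bihomogeneous_Yv] bihomogeneous_Yv]
    by (simp add: numeral_2_eq_2)
  have q: "bihomogeneous 2 2 ((Xv a * Yv b + Xv c * Yv d)\<^sup>2 :: (4 + 4, 'a) mpoly)" for a b c d
    using bihomogeneous_square[OF bihomogeneous_add[OF bihomogeneous_mult[OF bihomogeneous_Xv bihomogeneous_Yv]
          bihomogeneous_mult[OF bihomogeneous_Xv bihomogeneous_Yv]]]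
    by simp
  have "\<forall>i j. bihomogeneous 2 2 (law_tuples s $ i $ j)"
    unfolding law_tuples_def forall_index4 quad_nth
    by (intro conjI bihomogeneous_add bihomogeneous_cst_mult m q)
  then show ?thesis by blast
qed

global_interpretation to_ac: ring_embedding to_ac
  by unfold_locales simp_all

locale mu4_curve =
  fixes s :: "'k::field"
    and \<mu> :: "('k alg_closure ^ 4) set \<Rightarrow> ('k alg_closure ^ 4) set \<Rightarrow> ('k alg_closure ^ 4) set"
  assumes char: "CHAR('k) = 2" and nonzero: "s \<noteq> 0" and addition: "addition_morphism s \<mu>"
begin

sublocale mu4_closed "to_ac s"
proof
  have "(2::'k) = 0" using of_nat_CHAR[where ?'a = 'k] by (simp add: char)
  then have "to_ac (2::'k) = 0" by simp
  then show "(2::'k alg_closure) = 0" by simp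
  show "to_ac s \<noteq> 0" using nonzero by simp
qed

lemma curve_coords_eq: "curve_coords s = cone"
  by (simp add: curve_coords_def cone_def)

lemma curve_eq: "curve s = proj ` cone"
  by (simp add: curve_def curve_coords_eq)

lemma origin_eq: "origin = proj org"
  by (simp add: origin_def org_def)

lemma proj_cone_eq_iff: "x \<in> cone \<Longrightarrow> y \<in> cone \<Longrightarrow> proj x = proj y \<longleftrightarrow> x \<propto> y"
  by (simp add: proj_eq_iff cone_nonzero)

lemma product: "product_morphism s \<mu>"
  using addition by (simp add: addition_morphism_def)

lemma mu_in_curve: "P \<in> curve s \<Longrightarrow> Q \<in> curve s \<Longrightarrow> \<mu> P Q \<in> curve s"
  using product unfolding product_morphism_def by blast

sublocale points: Group.group "curve_group s \<mu>"
  rewrites "carrier (curve_group s \<mu>) = curve s"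
    and "monoid.mult (curve_group s \<mu>) = \<mu>"
    and "one (curve_group s \<mu>) = origin"
  using addition by (simp_all add: addition_morphism_def curve_group_def)

text \<open>A lift of \<open>\<mu>\<close> to coordinate vectors, the setting in which rigidity is
  stated.\<close>

definition mu_coords :: "'k alg_closure ^ 4 \<Rightarrow> 'k alg_closure ^ 4 \<Rightarrow> 'k alg_closure ^ 4" where
  "mu_coords x y = (SOME z. z \<in> cone \<and> \<mu> (proj x) (proj y) = proj z)"

lemma mu_coords:
  assumes "x \<in> cone" "y \<in> cone"
  shows "mu_coords x y \<in> cone" "proj (mu_coords x y) = \<mu> (proj x) (proj y)"
proof -
  have "\<mu> (proj x) (proj y) \<in> proj ` cone"
    using mu_in_curve assms by (simp add: curve_eq)
  then have "\<exists>z. z \<in> cone \<and> \<mu> (proj x) (proj y) = proj z" by blast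
  from someI_ex[OF this] show "mu_coords x y \<in> cone" "proj (mu_coords x y) = \<mu> (proj x) (proj y)"
    by (simp_all add: mu_coords_def)
qed

lemma gives_mu_coords:
  assumes "gives_on_product h s p \<mu>" "x \<in> cone" "y \<in> cone" "tuple_eval h p (at_pair x y) \<noteq> 0"
  shows "tuple_eval h p (at_pair x y) \<propto> mu_coords x y"
proof -
  have "proj (mu_coords x y) = proj (tuple_eval h p (at_pair x y))"
    using assms mu_coords by (simp add: gives_on_product_def curve_coords_eq)
  then show ?thesis
    using proj_eq_iff[OF cone_nonzero[OF mu_coords(1)] assms(4)] assms(2,3) proportional_sym by blast
qed

lemma form_tuple_eval:
  assumes "\<And>j. bihomogeneous d e (p $ j)"
    and "\<And>i. form UNIV d' (\<lambda>x. g x $ i)" "\<And>i. form UNIV e' (\<lambda>x. k x $ i)"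
  shows "form UNIV (d * d' + e * e') (\<lambda>x. tuple_eval h p (at_pair (g x) (k x)) $ j)"
  unfolding tuple_eval_def vec_lambda_beta
  using assms by (intro form_mpoly_eval semiring_closed_UNIV subset_UNIV)

text \<open>Serves for both partial maps of the addition: one of \<open>g\<close>, \<open>g'\<close>
  is constant and the other the identity.\<close>

lemma morphism_of_product:
  assumes g: "\<And>x. x \<in> cone \<Longrightarrow> g x \<in> cone" "\<And>x. x \<in> cone \<Longrightarrow> g' x \<in> cone"
    and form: "\<And>i. form UNIV a (\<lambda>x. g x $ i)" "\<And>i. form UNIV a' (\<lambda>x. g' x $ i)"
  shows "morphism (\<lambda>x. mu_coords (g x) (g' x))"
  unfolding morphism_def
proof (intro conjI ballI)
  fix x assume x: "x \<in> cone"
  then show "mu_coords (g x) (g' x) \<in> cone" using mu_coords(1) g by blast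
  obtain d e and p :: "(4 + 4, 'k alg_closure) mpoly ^ 4" where p: "\<forall>j. bihomogeneous d e (p $ j)"
      "tuple_eval id p (at_pair (g x) (g' x)) \<noteq> 0" "gives_on_product id s p \<mu>"
    using product g x unfolding product_morphism_def curve_coords_eq by blast
  \<comment> \<open>Multiplying the tuple by a coordinate that is nonzero at \<open>x\<close> makes
    its degree positive, as \<open>morphism\<close> demands.\<close>
  obtain i where i: "x $ i \<noteq> 0" using cone_nonzero[OF x] by (auto simp: vec_eq_iff)
  let ?f = "\<lambda>y. tuple_eval id p (at_pair (g y) (g' y))"
  have "form UNIV (1 + (d * a + e * a')) (\<lambda>y. y $ i * ?f y $ j)" for j
    using p(1) form by (intro form_mult form_nth form_tuple_eval) auto
  then have "\<forall>j. form UNIV (Suc (d * a + e * a')) (\<lambda>y. (y $ i *s ?f y) $ j)" by simp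
  moreover have "x $ i *s ?f x \<noteq> 0" using i p(2) by simp
  moreover have "y $ i *s ?f y \<propto> mu_coords (g y) (g' y)" if y: "y \<in> cone" "y $ i *s ?f y \<noteq> 0" for y
  proof -
    have "y $ i \<noteq> 0" "?f y \<noteq> 0" using y(2) by auto
    have "y $ i *s ?f y \<propto> ?f y" using \<open>y $ i \<noteq> 0\<close> by (rule proportional_smult)
    also have "?f y \<propto> mu_coords (g y) (g' y)"
      using p(3) g[OF y(1)] \<open>?f y \<noteq> 0\<close> by (rule gives_mu_coords)
    finally show ?thesis .
  qed
  ultimately show "\<exists>d f. (\<forall>i. form UNIV (Suc d) (\<lambda>y. f y $ i)) \<and> f x \<noteq> 0 \<and>
      (\<forall>y\<in>cone. f y \<noteq> 0 \<longrightarrow> f y \<propto> mu_coords (g y) (g' y))"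
    by (intro exI[of _ "d * a + e * a'"] exI[of _ "\<lambda>y. y $ i *s ?f y"]) blast
qed

lemma mu_coords_padd:
  assumes "x \<in> cone" "y \<in> cone"
  shows "mu_coords x y \<propto> padd x y"
proof (rule group_law_unique[OF _ _ _ _ _ assms])
  have curve: "proj a \<in> curve s" if "a \<in> cone" for a using that by (simp add: curve_eq)
  fix a assume a: "a \<in> cone"
  show "morphism (mu_coords a)"
    by (rule morphism_of_product[where g = "\<lambda>_. a" and g' = "\<lambda>x. x", OF _ _ form_const_nth form_nth])
      (use a in simp_all)
  show "morphism (\<lambda>x. mu_coords x a)"
    by (rule morphism_of_product[where g = "\<lambda>x. x" and g' = "\<lambda>_. a", OF _ _ form_nth form_const_nth])
      (use a in simp_all)
  show "mu_coords org a \<propto> a" "mu_coords a org \<propto> a"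
    using a curve[OF a] points.l_one[of "proj a"] points.r_one[of "proj a"]
    by (simp_all add: mu_coords origin_eq flip: proj_cone_eq_iff)
  obtain b where b: "b \<in> cone" "proj b = m_inv (curve_group s \<mu>) (proj a)"
    using points.inv_closed[OF curve[OF a]] by (auto simp: curve_eq)
  show "\<exists>b\<in>cone. \<forall>x\<in>cone. mu_coords b (mu_coords a x) \<propto> x \<and> mu_coords a (mu_coords b x) \<propto> x"
  proof (intro bexI[OF _ b(1)] ballI)
    fix x assume x: "x \<in> cone"
    have ba: "\<mu> (proj b) (proj a) = origin" "\<mu> (proj a) (proj b) = origin"
      using b(2) points.l_inv points.r_inv curve[OF a] by simp_all
    have "\<mu> (proj b) (\<mu> (proj a) (proj x)) = proj x" "\<mu> (proj a) (\<mu> (proj b) (proj x)) = proj x"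
      using ba curve a b(1) x by (simp_all flip: points.m_assoc)
    then show "mu_coords b (mu_coords a x) \<propto> x \<and> mu_coords a (mu_coords b x) \<propto> x"
      using a b(1) x by (simp add: mu_coords flip: proj_cone_eq_iff)
  qed
qed

abbreviation eval_pair :: "(4 + 4, 'k) mpoly ^ 4 \<Rightarrow> 'k alg_closure ^ 4 \<Rightarrow> 'k alg_closure ^ 4 \<Rightarrow> 'k alg_closure ^ 4" where
  "eval_pair p x y \<equiv> tuple_eval to_ac p (at_pair x y)"

lemma eval_law_tuples: "eval_pair (law_tuples s $ i) x y = law i x y"
proof -
  have "\<forall>i. eval_pair (law_tuples s $ i) x y = law i x y"
    unfolding forall_index4 vec_eq_iff4 by (simp add: tuple_eval_def law_tuples_def law_nth)
  then show ?thesis ..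
qed

lemma gives_on_product_iff: "gives_on_product to_ac s p \<mu> \<longleftrightarrow> gives_padd (eval_pair p)"
proof -
  have "\<mu> (proj x) (proj y) = proj (eval_pair p x y) \<longleftrightarrow> eval_pair p x y \<propto> padd x y"
    if "x \<in> cone" "y \<in> cone" "eval_pair p x y \<noteq> 0" for x y
  proof -
    have "\<mu> (proj x) (proj y) = proj (padd x y)"
      using mu_coords mu_coords_padd that padd_in_cone by (simp flip: proj_cone_eq_iff)
    then show ?thesis using that padd_nonzero by (auto simp: proj_eq_iff intro: proportional_sym)
  qed
  then show ?thesis by (auto simp: gives_on_product_def gives_padd_def curve_coords_eq)
qed

lemma biquadratic_eval_pair: "(\<And>j. bihomogeneous 2 2 (p $ j)) \<Longrightarrow> biquadratic (eval_pair p)"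
  unfolding biquadratic_def by (intro allI impI form_tuple_eval) auto

lemma ideal_tuples_eq: "ideal_tuples s = {p. \<forall>x\<in>cone. \<forall>y\<in>cone. eval_pair p x y = 0}"
  by (auto simp: ideal_tuples_def curve_coords_eq tuple_eval_def vec_eq_iff)

lemma addition_law_space_eq:
  "addition_law_space 2 2 s \<mu> = {p. (\<forall>j. bihomogeneous 2 2 (p $ j)) \<and> gives_padd (eval_pair p)}"
  by (auto simp: addition_law_space_def addition_law_def gives_on_product_iff ideal_tuples_eq gives_padd_def)

lemma subspace_ideal_tuples: "tuple.subspace (ideal_tuples s)"
  unfolding tuple.subspace_def ideal_tuples_eq
  by (auto simp: to_ac.tuple_eval_add to_ac.tuple_eval_scale) (simp add: tuple_eval_def vec_eq_iff)

lemma subspace_addition_law_space: "tuple.subspace (addition_law_space 2 2 s \<mu>)"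
proof -
  have "gives_padd (eval_pair 0)"
    by (simp add: gives_padd_def tuple_eval_def vec_eq_iff)
  moreover have "gives_padd (eval_pair (p + q))" if pq: "gives_padd (eval_pair p)" "gives_padd (eval_pair q)" for p q
    unfolding gives_padd_iff
  proof (intro ballI)
    fix x y assume "x \<in> cone" "y \<in> cone"
    with pq obtain k l where "eval_pair p x y = k *s padd x y" "eval_pair q x y = l *s padd x y"
      unfolding gives_padd_iff by blast
    then show "\<exists>k. eval_pair (p + q) x y = k *s padd x y"
      by (intro exI[of _ "k + l"]) (simp add: to_ac.tuple_eval_add vector_sadd_rdistrib)
  qed
  moreover have "gives_padd (eval_pair (tuple_scale c p))" if "gives_padd (eval_pair p)" for c p
    using that unfolding gives_padd_iff to_ac.tuple_eval_scale by (metis vector_smult_assoc)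
  ultimately show ?thesis
    unfolding tuple.subspace_def addition_law_space_eq
    by (auto simp: tuple_scale_def intro: bihomogeneous_0 bihomogeneous_add bihomogeneous_cst_mult)
qed

lemma eval_combination:
  "eval_pair (\<Sum>i\<in>UNIV. tuple_scale (c i) (law_tuples s $ i)) x y = (\<Sum>i\<in>UNIV. to_ac (c i) *s law i x y)"
  by (simp add: to_ac.tuple_eval_sum to_ac.tuple_eval_scale eval_law_tuples)

lemma basis_law_tuples: "tuple.basis_modulo (ideal_tuples s) (addition_law_space 2 2 s \<mu>) (law_tuples s)"
  unfolding tuple.basis_modulo_def
proof (intro conjI allI impI ballI)
  fix i
  show "law_tuples s $ i \<in> addition_law_space 2 2 s \<mu>"
    using gives_padd_law by (simp add: addition_law_space_eq bihomogeneous_law_tuples eval_law_tuples)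
next
  fix c i
  assume "(\<Sum>i\<in>UNIV. tuple_scale (c i) (law_tuples s $ i)) \<in> ideal_tuples s"
  then have "(\<Sum>i\<in>UNIV. to_ac (c i) *s law i x y) = 0" if "x \<in> cone" "y \<in> cone" for x y
    using that by (simp add: ideal_tuples_eq eval_combination)
  then have "to_ac (c i) = 0" by (rule law_independent)
  then show "c i = 0" by simp
next
  fix p assume "p \<in> addition_law_space 2 2 s \<mu>"
  then have p: "\<And>j. bihomogeneous 2 2 (p $ j)" "gives_padd (eval_pair p)"
    by (simp_all add: addition_law_space_eq)
  \<comment> \<open>The coefficients found over the closure have to come from the base field. They
    do, because the coefficients of \<open>p\<close>, the coordinates of \<open>org\<close>,
    \<open>s\<close> and its inverse all lie in the image \<open>?S\<close>.\<close>
  let ?S = "range to_ac :: 'k alg_closure set"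
  have S: "semiring_closed ?S"
    unfolding semiring_closed_def
    using rangeI[of "to_ac :: 'k \<Rightarrow> _" 0] rangeI[of "to_ac :: 'k \<Rightarrow> _" 1]
    by (auto simp flip: to_ac_add to_ac_mult)
  have "form ?S 2 (\<lambda>x. eval_pair p x org $ 0)"
  proof -
    have "\<forall>i. org $ i \<in> ?S"
      using S by (simp add: forall_index4 semiring_closed_def del: image_iff)
    then have "form ?S (2 * 1 + 2 * 0) (\<lambda>x. mpoly_eval to_ac (p $ 0) (at_pair x org))"
      by (intro form_mpoly_eval p S form_nth form_const) auto
    then show ?thesis by (simp add: tuple_eval_def)
  qed
  then obtain c where c: "\<And>i. c i \<in> ?S"
    "\<And>x y. x \<in> cone \<Longrightarrow> y \<in> cone \<Longrightarrow> eval_pair p x y = (\<Sum>i\<in>UNIV. c i *s law i x y)"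
    by (rule law_basis[OF biquadratic_eval_pair[OF p(1)] p(2) S rangeI
          rangeI[of to_ac "inverse s", unfolded to_ac_inverse]]) (rule that; assumption)
  have "\<forall>i. \<exists>b. c i = to_ac b" using c(1) by blast
  then obtain b where b: "\<And>i. c i = to_ac (b i)" by metis
  let ?q = "\<Sum>i\<in>UNIV. tuple_scale (b i) (law_tuples s $ i)"
  have "eval_pair (p - ?q) x y = 0" if "x \<in> cone" "y \<in> cone" for x y
  proof -
    have "eval_pair (p - ?q) x y + eval_pair ?q x y = eval_pair p x y"
      by (simp flip: to_ac.tuple_eval_add)
    then show ?thesis using c(2)[OF that] by (simp add: eval_combination b)
  qed
  then show "\<exists>c. p - (\<Sum>i\<in>UNIV. tuple_scale (c i) (law_tuples s $ i)) \<in> ideal_tuples s"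
    by (auto simp: ideal_tuples_eq)
qed

end

theorem theorem27:
  fixes s :: "'k::field"
    and \<mu> :: "('k alg_closure ^ 4) set \<Rightarrow> ('k alg_closure ^ 4) set \<Rightarrow> ('k alg_closure ^ 4) set"
  assumes "CHAR('k) = 2" and "s \<noteq> 0" and "addition_morphism s \<mu>"
  shows "tuple.subspace (ideal_tuples s) \<and> tuple.subspace (addition_law_space 2 2 s \<mu>) \<and>
    tuple.basis_modulo (ideal_tuples s) (addition_law_space 2 2 s \<mu>)
     (quad
       (quad ((Xv 0 * Yv 0 + Xv 2 * Yv 2)\<^sup>2)
             (Xv 0 * Xv 1 * Yv 0 * Yv 1 + Xv 2 * Xv 3 * Yv 2 * Yv 3)
             (cst s * (Xv 1 * Yv 1 + Xv 3 * Yv 3)\<^sup>2)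
             (Xv 0 * Xv 3 * Yv 0 * Yv 3 + Xv 1 * Xv 2 * Yv 1 * Yv 2))
       (quad (Xv 0 * Xv 1 * Yv 0 * Yv 3 + Xv 2 * Xv 3 * Yv 1 * Yv 2)
             ((Xv 1 * Yv 0 + Xv 3 * Yv 2)\<^sup>2)
             (Xv 0 * Xv 3 * Yv 2 * Yv 3 + Xv 1 * Xv 2 * Yv 0 * Yv 1)
             ((Xv 0 * Yv 3 + Xv 2 * Yv 1)\<^sup>2))
       (quad (cst s * (Xv 1 * Yv 3 + Xv 3 * Yv 1)\<^sup>2)
             (Xv 0 * Xv 3 * Yv 1 * Yv 2 + Xv 1 * Xv 2 * Yv 0 * Yv 3)
             ((Xv 0 * Yv 2 + Xv 2 * Yv 0)\<^sup>2)
             (Xv 0 * Xv 1 * Yv 2 * Yv 3 + Xv 2 * Xv 3 * Yv 0 * Yv 1))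
       (quad (Xv 0 * Xv 3 * Yv 0 * Yv 1 + Xv 1 * Xv 2 * Yv 2 * Yv 3)
             ((Xv 0 * Yv 1 + Xv 2 * Yv 3)\<^sup>2)
             (Xv 0 * Xv 1 * Yv 1 * Yv 2 + Xv 2 * Xv 3 * Yv 0 * Yv 3)
             ((Xv 1 * Yv 2 + Xv 3 * Yv 0)\<^sup>2)))"
proof -
  interpret mu4_curve s \<mu> using assms by unfold_locales
  show ?thesis
    using subspace_ideal_tuples subspace_addition_law_space basis_law_tuples
    unfolding law_tuples_def by blast
qed

end
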